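(* Let $\varphi:[0,\infty[\to[0,\infty[$ be a locally Lipschitz nondecreasing function with $\varphi(0)=0$, not identically zero. Then the equation $\Delta_kv=\varphi(v)$ admits an entire positive solution on $\mathbb{R}^d$ if and only if $\varphi$ satisfies the Keller-Osserman condition, i.e. there exists $a>0$ such that $$\int_a^\infty\frac{dt}{\sqrt{\int_0^t\varphi(s)\,ds}}=\infty .$$
   Context: Dunkl setting. $\langle\cdot,\cdot\rangle$ is the Euclidean inner product on $\mathbb{R}^d$, $|\cdot|$ its norm. For $\alpha\in\mathbb{R}^d\setminus\{0\}$, $\sigma_\alpha(x)=x-2\frac{\langle\alpha,x\rangle}{|\alpha|^2}\alpha$. $R$ is a fixed root system: a finite subset of $\mathbb{R}^d\setminus\{0\}$ with $R\cap\mathbb{R}\alpha=\{\pm\alpha\}$ and $\sigma_\alpha(R)=R$ for all $\alpha\in R$. $k:R\to]0,\infty[$ is a fixed (strictly positive) multiplicity function, i.e. $k(\sigma_\alpha\beta)=k(\beta)$ for all $\alpha,\beta\in R$. Assume $m:=d+\sum_{\alpha\in R}k(\alpha)>2$. Put $w_k(x)=\prod_{\alpha\in R}|\langle x,\alpha\rangle|^{k(\alpha)}$. The Dunkl Laplacian is, for $u\in C^2$, $\Delta_ku(x)=\Delta u(x)+\sum_{\alpha\in R}k(\alpha)\left(\frac{\langle\nabla u(x),\alpha\rangle}{\langle\alpha,x\rangle}-\frac{|\alpha|^2}{2}\frac{u(x)-u(\sigma_\alpha x)}{\langle\alpha,x\rangle^2}\right)$ (extended by continuity where $\langle\alpha,x\rangle=0$).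 An entire positive solution is a function $v\in C(\mathbb{R}^d)$, $v>0$, such that $\int_{\mathbb{R}^d}v\,\Delta_k\psi\,w_k\,dx=\int_{\mathbb{R}^d}\varphi(v)\,\psi\,w_k\,dx$ for every $\psi\in C_c^\infty(\mathbb{R}^d)$ (solution in the distributional sense). In the integral condition, $1/\sqrt{0}$ is read as $\infty$. *)

theory Defs
  imports "HOL-Analysis.Analysis"
begin

definition refl_hyp :: "'a::euclidean_space \<Rightarrow> 'a \<Rightarrow> 'a" where
  "refl_hyp \<alpha> x = x - (2 * (\<alpha> \<bullet> x) / (norm \<alpha>)\<^sup>2) *\<^sub>R \<alpha>"

definition root_system :: "'a::euclidean_space set \<Rightarrow> bool" where
  "root_system R \<longleftrightarrow>
     finite R \<and> 0 \<notin> R \<and>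
     (\<forall>\<alpha>\<in>R. R \<inter> range (\<lambda>c. c *\<^sub>R \<alpha>) = {\<alpha>, - \<alpha>} \<and> refl_hyp \<alpha> ` R = R)"

definition pos_multiplicity :: "'a::euclidean_space set \<Rightarrow> ('a \<Rightarrow> real) \<Rightarrow> bool" where
  "pos_multiplicity R k \<longleftrightarrow>
     (\<forall>\<alpha>\<in>R. k \<alpha> > 0) \<and> (\<forall>\<alpha>\<in>R. \<forall>\<beta>\<in>R. k (refl_hyp \<alpha> \<beta>) = k \<beta>)"

definition dunkl_weight :: "'a::euclidean_space set \<Rightarrow> ('a \<Rightarrow> real) \<Rightarrow> 'a \<Rightarrow> real" where
  "dunkl_weight R k x = (\<Prod>\<alpha>\<in>R. \<bar>x \<bullet> \<alpha>\<bar> powr k \<alpha>)"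

definition partial :: "'a::euclidean_space \<Rightarrow> ('a \<Rightarrow> real) \<Rightarrow> 'a \<Rightarrow> real" where
  "partial b f x = frechet_derivative f (at x) b"

definition grad :: "('a::euclidean_space \<Rightarrow> real) \<Rightarrow> 'a \<Rightarrow> 'a" where
  "grad f x = (\<Sum>b\<in>Basis. partial b f x *\<^sub>R b)"

definition laplacian :: "('a::euclidean_space \<Rightarrow> real) \<Rightarrow> 'a \<Rightarrow> real" where
  "laplacian f x = (\<Sum>b\<in>Basis. partial b (partial b f) x)"

definition dunkl_term_reg :: "'a::euclidean_space \<Rightarrow> ('a \<Rightarrow> real) \<Rightarrow> 'a \<Rightarrow> real" where
  "dunkl_term_reg \<alpha> u x =
     (grad u x \<bullet> \<alpha>) / (\<alpha> \<bullet> x)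
       - (norm \<alpha>)\<^sup>2 / 2 * ((u x - u (refl_hyp \<alpha> x)) / (\<alpha> \<bullet> x)\<^sup>2)"

text \<open>For \<open>C\<^sup>2\<close> functions each summand separately extends continuously across its own
  hyperplane, so the limit below exists and the extension can be made summand by summand.\<close>

definition dunkl_term :: "'a::euclidean_space \<Rightarrow> ('a \<Rightarrow> real) \<Rightarrow> 'a \<Rightarrow> real" where
  "dunkl_term \<alpha> u x =
     (if \<alpha> \<bullet> x \<noteq> 0 then dunkl_term_reg \<alpha> u x
      else Lim (at x within {y. \<alpha> \<bullet> y \<noteq> 0}) (dunkl_term_reg \<alpha> u))"

definition dunkl_laplacian ::
    "'a::euclidean_space set \<Rightarrow> ('a \<Rightarrow> real) \<Rightarrow> ('a \<Rightarrow> real) \<Rightarrow> 'a \<Rightarrow> real" where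
  "dunkl_laplacian R k u x = laplacian u x + (\<Sum>\<alpha>\<in>R. k \<alpha> * dunkl_term \<alpha> u x)"

text \<open>All iterated partial derivatives exist and are (totally) differentiable, hence continuous;
  \<open>bs = []\<close> is \<open>f\<close> itself.\<close>

definition smooth :: "('a::euclidean_space \<Rightarrow> real) \<Rightarrow> bool" where
  "smooth f \<longleftrightarrow> (\<forall>bs\<in>lists Basis. foldr partial bs f differentiable_on UNIV)"

definition test_functions :: "('a::euclidean_space \<Rightarrow> real) set" where
  "test_functions = {\<psi>. smooth \<psi> \<and> compact (closure {x. \<psi> x \<noteq> 0})}"

definition entire_positive_solution ::
    "'a::euclidean_space set \<Rightarrow> ('a \<Rightarrow> real) \<Rightarrow> (real \<Rightarrow> real) \<Rightarrow> ('a \<Rightarrow> real) \<Rightarrow> bool" where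
  "entire_positive_solution R k \<phi> v \<longleftrightarrow>
     continuous_on UNIV v \<and> (\<forall>x. v x > 0) \<and>
     (\<forall>\<psi>\<in>test_functions.
        (LINT x|lborel. v x * dunkl_laplacian R k \<psi> x * dunkl_weight R k x)
          = (LINT x|lborel. \<phi> (v x) * \<psi> x * dunkl_weight R k x))"

text \<open>The library notion is about families of maps with a time parameter; here the parameter is
  a dummy.\<close>

definition locally_lipschitz_on :: "real set \<Rightarrow> (real \<Rightarrow> real) \<Rightarrow> bool" where
  "locally_lipschitz_on X f \<longleftrightarrow> local_lipschitz {0::real} X (\<lambda>_. f)"

text \<open>In \<^typ>\<open>ennreal\<close>, \<open>inverse 0 = \<infinity>\<close>, which is the intended reading of \<open>1 / sqrt 0\<close>.  In
  particular the condition holds whenever \<open>\<phi>\<close> vanishes on a neighbourhood of \<open>0\<close>.\<close>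

definition keller_osserman :: "(real \<Rightarrow> real) \<Rightarrow> bool" where
  "keller_osserman \<phi> \<longleftrightarrow>
     (\<exists>a>0. (\<integral>\<^sup>+t\<in>{a..}. inverse (ennreal (sqrt (integral {0..t} \<phi>))) \<partial>lborel) = \<infinity>)"

end

theory Submission
  imports Defs "HOL-Library.Function_Algebras" "HOL-Computational_Algebra.Polynomial"
begin

text \<open>
For a function of \<open>\<bar>x\<bar>\<close> all reflection differences vanish, so the Dunkl Laplacian acts on it as the radial
Laplacian \<open>u'' + (m - 1)/r u'\<close> of the real dimension \<open>m\<close>.  Both directions compare with radial functions, and
these are governed by the one-dimensional equation \<open>Q'' = \<phi>(Q)\<close>, that is \<open>Q' = sqrt (2 \<Phi>(Q))\<close> with
\<open>\<Phi> t = integral {0..t} \<phi>\<close>; separation of variables turns the Keller-Osserman integral into the life time of \<open>Q\<close>.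

Existence.  If \<open>\<phi>\<close> vanishes near \<open>0\<close>, a small constant is a solution.  Otherwise the condition makes
\<open>B'' = \<phi>(B)\<close> globally solvable; \<open>B\<close> is a supersolution of the radial equation, and monotone iteration
from a constant, which stays below \<open>B\<close>, yields a radial \<open>C\<^sup>2\<close> solution (\<open>radial_solution_exists\<close>).  It is a
distributional solution because \<open>\<Delta>\<^sub>k\<close> is symmetric with respect to the weight (\<open>dunkl_green\<close>).

Nonexistence.  If the condition fails, then for every \<open>a > 0\<close> there is a radial supersolution \<open>u\<close> on a ball with
\<open>u 0 = a\<close> that tends to infinity at the boundary (\<open>blow_up_supersolution\<close>).  A comparison principle gives
\<open>v 0 \<le> a\<close> for every entire solution \<open>v\<close>, contradicting \<open>v 0 > 0\<close>.  At a maximum of a \<open>C\<^sup>2\<close> function the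
reflection terms have the favourable sign, so comparison is immediate for \<open>C\<^sup>2\<close> functions
(\<open>dunkl_laplacian_at_max\<close>).  An entire solution is only continuous, and convolution does not commute
with \<open>\<Delta>\<^sub>k\<close>; the smoothing used instead is approximation by polynomials.

Smoothing.  On each ball of radius \<open>\<rho>\<close> there are polynomials \<open>p\<close> with \<open>p\<close> uniformly close to \<open>v\<close> and \<open>\<Delta>\<^sub>k p\<close> uniformly
close to \<open>\<phi>(v)\<close> (\<open>distributional_approximation\<close>).  Since \<open>\<Delta>\<^sub>k\<close> lowers degrees by two,
\<open>q \<mapsto> \<Delta>\<^sub>k ((\<rho>\<^sup>2 - \<bar>x\<bar>\<^sup>2) q)\<close> maps the polynomials of bounded degree to themselves; by the maximum principle it is
injective, hence surjective (\<open>dirichlet_polynomial\<close>).  So the Dirichlet problem with polynomial data has a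
polynomial solution.  Take such solutions for data approximating \<open>v\<close> on the sphere and \<open>\<phi>(v)\<close> in the ball:
by the maximum principle they converge uniformly.  The difference \<open>z\<close> of \<open>v\<close> and the limit vanishes on the
sphere and is weakly harmonic; testing it with \<open>(\<rho>\<^sup>2 - \<bar>x\<bar>\<^sup>2) q\<close> shows that it is orthogonal to all polynomials,
so \<open>z = 0\<close>.  As test functions must be smooth with compact support, the factor \<open>\<tau> = \<rho>\<^sup>2 - \<bar>x\<bar>\<^sup>2\<close> is first replaced by
\<open>\<tau> exp (- \<delta> / \<tau>)\<close>, and \<open>\<delta>\<close> tends to \<open>0\<close> (\<open>orthogonal_boundary_factor\<close>).
\<close>

section \<open>The Dunkl Laplacian of twice continuously differentiable functions\<close>

text \<open>Gradient and Hessian are carried along explicitly, so that formulas for \<open>\<Delta>\<^sub>k\<close> can be stated and combined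
without Frechet derivatives chosen by description.\<close>

definition has_grad_hess ::
    "('a::euclidean_space \<Rightarrow> real) \<Rightarrow> ('a \<Rightarrow> 'a) \<Rightarrow> ('a \<Rightarrow> 'a \<Rightarrow> 'a) \<Rightarrow> bool" where
  "has_grad_hess f g H \<longleftrightarrow>
     (\<forall>x. (f has_derivative (\<lambda>h. g x \<bullet> h)) (at x)) \<and>
     (\<forall>x. (g has_derivative H x) (at x)) \<and>
     (\<forall>b. continuous_on UNIV (\<lambda>x. H x b))"

text \<open>On the mirror \<open>\<alpha> \<bullet> x = 0\<close> the value is the limit from outside: by Taylor's formula the first-order terms cancel
and the second derivative in direction \<open>\<alpha> / norm \<alpha>\<close> remains.\<close>

definition dunkl_term_C2 ::
    "'a::euclidean_space \<Rightarrow> ('a \<Rightarrow> real) \<Rightarrow> ('a \<Rightarrow> 'a) \<Rightarrow> ('a \<Rightarrow> 'a \<Rightarrow> 'a) \<Rightarrow> 'a \<Rightarrow> real" where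
  "dunkl_term_C2 \<alpha> f g H x =
     (if \<alpha> \<bullet> x \<noteq> 0
      then g x \<bullet> \<alpha> / (\<alpha> \<bullet> x) - (norm \<alpha>)\<^sup>2 / 2 * ((f x - f (refl_hyp \<alpha> x)) / (\<alpha> \<bullet> x)\<^sup>2)
      else H x \<alpha> \<bullet> \<alpha> / (norm \<alpha>)\<^sup>2)"

lemma has_grad_hessD:
  assumes "has_grad_hess f g H"
  shows "(f has_derivative (\<lambda>h. g x \<bullet> h)) (at x)" "(g has_derivative H x) (at x)"
    "continuous_on UNIV (\<lambda>x. H x b)"
  using assms by (auto simp: has_grad_hess_def)

lemma has_grad_hess_continuous:
  assumes "has_grad_hess f g H"
  shows "continuous_on UNIV f" "continuous_on UNIV g"
  using has_grad_hessD[OF assms] by (auto simp: continuous_on_eq_continuous_at intro: has_derivative_continuous)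

lemma has_grad_hess_line:
  assumes "has_grad_hess f g H"
  shows "((\<lambda>t. f (x + t *\<^sub>R b)) has_real_derivative g (x + t *\<^sub>R b) \<bullet> b) (at t)"
    "((\<lambda>t. g (x + t *\<^sub>R b) \<bullet> c) has_real_derivative H (x + t *\<^sub>R b) b \<bullet> c) (at t)"
proof -
  have d: "((\<lambda>t. x + t *\<^sub>R b) has_derivative (\<lambda>h. h *\<^sub>R b)) (at t)"
    by (auto intro!: derivative_eq_intros)
  have lin: "linear (H (x + t *\<^sub>R b))"
    using has_grad_hessD(2)[OF assms] has_derivative_linear by blast
  show "((\<lambda>t. f (x + t *\<^sub>R b)) has_real_derivative g (x + t *\<^sub>R b) \<bullet> b) (at t)"
    by (rule has_derivative_imp_has_field_derivative[OF has_derivative_compose[OF d has_grad_hessD(1)[OF assms]]])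
      simp
  have "((\<lambda>t. g (x + t *\<^sub>R b)) has_derivative (\<lambda>h. H (x + t *\<^sub>R b) (h *\<^sub>R b))) (at t)"
    using has_derivative_compose[OF d has_grad_hessD(2)[OF assms]] by simp
  then have "((\<lambda>t. g (x + t *\<^sub>R b) \<bullet> c) has_derivative (\<lambda>h. H (x + t *\<^sub>R b) (h *\<^sub>R b) \<bullet> c)) (at t)"
    by (rule has_derivative_inner_left)
  then show "((\<lambda>t. g (x + t *\<^sub>R b) \<bullet> c) has_real_derivative H (x + t *\<^sub>R b) b \<bullet> c) (at t)"
    by (rule has_derivative_imp_has_field_derivative) (simp add: linear_cmul[OF lin])
qed

lemma has_grad_hess_partial:
  assumes "has_grad_hess f g H"
  shows "partial b f = (\<lambda>x. g x \<bullet> b)" "partial c (partial b f) = (\<lambda>x. H x c \<bullet> b)"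
    "grad f = g" "laplacian f x = (\<Sum>b\<in>Basis. H x b \<bullet> b)"
proof -
  show 1: "partial b f = (\<lambda>x. g x \<bullet> b)" for b
    unfolding partial_def using frechet_derivative_at[OF has_grad_hessD(1)[OF assms]] by metis
  have "((\<lambda>x. g x \<bullet> b) has_derivative (\<lambda>h. H x h \<bullet> b)) (at x)" for x b
    using has_derivative_inner_left[OF has_grad_hessD(2)[OF assms]] .
  then show 2: "partial c (partial b f) = (\<lambda>x. H x c \<bullet> b)" for b c
    unfolding 1 unfolding partial_def using frechet_derivative_at by metis
  show "grad f = g"
    unfolding grad_def 1 by (simp add: euclidean_representation)
  show "laplacian f x = (\<Sum>b\<in>Basis. H x b \<bullet> b)"
    unfolding laplacian_def 2 ..
qed

lemma norm_refl_hyp [simp]: "norm (refl_hyp \<alpha> x) = norm x"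
proof (cases "\<alpha> = 0")
  case False
  define c where "c = 2 * (\<alpha> \<bullet> x) / (norm \<alpha>)\<^sup>2"
  have c: "c * (norm \<alpha>)\<^sup>2 = 2 * (\<alpha> \<bullet> x)" using False by (simp add: c_def)
  have "(norm (refl_hyp \<alpha> x))\<^sup>2 = (norm x)\<^sup>2 - 2 * c * (\<alpha> \<bullet> x) + c * (c * (norm \<alpha>)\<^sup>2)"
    unfolding power2_norm_eq_inner refl_hyp_def c_def[unfolded power2_norm_eq_inner, symmetric]
    by (simp add: algebra_simps inner_commute)
  then have "(norm (refl_hyp \<alpha> x))\<^sup>2 = (norm x)\<^sup>2" unfolding c by simp
  then show ?thesis by simp
qed (simp add: refl_hyp_def)

lemma refl_hyp_adjoint: "refl_hyp \<alpha> x \<bullet> y = x \<bullet> refl_hyp \<alpha> y"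
  by (simp add: refl_hyp_def algebra_simps inner_commute)

lemma inner_refl_hyp_self: "\<alpha> \<noteq> 0 \<Longrightarrow> \<alpha> \<bullet> refl_hyp \<alpha> x = - (\<alpha> \<bullet> x)"
  by (simp add: refl_hyp_def algebra_simps power2_norm_eq_inner)

lemma refl_hyp_involution [simp]: "refl_hyp \<alpha> (refl_hyp \<alpha> x) = x"
proof (cases "\<alpha> = 0")
  case False
  then show ?thesis
    using inner_refl_hyp_self[OF False, of x] by (simp add: refl_hyp_def [of \<alpha> "refl_hyp \<alpha> x"])
      (simp add: refl_hyp_def)
qed (simp add: refl_hyp_def)

lemma continuous_refl_hyp [continuous_intros]:
  "continuous_on S f \<Longrightarrow> continuous_on S (\<lambda>x. refl_hyp \<alpha> (f x))"
  unfolding refl_hyp_def divide_inverse by (intro continuous_intros)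

text \<open>Taylor's formula on the segment from \<open>y\<close> to its mirror image: the gradient term cancels the first-order part of
the difference quotient.  This is why the summand is bounded by second derivatives and extends continuously across
the mirror, although it contains \<open>(\<alpha> \<bullet> y)\<^sup>2\<close> in a denominator.\<close>

lemma dunkl_term_C2_eq_hess:
  assumes f: "has_grad_hess f g H" and "\<alpha> \<noteq> 0"
  obtains z where "norm (z - y) \<le> 2 * norm y"
    "norm (z - y) \<le> 2 * \<bar>\<alpha> \<bullet> y\<bar> / norm \<alpha>"
    "dunkl_term_C2 \<alpha> f g H y = H z \<alpha> \<bullet> \<alpha> / (norm \<alpha>)\<^sup>2"
proof (cases "\<alpha> \<bullet> y = 0")
  case True
  with that[of y] show ?thesis by (simp add: dunkl_term_C2_def)
next
  case False
  define c where "c = - (2 * (\<alpha> \<bullet> y) / (norm \<alpha>)\<^sup>2)"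
  define diff where "diff = (\<lambda>n::nat. if n = 0 then (\<lambda>s. f (y + s *\<^sub>R \<alpha>))
     else if n = 1 then (\<lambda>s. g (y + s *\<^sub>R \<alpha>) \<bullet> \<alpha>) else (\<lambda>s. H (y + s *\<^sub>R \<alpha>) \<alpha> \<bullet> \<alpha>))"
  have "\<forall>m t. m < 2 \<and> \<bar>t\<bar> \<le> \<bar>c\<bar> \<longrightarrow> (diff m has_real_derivative diff (Suc m) t) (at t)"
    using has_grad_hess_line[OF f, of y \<alpha>] by (auto simp: diff_def less_2_cases_iff)
  from Maclaurin_bi_le[OF refl this] obtain t where t: "\<bar>t\<bar> \<le> \<bar>c\<bar>"
    and e: "diff 0 c = (\<Sum>m<2. diff m 0 / fact m * c ^ m) + diff 2 t / fact 2 * c ^ 2" by blast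
  have n0: "norm \<alpha> > 0" using assms by simp
  have refl: "refl_hyp \<alpha> y = y + c *\<^sub>R \<alpha>" by (simp add: refl_hyp_def c_def)
  have e': "f (refl_hyp \<alpha> y) = f y + c * (g y \<bullet> \<alpha>) + c\<^sup>2 / 2 * (H (y + t *\<^sub>R \<alpha>) \<alpha> \<bullet> \<alpha>)"
    using e by (simp add: diff_def refl numeral_2_eq_2)
  have "\<bar>t\<bar> * norm \<alpha> \<le> \<bar>c\<bar> * norm \<alpha>" using t n0 by simp
  also have cn: "\<bar>c\<bar> * norm \<alpha> = 2 * \<bar>\<alpha> \<bullet> y\<bar> / norm \<alpha>"
    using n0 by (simp add: c_def abs_mult power2_eq_square)
  finally have b1: "norm (y + t *\<^sub>R \<alpha> - y) \<le> 2 * \<bar>\<alpha> \<bullet> y\<bar> / norm \<alpha>" by simp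
  also have "\<dots> \<le> 2 * norm y"
    using Cauchy_Schwarz_ineq2[of \<alpha> y] n0 by (simp add: divide_simps mult.commute)
  finally have b2: "norm (y + t *\<^sub>R \<alpha> - y) \<le> 2 * norm y" .
  have "dunkl_term_C2 \<alpha> f g H y = H (y + t *\<^sub>R \<alpha>) \<alpha> \<bullet> \<alpha> / (norm \<alpha>)\<^sup>2"
  proof -
    define N t' G h where "N = (norm \<alpha>)\<^sup>2" and "t' = \<alpha> \<bullet> y" and "G = g y \<bullet> \<alpha>"
      and "h = H (y + t *\<^sub>R \<alpha>) \<alpha> \<bullet> \<alpha>"
    have N: "N \<noteq> 0" using n0 by (simp add: N_def)
    have t': "t' \<noteq> 0" using False by (simp add: t'_def)
    have "G / t' - N / 2 * ((f y - (f y + c * G + c\<^sup>2 / 2 * h)) / t'\<^sup>2) = h / N"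
      using N t' unfolding c_def N_def[symmetric] t'_def[symmetric]
      by (simp add: divide_simps power2_eq_square) (simp add: algebra_simps)
    then show ?thesis
      using False unfolding dunkl_term_C2_def e' N_def G_def h_def t'_def by simp
  qed
  from that[OF b2 b1 this] show ?thesis .
qed

lemma dunkl_term_C2_tendsto:
  assumes f: "has_grad_hess f g H" and a: "\<alpha> \<noteq> 0" and x: "\<alpha> \<bullet> x = 0"
  shows "(dunkl_term_C2 \<alpha> f g H \<longlongrightarrow> dunkl_term_C2 \<alpha> f g H x) (at x)"
proof -
  have "\<forall>y. \<exists>z. norm (z - y) \<le> 2 * \<bar>\<alpha> \<bullet> y\<bar> / norm \<alpha>
     \<and> dunkl_term_C2 \<alpha> f g H y = H z \<alpha> \<bullet> \<alpha> / (norm \<alpha>)\<^sup>2"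
    using dunkl_term_C2_eq_hess[OF f a] by metis
  then obtain z where z: "\<And>y. norm (z y - y) \<le> 2 * \<bar>\<alpha> \<bullet> y\<bar> / norm \<alpha>"
     "\<And>y. dunkl_term_C2 \<alpha> f g H y = H (z y) \<alpha> \<bullet> \<alpha> / (norm \<alpha>)\<^sup>2" by metis
  have zx: "z x = x" using z(1)[of x] x by simp
  have "((\<lambda>y. z y - y) \<longlongrightarrow> 0) (at x)"
  proof (rule Lim_null_comparison)
    show "\<forall>\<^sub>F y in at x. norm (z y - y) \<le> 2 * \<bar>\<alpha> \<bullet> y\<bar> / norm \<alpha>" using z by simp
    have "((\<lambda>y. 2 * \<bar>\<alpha> \<bullet> y\<bar> / norm \<alpha>) \<longlongrightarrow> 2 * \<bar>\<alpha> \<bullet> x\<bar> / norm \<alpha>) (at x)"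
      using a by (intro tendsto_intros) auto
    then show "((\<lambda>y. 2 * \<bar>\<alpha> \<bullet> y\<bar> / norm \<alpha>) \<longlongrightarrow> 0) (at x)" using x by simp
  qed
  from tendsto_add[OF this tendsto_ident_at] have zl: "(z \<longlongrightarrow> x) (at x)" by simp
  have "isCont (\<lambda>z. H z \<alpha>) x"
    using has_grad_hessD(3)[OF f] by (simp add: continuous_on_eq_continuous_at)
  from isCont_tendsto_compose[OF this zl]
  have "((\<lambda>y. H (z y) \<alpha> \<bullet> \<alpha> / (norm \<alpha>)\<^sup>2) \<longlongrightarrow> H x \<alpha> \<bullet> \<alpha> / (norm \<alpha>)\<^sup>2) (at x)"
    using a by (intro tendsto_intros) auto
  moreover have "dunkl_term_C2 \<alpha> f g H = (\<lambda>y. H (z y) \<alpha> \<bullet> \<alpha> / (norm \<alpha>)\<^sup>2)"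
    by (rule ext) (rule z(2))
  ultimately show ?thesis unfolding z(2)[of x] zx by (simp only:)
qed

lemma continuous_dunkl_term_C2:
  assumes f: "has_grad_hess f g H" and a: "\<alpha> \<noteq> 0"
  shows "continuous_on UNIV (dunkl_term_C2 \<alpha> f g H)"
proof -
  let ?S = "{y. \<alpha> \<bullet> y \<noteq> 0}"
  have op: "open ?S" by (rule open_Collect_neq) (intro continuous_on_inner continuous_on_const continuous_on_id)+
  have "continuous_on ?S (\<lambda>x. g x \<bullet> \<alpha> / (\<alpha> \<bullet> x)
      - (norm \<alpha>)\<^sup>2 / 2 * ((f x - f (refl_hyp \<alpha> x)) / (\<alpha> \<bullet> x)\<^sup>2))"
    using continuous_on_subset[OF has_grad_hess_continuous(1)[OF f]]
      continuous_on_subset[OF has_grad_hess_continuous(2)[OF f]]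
      continuous_on_compose2[OF has_grad_hess_continuous(1)[OF f] continuous_refl_hyp[OF continuous_on_id]]
    by (intro continuous_on_diff continuous_on_divide continuous_on_mult continuous_on_power
        continuous_on_inner continuous_on_const continuous_on_id) auto
  then have c: "continuous_on ?S (dunkl_term_C2 \<alpha> f g H)"
    by (rule continuous_on_eq) (simp add: dunkl_term_C2_def)
  have "isCont (dunkl_term_C2 \<alpha> f g H) x" for x
  proof (cases "\<alpha> \<bullet> x = 0")
    case True
    then show ?thesis using dunkl_term_C2_tendsto[OF f a] by (simp add: isCont_def)
  next
    case False
    then show ?thesis using c op by (simp add: continuous_on_eq_continuous_at)
  qed
  then show ?thesis by (simp add: continuous_on_eq_continuous_at)
qed

text \<open>The complement of the mirror accumulates at every point of the mirror, so the limit in \<open>dunkl_term\<close> is unique.\<close>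

lemma dunkl_term_eq:
  assumes f: "has_grad_hess f g H" and a: "\<alpha> \<noteq> 0"
  shows "dunkl_term \<alpha> f x = dunkl_term_C2 \<alpha> f g H x"
proof (cases "\<alpha> \<bullet> x = 0")
  case False
  then show ?thesis
    by (simp add: dunkl_term_def dunkl_term_reg_def dunkl_term_C2_def has_grad_hess_partial(3)[OF f])
next
  case True
  let ?S = "{y. \<alpha> \<bullet> y \<noteq> 0}"
  have "(dunkl_term_C2 \<alpha> f g H \<longlongrightarrow> dunkl_term_C2 \<alpha> f g H x) (at x within ?S)"
    using dunkl_term_C2_tendsto[OF f a True] by (rule tendsto_within_subset) simp
  moreover have "\<forall>\<^sub>F y in at x within ?S. dunkl_term_C2 \<alpha> f g H y = dunkl_term_reg \<alpha> f y"
    by (simp add: eventually_at_filter dunkl_term_C2_def dunkl_term_reg_def has_grad_hess_partial(3)[OF f])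
  ultimately have l: "(dunkl_term_reg \<alpha> f \<longlongrightarrow> dunkl_term_C2 \<alpha> f g H x) (at x within ?S)"
    by (simp cong: tendsto_cong)
  have "x islimpt ?S"
    unfolding islimpt_approachable
  proof (intro allI impI)
    fix e :: real assume e: "e > 0"
    have n: "norm \<alpha> > 0" using a by simp
    have "norm ((e / (2 * norm \<alpha>)) *\<^sub>R \<alpha>) < e" using e n by simp
    then show "\<exists>x'\<in>?S. x' \<noteq> x \<and> dist x' x < e"
      using e n True a by (intro bexI[of _ "x + (e / (2 * norm \<alpha>)) *\<^sub>R \<alpha>"])
        (auto simp: dist_norm inner_add_right simp del: norm_scaleR)
  qed
  then have "at x within ?S \<noteq> bot" by (simp add: trivial_limit_within)
  with l show ?thesis using True by (simp add: dunkl_term_def tendsto_Lim)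
qed

lemma has_grad_hess_add:
  assumes "has_grad_hess f g H" "has_grad_hess f' g' H'"
  shows "has_grad_hess (\<lambda>x. f x + f' x) (\<lambda>x. g x + g' x) (\<lambda>x h. H x h + H' x h)"
  using assms unfolding has_grad_hess_def inner_add_left
  by (intro conjI allI has_derivative_add continuous_on_add) auto

lemma has_grad_hess_cmult:
  assumes "has_grad_hess f g H"
  shows "has_grad_hess (\<lambda>x. c * f x) (\<lambda>x. c *\<^sub>R g x) (\<lambda>x h. c *\<^sub>R H x h)"
  using assms unfolding has_grad_hess_def
  by (auto intro!: derivative_eq_intros continuous_intros)

lemma has_grad_hess_const: "has_grad_hess (\<lambda>x. c) (\<lambda>x. 0) (\<lambda>x h. 0)"
  unfolding has_grad_hess_def inner_zero_left by auto

lemma has_grad_hess_mult: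
  assumes "has_grad_hess f g H" "has_grad_hess f' g' H'"
  shows "has_grad_hess (\<lambda>x. f x * f' x) (\<lambda>x. f x *\<^sub>R g' x + f' x *\<^sub>R g x)
     (\<lambda>x h. f x *\<^sub>R H' x h + (g x \<bullet> h) *\<^sub>R g' x + f' x *\<^sub>R H x h + (g' x \<bullet> h) *\<^sub>R g x)"
  unfolding has_grad_hess_def
proof (intro conjI allI)
  fix x
  note d = has_grad_hessD[OF assms(1)] has_grad_hessD[OF assms(2)]
  show "((\<lambda>x. f x * f' x) has_derivative (\<lambda>h. (f x *\<^sub>R g' x + f' x *\<^sub>R g x) \<bullet> h)) (at x)"
    by (rule has_derivative_eq_rhs[OF has_derivative_mult[OF d(1,4)]])
      (auto simp: fun_eq_iff algebra_simps)
  show "((\<lambda>x. f x *\<^sub>R g' x + f' x *\<^sub>R g x) has_derivative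
    (\<lambda>h. f x *\<^sub>R H' x h + (g x \<bullet> h) *\<^sub>R g' x + f' x *\<^sub>R H x h + (g' x \<bullet> h) *\<^sub>R g x)) (at x)"
    by (rule has_derivative_eq_rhs[OF has_derivative_add[OF
          has_derivative_scaleR[OF d(1,5)] has_derivative_scaleR[OF d(4,2)]]])
      (auto simp: fun_eq_iff algebra_simps)
  show "continuous_on UNIV (\<lambda>x. f x *\<^sub>R H' x b + (g x \<bullet> b) *\<^sub>R g' x + f' x *\<^sub>R H x b + (g' x \<bullet> b) *\<^sub>R g x)" for b
    by (intro continuous_intros has_grad_hess_continuous[OF assms(1)] has_grad_hess_continuous[OF assms(2)]
      has_grad_hessD(3)[OF assms(1)] has_grad_hessD(3)[OF assms(2)])
qed

lemma has_grad_hess_smooth: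
  assumes "smooth f"
  shows "has_grad_hess f (grad f) (\<lambda>x h. \<Sum>b\<in>Basis. \<Sum>c\<in>Basis. ((h \<bullet> c) * partial c (partial b f) x) *\<^sub>R b)"
proof -
  have sm: "bs \<in> lists Basis \<Longrightarrow> foldr partial bs f differentiable_on UNIV" for bs
    using assms by (auto simp: smooth_def)
  have der: "(F has_derivative (\<lambda>h. \<Sum>b\<in>Basis. (h \<bullet> b) * partial b F x)) (at x)"
    if "F differentiable_on UNIV" for F :: "'a \<Rightarrow> real" and x
  proof -
    have "F differentiable at x" using that by (auto simp: differentiable_on_def)
    then have d: "(F has_derivative frechet_derivative F (at x)) (at x)"
      by (simp add: frechet_derivative_works)
    have lin: "linear (frechet_derivative F (at x))" using d has_derivative_linear by blast
    have "frechet_derivative F (at x) h = (\<Sum>b\<in>Basis. (h \<bullet> b) * partial b F x)" for h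
    proof -
      have "frechet_derivative F (at x) h = frechet_derivative F (at x) (\<Sum>b\<in>Basis. (h \<bullet> b) *\<^sub>R b)"
        by (simp add: euclidean_representation)
      also have "\<dots> = (\<Sum>b\<in>Basis. (h \<bullet> b) * partial b F x)"
        by (simp add: linear_sum[OF lin] linear_cmul[OF lin] partial_def)
      finally show ?thesis .
    qed
    then have "frechet_derivative F (at x) = (\<lambda>h. \<Sum>b\<in>Basis. (h \<bullet> b) * partial b F x)" ..
    with d show ?thesis by simp
  qed
  have 0: "f differentiable_on UNIV" using sm[of "[]"] by simp
  have 1: "b \<in> Basis \<Longrightarrow> partial b f differentiable_on UNIV" for b using sm[of "[b]"] by simp
  have 2: "b \<in> Basis \<Longrightarrow> c \<in> Basis \<Longrightarrow> partial c (partial b f) differentiable_on UNIV" for b c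
    using sm[of "[c,b]"] by simp
  show ?thesis unfolding has_grad_hess_def
  proof (intro conjI allI)
    fix x b
    show "(f has_derivative (\<lambda>h. grad f x \<bullet> h)) (at x)"
      by (rule has_derivative_eq_rhs[OF der[OF 0]])
        (simp add: grad_def inner_sum_left inner_sum_right fun_eq_iff inner_commute mult.commute)
    show "(grad f has_derivative (\<lambda>h. \<Sum>b\<in>Basis. \<Sum>c\<in>Basis. ((h \<bullet> c) * partial c (partial b f) x) *\<^sub>R b)) (at x)"
      unfolding grad_def[abs_def]
      by (rule has_derivative_eq_rhs, rule has_derivative_sum, rule has_derivative_scaleR_left[OF der[OF 1]])
        (auto simp: fun_eq_iff scaleR_sum_left)
    show "continuous_on UNIV (\<lambda>x. \<Sum>ba\<in>Basis. \<Sum>c\<in>Basis. ((b \<bullet> c) * partial c (partial ba f) x) *\<^sub>R ba)"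
      by (intro continuous_intros differentiable_imp_continuous_on 2)
  qed
qed

lemma dunkl_term_C2_linear:
  "dunkl_term_C2 \<alpha> (\<lambda>x. f x + c * f' x) (\<lambda>x. g x + c *\<^sub>R g' x) (\<lambda>x h. H x h + c *\<^sub>R H' x h) x
     = dunkl_term_C2 \<alpha> f g H x + c * dunkl_term_C2 \<alpha> f' g' H' x"
proof -
  have *: "(gx + c * g'x) / t - N * ((a + c * b - (a' + c * b')) / t2)
      = gx / t - N * ((a - a') / t2) + c * (g'x / t - N * ((b - b') / t2))"
    for gx g'x t N a b a' b' t2 :: real
    by (simp add: divide_inverse algebra_simps)
  have "(if t \<noteq> 0 then (gx + c * g'x) / t - N * ((a + c * b - (a' + c * b')) / t2) else (h + c * h') / M)
      = (if t \<noteq> 0 then gx / t - N * ((a - a') / t2) else h / M)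
        + c * (if t \<noteq> 0 then g'x / t - N * ((b - b') / t2) else h' / M)"
    for gx g'x t N a b a' b' t2 h h' M :: real
    unfolding * by (simp add: add_divide_distrib)
  then show ?thesis
    unfolding dunkl_term_C2_def inner_add_left inner_scaleR_left .
qed

locale dunkl_setting =
  fixes R :: "'a::euclidean_space set" and k :: "'a \<Rightarrow> real" and m :: real
  assumes root: "root_system R" and mult: "pos_multiplicity R k"
    and m_eq: "m = real DIM('a) + (\<Sum>\<alpha>\<in>R. k \<alpha>)" and m_gt: "m > 2"
begin

lemma finite_R [simp]: "finite R"
  using root by (simp add: root_system_def)

lemma R_nonzero: "\<alpha> \<in> R \<Longrightarrow> \<alpha> \<noteq> 0"
  using root unfolding root_system_def by metis

lemma refl_R: "\<alpha> \<in> R \<Longrightarrow> refl_hyp \<alpha> ` R = R"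
  using root unfolding root_system_def by metis

lemma k_pos: "\<alpha> \<in> R \<Longrightarrow> k \<alpha> > 0" and k_refl: "\<alpha> \<in> R \<Longrightarrow> \<beta> \<in> R \<Longrightarrow> k (refl_hyp \<alpha> \<beta>) = k \<beta>"
  using mult by (auto simp: pos_multiplicity_def)

lemma dunkl_laplacian_eq:
  assumes f: "has_grad_hess f g H"
  shows "dunkl_laplacian R k f x =
    (\<Sum>b\<in>Basis. H x b \<bullet> b) + (\<Sum>\<alpha>\<in>R. k \<alpha> * dunkl_term_C2 \<alpha> f g H x)"
  unfolding dunkl_laplacian_def has_grad_hess_partial(4)[OF f]
  by (simp add: dunkl_term_eq[OF f R_nonzero])

lemma continuous_dunkl_laplacian:
  assumes f: "has_grad_hess f g H"
  shows "continuous_on UNIV (dunkl_laplacian R k f)"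
proof -
  have "continuous_on UNIV (\<lambda>x. (\<Sum>b\<in>Basis. H x b \<bullet> b) + (\<Sum>\<alpha>\<in>R. k \<alpha> * dunkl_term_C2 \<alpha> f g H x))"
    by (intro continuous_on_add continuous_on_sum continuous_on_mult_left continuous_on_inner
        continuous_on_const has_grad_hessD(3)[OF f] continuous_dunkl_term_C2[OF f R_nonzero])
  then show ?thesis
    by (rule continuous_on_eq) (rule dunkl_laplacian_eq[OF f, symmetric])
qed

lemma dunkl_laplacian_const: "dunkl_laplacian R k (\<lambda>x. c) x = 0"
proof -
  have "dunkl_term_C2 \<alpha> (\<lambda>x. c) (\<lambda>x. 0) (\<lambda>x h. 0) x = 0" for \<alpha>
    unfolding dunkl_term_C2_def by simp
  then show ?thesis by (simp add: dunkl_laplacian_eq[OF has_grad_hess_const])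
qed

lemma dunkl_laplacian_linear:
  assumes f: "has_grad_hess f g H" and f': "has_grad_hess f' g' H'"
  shows "dunkl_laplacian R k (\<lambda>x. f x + c * f' x) x = dunkl_laplacian R k f x + c * dunkl_laplacian R k f' x"
  unfolding dunkl_laplacian_eq[OF has_grad_hess_add[OF f has_grad_hess_cmult[OF f']]]
    dunkl_laplacian_eq[OF f] dunkl_laplacian_eq[OF f'] dunkl_term_C2_linear
  by (simp add: inner_add_left sum.distrib sum_distrib_left distrib_left mult.left_commute)

end

section \<open>Reflections and translations preserve Lebesgue measure\<close>

lemma integrable_compact_support:
  fixes h :: "'a::euclidean_space \<Rightarrow> real"
  assumes c: "continuous_on UNIV h" and z: "\<And>x. norm x > \<rho> \<Longrightarrow> h x = 0"
  shows "integrable lborel h"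
proof -
  have "integrable lborel (\<lambda>x. indicator (cball 0 \<rho>) x *\<^sub>R h x)"
    by (intro borel_integrable_compact compact_cball continuous_on_subset[OF c]) auto
  also have "(\<lambda>x. indicator (cball 0 \<rho>) x *\<^sub>R h x) = h"
    using z by (auto simp: fun_eq_iff indicator_def not_le)
  finally show ?thesis .
qed

lemma nn_integral_lborel_plus:
  fixes c :: "'a::euclidean_space"
  assumes "f \<in> borel_measurable borel"
  shows "(\<integral>\<^sup>+x. f (c + x) \<partial>lborel) = (\<integral>\<^sup>+x. f x \<partial>lborel)"
proof -
  have "(\<integral>\<^sup>+x. f x \<partial>lborel) = (\<integral>\<^sup>+x. f x \<partial>(distr lborel borel ((+) c)))"
    by (simp add: lborel_distr_plus)
  also have "\<dots> = (\<integral>\<^sup>+x. f (c + x) \<partial>lborel)"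
    using assms by (subst nn_integral_distr) auto
  finally show ?thesis ..
qed

lemma nn_integral_lborel_diff:
  fixes c :: "'a::euclidean_space"
  assumes "f \<in> borel_measurable borel"
  shows "(\<integral>\<^sup>+x. f (c - x) \<partial>lborel) = (\<integral>\<^sup>+x. f x \<partial>lborel)"
proof -
  have "(lborel :: 'a measure) = density (distr lborel borel (\<lambda>x. c + (-1) *\<^sub>R x)) (\<lambda>_. ennreal (\<bar>-1\<bar>^DIM('a)))"
    by (rule lborel_affine) simp
  then have "(lborel :: 'a measure) = distr lborel borel (\<lambda>x. c - x)"
    by (simp add: density_1)
  then have "(\<integral>\<^sup>+x. f x \<partial>lborel) = (\<integral>\<^sup>+x. f x \<partial>(distr lborel borel (\<lambda>x. c - x)))"
    by simp
  also have "\<dots> = (\<integral>\<^sup>+x. f (c - x) \<partial>lborel)"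
    using assms by (subst nn_integral_distr) auto
  finally show ?thesis ..
qed

lemma linear_refl_hyp: "linear (refl_hyp \<alpha>)"
  by (rule linearI) (simp_all add: refl_hyp_def inner_add_right algebra_simps add_divide_distrib)

lemma measurable_refl_hyp [measurable]: "refl_hyp \<alpha> \<in> borel_measurable borel"
  by (intro borel_measurable_continuous_onI continuous_refl_hyp continuous_on_id)

text \<open>The image of Lebesgue measure under a reflection is translation invariant, and two translation invariant measures
are proportional.  In detail, let \<open>\<mu>\<close> be the image of Lebesgue measure \<open>\<nu>\<close> under the reflection \<open>T\<close> and \<open>B\<close> the unit ball,
which \<open>T\<close> preserves: computing \<open>\<integral>\<integral> 1\<^sub>A(Tx) 1\<^sub>B(Tx + y) dy dx\<close> in both orders gives \<open>\<mu>(A) \<nu>(B) = \<nu>(A) \<nu>(B)\<close>.\<close>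

lemma lborel_distr_refl_hyp: "distr lborel borel (refl_hyp \<alpha>) = (lborel :: 'a::euclidean_space measure)"
proof (rule measure_eqI)
  let ?T = "refl_hyp \<alpha> :: 'a \<Rightarrow> 'a" and ?B = "ball 0 1 :: 'a set"
  fix A assume "A \<in> sets (distr lborel borel ?T)"
  then have A [measurable]: "A \<in> sets borel" by simp
  have [measurable]: "?B \<in> sets borel" by simp
  have TB: "?T x \<in> ?B \<longleftrightarrow> x \<in> ?B" for x by simp
  have Tm: "?T (- ?T y + x) = ?T x - y" for x y
    by (simp add: linear_diff[OF linear_refl_hyp])
  have mT: "emeasure (distr lborel borel ?T) A = (\<integral>\<^sup>+x. indicator A (?T x) \<partial>lborel)"
  proof -
    have "emeasure (distr lborel borel ?T) A = (\<integral>\<^sup>+x. indicator A x \<partial>distr lborel borel ?T)"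
      by (rule nn_integral_indicator[symmetric]) simp
    also have "\<dots> = (\<integral>\<^sup>+x. indicator A (?T x) \<partial>lborel)"
      by (rule nn_integral_distr) auto
    finally show ?thesis .
  qed
  have "(\<integral>\<^sup>+x. \<integral>\<^sup>+y. indicator A (?T x) * indicator ?B (?T x + y) \<partial>lborel \<partial>lborel)
      = (\<integral>\<^sup>+x. indicator A (?T x) * emeasure lborel ?B \<partial>lborel)"
  proof (rule nn_integral_cong)
    fix x
    have "(\<integral>\<^sup>+y. indicator A (?T x) * indicator ?B (?T x + y) \<partial>lborel)
      = indicator A (?T x) * (\<integral>\<^sup>+y. indicator ?B (?T x + y) \<partial>lborel)"
      by (rule nn_integral_cmult) measurable
    also have "(\<integral>\<^sup>+y. indicator ?B (?T x + y) \<partial>lborel) = (\<integral>\<^sup>+y. indicator ?B y \<partial>lborel)"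
      by (rule nn_integral_lborel_plus) measurable
    finally show "(\<integral>\<^sup>+y. indicator A (?T x) * indicator ?B (?T x + y) \<partial>lborel)
      = indicator A (?T x) * emeasure lborel ?B" by simp
  qed
  also have "\<dots> = emeasure (distr lborel borel ?T) A * emeasure lborel ?B"
    unfolding mT by (rule nn_integral_multc) measurable
  finally have 1: "(\<integral>\<^sup>+x. \<integral>\<^sup>+y. indicator A (?T x) * indicator ?B (?T x + y) \<partial>lborel \<partial>lborel)
      = emeasure (distr lborel borel ?T) A * emeasure lborel ?B" .
  (* Other order: translate x by - T y in the inner integral, then reflect and translate y. *)
  have "(\<integral>\<^sup>+x. \<integral>\<^sup>+y. indicator A (?T x) * indicator ?B (?T x + y) \<partial>lborel \<partial>lborel)
     = (\<integral>\<^sup>+y. \<integral>\<^sup>+x. indicator A (?T x) * indicator ?B (?T x + y) \<partial>lborel \<partial>lborel)"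
    by (rule lborel_pair.Fubini') measurable
  also have "\<dots> = (\<integral>\<^sup>+y. \<integral>\<^sup>+x. indicator A (?T x - y) * indicator ?B (?T x) \<partial>lborel \<partial>lborel)"
  proof (rule nn_integral_cong)
    fix y
    have "(\<integral>\<^sup>+x. indicator A (?T x) * indicator ?B (?T x + y) \<partial>lborel)
      = (\<integral>\<^sup>+x. indicator A (?T (- ?T y + x)) * indicator ?B (?T (- ?T y + x) + y) \<partial>lborel)"
      by (rule nn_integral_lborel_plus[symmetric]) measurable
    then show "(\<integral>\<^sup>+x. indicator A (?T x) * indicator ?B (?T x + y) \<partial>lborel)
      = (\<integral>\<^sup>+x. indicator A (?T x - y) * indicator ?B (?T x) \<partial>lborel)"
      unfolding Tm by simp
  qed
  also have "\<dots> = (\<integral>\<^sup>+x. \<integral>\<^sup>+y. indicator A (?T x - y) * indicator ?B (?T x) \<partial>lborel \<partial>lborel)"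
    by (rule lborel_pair.Fubini') measurable
  also have "\<dots> = (\<integral>\<^sup>+x. emeasure lborel A * indicator ?B x \<partial>lborel)"
  proof (rule nn_integral_cong)
    fix x
    have "(\<integral>\<^sup>+y. indicator A (?T x - y) * indicator ?B (?T x) \<partial>lborel)
      = (\<integral>\<^sup>+y. indicator A (?T x - y) \<partial>lborel) * indicator ?B (?T x)"
      by (rule nn_integral_multc) measurable
    also have "(\<integral>\<^sup>+y. indicator A (?T x - y) \<partial>lborel) = (\<integral>\<^sup>+y. indicator A y \<partial>lborel)"
      by (rule nn_integral_lborel_diff) measurable
    also have "\<dots> = emeasure lborel A" by (rule nn_integral_indicator) simp
    finally have "(\<integral>\<^sup>+y. indicator A (?T x - y) * indicator ?B (?T x) \<partial>lborel)
      = emeasure lborel A * indicator ?B (?T x)" .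
    moreover have "indicator ?B (?T x) = (indicator ?B x :: ennreal)"
      by (simp only: indicator_def TB)
    ultimately show "(\<integral>\<^sup>+y. indicator A (?T x - y) * indicator ?B (?T x) \<partial>lborel)
      = emeasure lborel A * indicator ?B x" by (simp only:)
  qed
  also have "\<dots> = emeasure lborel A * emeasure lborel ?B"
    by (simp add: nn_integral_cmult_indicator)
  finally have "emeasure (distr lborel borel ?T) A * emeasure lborel ?B = emeasure lborel A * emeasure lborel ?B"
    using 1 by simp
  moreover have "emeasure lborel ?B \<noteq> 0"
  proof
    assume "emeasure lborel ?B = 0"
    then have "?B \<in> null_sets lborel" by auto
    then have "negligible ?B" by (simp add: negligible_iff_null_sets null_sets_completionI)
    then show False using open_not_negligible[of ?B] by simp
  qed
  moreover have "emeasure lborel ?B \<noteq> \<infinity>"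
    using emeasure_bounded_finite[of ?B] by auto
  ultimately show "emeasure (distr lborel borel ?T) A = emeasure lborel A"
    by (simp add: mult.commute[of _ "emeasure lborel ?B"] ennreal_mult_cancel_left)
qed simp

lemma integral_refl_hyp:
  fixes f :: "'a::euclidean_space \<Rightarrow> real"
  assumes [measurable]: "f \<in> borel_measurable borel"
  shows "(LINT x|lborel. f (refl_hyp \<alpha> x)) = (LINT x|lborel. f x)"
proof -
  have "(LINT x|lborel. f x) = (LINT x|distr lborel borel (refl_hyp \<alpha>). f x)"
    by (simp add: lborel_distr_refl_hyp)
  also have "\<dots> = (LINT x|lborel. f (refl_hyp \<alpha> x))"
    by (rule integral_distr) measurable
  finally show ?thesis ..
qed

lemma integral_translate:
  fixes f :: "'a::euclidean_space \<Rightarrow> real"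
  assumes [measurable]: "f \<in> borel_measurable borel"
  shows "(LINT x|lborel. f (c + x)) = (LINT x|lborel. f x)"
proof -
  have "(LINT x|lborel. f x) = (LINT x|distr lborel borel ((+) c). f x)"
    by (simp add: lborel_distr_plus)
  also have "\<dots> = (LINT x|lborel. f (c + x))"
    by (rule integral_distr) measurable
  finally show ?thesis ..
qed

lemma continuous_bounded_cball:
  fixes f :: "'a::euclidean_space \<Rightarrow> real"
  assumes "continuous_on UNIV f"
  obtains C where "C > 0" "\<And>x. norm x \<le> r \<Longrightarrow> \<bar>f x\<bar> \<le> C"
proof -
  have "compact (f ` cball 0 r)"
    using assms by (intro compact_continuous_image) (auto intro: continuous_on_subset)
  then have "bounded (f ` cball 0 r)" by (rule compact_imp_bounded)
  then obtain C where "C > 0" "\<forall>y\<in>f ` cball 0 r. norm y \<le> C" by (meson bounded_pos)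
  then show ?thesis by (intro that[of C]) auto
qed

text \<open>Translation invariance makes the integral of each difference quotient vanish; the mean value theorem dominates the
quotients.\<close>

lemma integral_directional_derivative:
  fixes b :: "'a::euclidean_space" and G D :: "'a::euclidean_space \<Rightarrow> real"
  assumes der: "\<And>x t. ((\<lambda>t. G (x + t *\<^sub>R b)) has_real_derivative D (x + t *\<^sub>R b)) (at t)"
    and cG: "continuous_on UNIV G" and cD: "continuous_on UNIV D"
    and z: "\<And>x. norm x > \<rho> \<Longrightarrow> G x = 0"
  shows "(LINT x|lborel. D x) = 0"
proof -
  obtain C where C: "C > 0" "\<And>x. norm x \<le> \<rho> + 2 * norm b \<Longrightarrow> \<bar>D x\<bar> \<le> C"
    using continuous_bounded_cball[OF cD] by blast
  define s where "s = (\<lambda>n x. (G (inverse (real (Suc n)) *\<^sub>R b + x) - G x) * real (Suc n))"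
  define w where "w = (\<lambda>x::'a. indicator (cball 0 (\<rho> + norm b)) x *\<^sub>R C)"
  have [measurable]: "G \<in> borel_measurable borel" "D \<in> borel_measurable borel"
    using cG cD by (auto intro: borel_measurable_continuous_onI)
  have iG: "integrable lborel G" using integrable_compact_support[OF cG z] .
  have "(\<lambda>n. integral\<^sup>L lborel (s n)) \<longlonglongrightarrow> integral\<^sup>L lborel D"
  proof (rule integral_dominated_convergence[where w = w])
    show "integrable lborel w"
      unfolding w_def by (intro borel_integrable_compact) auto
    show "AE x in lborel. (\<lambda>n. s n x) \<longlonglongrightarrow> D x"
    proof (rule AE_I2)
      fix x
      have "((\<lambda>h. (G (x + (0 + h) *\<^sub>R b) - G (x + 0 *\<^sub>R b)) / h) \<longlongrightarrow> D (x + 0 *\<^sub>R b)) (at 0)"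
        using der[of x 0] unfolding DERIV_def .
      then have "((\<lambda>h. (G (x + h *\<^sub>R b) - G x) / h) \<longlongrightarrow> D x) (at 0)" by simp
      moreover have "filterlim (\<lambda>n. inverse (real (Suc n))) (at 0) sequentially"
        unfolding filterlim_at using LIMSEQ_inverse_real_of_nat by auto
      ultimately have "(\<lambda>n. (G (x + inverse (real (Suc n)) *\<^sub>R b) - G x) / inverse (real (Suc n))) \<longlonglongrightarrow> D x"
        by (rule filterlim_compose)
      then show "(\<lambda>n. s n x) \<longlonglongrightarrow> D x"
        by (simp add: s_def add.commute divide_inverse)
    qed
    show "AE x in lborel. norm (s n x) \<le> w x" for n
    proof (rule AE_I2)
      fix x :: 'a
      define h where "h = inverse (real (Suc n))"
      have h: "h > 0" "h \<le> 1" by (auto simp: h_def divide_simps inverse_eq_divide)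
      have sn: "s n x = (G (x + h *\<^sub>R b) - G x) / h"
        by (simp add: s_def h_def add.commute divide_inverse)
      show "norm (s n x) \<le> w x"
      proof (cases "norm x \<le> \<rho> + norm b")
        case True
        obtain \<xi> where xi: "0 < \<xi>" "\<xi> < h"
          "G (x + h *\<^sub>R b) - G (x + 0 *\<^sub>R b) = (h - 0) * D (x + \<xi> *\<^sub>R b)"
          using MVT2[OF h(1), of "\<lambda>t. G (x + t *\<^sub>R b)" "\<lambda>t. D (x + t *\<^sub>R b)"] der by blast
        have "norm (\<xi> *\<^sub>R b) \<le> 1 * norm b" using xi(1,2) h(2) unfolding norm_scaleR
          by (intro mult_right_mono) auto
        then have "norm (x + \<xi> *\<^sub>R b) \<le> \<rho> + 2 * norm b"
          using True norm_triangle_ineq[of x "\<xi> *\<^sub>R b"] by linarith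
        from C(2)[OF this] show ?thesis using xi(3) h True by (simp add: sn w_def)
      next
        case False
        have "norm (h *\<^sub>R b) \<le> 1 * norm b" using h unfolding norm_scaleR
          by (intro mult_right_mono) auto
        then have "norm (x + h *\<^sub>R b) > \<rho>"
          using False norm_triangle_ineq2[of x "- (h *\<^sub>R b)"] by simp
        moreover have "norm x > \<rho>" using False norm_ge_zero[of b] by linarith
        ultimately show ?thesis using C(1) by (simp add: sn z w_def)
      qed
    qed
  qed (auto simp: s_def)
  moreover have "integral\<^sup>L lborel (s n) = 0" for n
  proof -
    have "integrable lborel (\<lambda>x. G (inverse (real (Suc n)) *\<^sub>R b + x))"
    proof (rule integrable_compact_support)
      show "continuous_on UNIV (\<lambda>x. G (inverse (real (Suc n)) *\<^sub>R b + x))"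
        by (rule continuous_on_compose2[OF cG]) (auto intro: continuous_intros)
      fix x :: 'a assume "norm x > \<rho> + norm (inverse (real (Suc n)) *\<^sub>R b)"
      then have "norm (inverse (real (Suc n)) *\<^sub>R b + x) > \<rho>"
        using norm_triangle_ineq2[of x "- (inverse (real (Suc n)) *\<^sub>R b)"] by (simp add: add.commute)
      then show "G (inverse (real (Suc n)) *\<^sub>R b + x) = 0" by (rule z)
    qed
    then show ?thesis
      unfolding s_def using iG integral_translate[of G] by simp
  qed
  ultimately have "(\<lambda>n::nat. 0 :: real) \<longlonglongrightarrow> integral\<^sup>L lborel D" by simp
  then show ?thesis by (simp add: LIMSEQ_const_iff)
qed

lemma has_grad_hess_support:
  assumes f: "has_grad_hess f g H" and z: "\<And>x. norm x > \<rho> \<Longrightarrow> f x = 0" and x: "norm x > \<rho>"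
  shows "g x = 0" "H x b = 0"
proof -
  have op: "open {x::'a. norm x > \<rho>}" by (intro open_Collect_less continuous_intros)
  have g: "g y = 0" if "norm y > \<rho>" for y
  proof -
    have "(f has_derivative (\<lambda>h. 0)) (at y)"
      by (rule has_derivative_transform_within_open[OF has_derivative_const op]) (use that z in auto)
    from fun_cong[OF has_derivative_unique[OF this has_grad_hessD(1)[OF f]], of "g y"]
    have "g y \<bullet> g y = 0" by simp
    then show ?thesis by simp
  qed
  show "g x = 0" using g x .
  have "(g has_derivative (\<lambda>h. 0)) (at x)"
    by (rule has_derivative_transform_within_open[OF has_derivative_const op]) (use x g in auto)
  from fun_cong[OF has_derivative_unique[OF this has_grad_hessD(2)[OF f]], of b] show "H x b = 0" by simp
qed

lemma dunkl_term_C2_support: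
  assumes f: "has_grad_hess f g H" and z: "\<And>x. norm x > \<rho> \<Longrightarrow> f x = 0" and x: "norm x > \<rho>"
  shows "dunkl_term_C2 \<alpha> f g H x = 0"
  using has_grad_hess_support[OF f z x] z[of x] z[of "refl_hyp \<alpha> x"] x
  by (simp add: dunkl_term_C2_def)

section \<open>Symmetry of the Dunkl Laplacian\<close>

text \<open>The factors of the Dunkl weight are only Hoelder continuous when \<open>k\<close> is small.  Replacing \<open>\<bar>t\<bar>\<close> by
\<open>sqrt (t\<^sup>2 + \<epsilon>\<^sup>2)\<close> gives a smooth weight that is still invariant under all reflections.\<close>

definition smoothed_weight :: "'a::euclidean_space set \<Rightarrow> ('a \<Rightarrow> real) \<Rightarrow> real \<Rightarrow> 'a \<Rightarrow> real" where
  "smoothed_weight R k \<epsilon> x = (\<Prod>\<alpha>\<in>R. ((x \<bullet> \<alpha>)\<^sup>2 + \<epsilon>\<^sup>2) powr (k \<alpha> / 2))"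

context dunkl_setting
begin

abbreviation "w \<equiv> dunkl_weight R k"

lemma weight_nonneg: "0 \<le> w x"
  unfolding dunkl_weight_def by (intro prod_nonneg) auto

lemma continuous_weight: "continuous_on UNIV w"
proof -
  have "continuous_on UNIV (\<lambda>x. \<bar>x \<bullet> \<alpha>\<bar> powr k \<alpha>)" if "\<alpha> \<in> R" for \<alpha>
    by (rule continuous_on_powr') (use k_pos[OF that] in \<open>auto intro!: continuous_intros\<close>)
  then show ?thesis unfolding dunkl_weight_def[abs_def] by (intro continuous_on_prod)
qed

lemma prod_refl:
  assumes a: "\<alpha> \<in> R"
  shows "(\<Prod>\<beta>\<in>R. F (refl_hyp \<alpha> \<beta>)) = (\<Prod>\<beta>\<in>R. F \<beta>)"
proof -
  have "inj_on (refl_hyp \<alpha>) R" by (rule inj_on_inverseI[of _ "refl_hyp \<alpha>"]) simp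
  from prod.reindex[OF this, of F] show ?thesis by (simp add: refl_R[OF a] o_def)
qed

lemma smoothed_weight_refl:
  assumes a: "\<alpha> \<in> R"
  shows "smoothed_weight R k \<epsilon> (refl_hyp \<alpha> x) = smoothed_weight R k \<epsilon> x"
proof -
  have "smoothed_weight R k \<epsilon> (refl_hyp \<alpha> x)
     = (\<Prod>\<beta>\<in>R. ((x \<bullet> refl_hyp \<alpha> \<beta>)\<^sup>2 + \<epsilon>\<^sup>2) powr (k (refl_hyp \<alpha> \<beta>) / 2))"
    unfolding smoothed_weight_def by (intro prod.cong) (auto simp: k_refl[OF a] refl_hyp_adjoint)
  also have "\<dots> = smoothed_weight R k \<epsilon> x"
    unfolding smoothed_weight_def by (rule prod_refl[OF a])
  finally show ?thesis .
qed

lemma smoothed_weight_exp: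
  assumes "\<epsilon> \<noteq> 0"
  shows "smoothed_weight R k \<epsilon> x = exp (\<Sum>\<alpha>\<in>R. k \<alpha> / 2 * ln ((x \<bullet> \<alpha>)\<^sup>2 + \<epsilon>\<^sup>2))"
proof -
  have "((x \<bullet> \<alpha>)\<^sup>2 + \<epsilon>\<^sup>2) \<noteq> 0" for \<alpha>
    using assms by (metis sum_power2_eq_zero_iff)
  then have "((x \<bullet> \<alpha>)\<^sup>2 + \<epsilon>\<^sup>2) powr (k \<alpha> / 2) = exp (k \<alpha> / 2 * ln ((x \<bullet> \<alpha>)\<^sup>2 + \<epsilon>\<^sup>2))" for \<alpha>
    by (simp only: powr_def if_False)
  then show ?thesis unfolding smoothed_weight_def exp_sum[OF finite_R] by (simp only:)
qed

lemma smoothed_weight_continuous: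
  assumes "\<epsilon> \<noteq> 0"
  shows "continuous_on UNIV (smoothed_weight R k \<epsilon>)"
proof -
  have *: "((x \<bullet> \<alpha>)\<^sup>2 + \<epsilon>\<^sup>2) \<noteq> 0" for x \<alpha> :: 'a
    using assms by (metis sum_power2_eq_zero_iff)
  have "continuous_on UNIV (\<lambda>x. exp (\<Sum>\<alpha>\<in>R. k \<alpha> / 2 * ln ((x \<bullet> \<alpha>)\<^sup>2 + \<epsilon>\<^sup>2)))"
    by (intro continuous_intros ballI *)
  then show ?thesis by (rule continuous_on_eq) (rule smoothed_weight_exp[OF assms, symmetric])
qed

lemma smoothed_weight_deriv:
  assumes e: "\<epsilon> \<noteq> 0"
  shows "((\<lambda>t. smoothed_weight R k \<epsilon> (x + t *\<^sub>R b)) has_real_derivative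
    smoothed_weight R k \<epsilon> (x + t *\<^sub>R b) *
      (\<Sum>\<alpha>\<in>R. k \<alpha> * ((x + t *\<^sub>R b) \<bullet> \<alpha>) * (b \<bullet> \<alpha>) / (((x + t *\<^sub>R b) \<bullet> \<alpha>)\<^sup>2 + \<epsilon>\<^sup>2))) (at t)"
proof -
  have pos: "((x + t *\<^sub>R b) \<bullet> \<alpha>)\<^sup>2 + \<epsilon>\<^sup>2 > 0" for \<alpha>
    using e by (simp add: add_nonneg_pos)
  have "((\<lambda>t. k \<alpha> / 2 * ln (((x + t *\<^sub>R b) \<bullet> \<alpha>)\<^sup>2 + \<epsilon>\<^sup>2)) has_real_derivative
      k \<alpha> * ((x + t *\<^sub>R b) \<bullet> \<alpha>) * (b \<bullet> \<alpha>) / (((x + t *\<^sub>R b) \<bullet> \<alpha>)\<^sup>2 + \<epsilon>\<^sup>2)) (at t)" for \<alpha>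
  proof -
    have "((\<lambda>t. (x \<bullet> \<alpha> + t * (b \<bullet> \<alpha>))\<^sup>2 + \<epsilon>\<^sup>2) has_real_derivative 2 * (x \<bullet> \<alpha> + t * (b \<bullet> \<alpha>)) * (b \<bullet> \<alpha>)) (at t)"
      by (auto intro!: derivative_eq_intros)
    from DERIV_ln_divide[THEN DERIV_chain2, OF _ this] pos[of \<alpha>]
    have d: "((\<lambda>t. ln ((x \<bullet> \<alpha> + t * (b \<bullet> \<alpha>))\<^sup>2 + \<epsilon>\<^sup>2)) has_real_derivative
      1 / ((x \<bullet> \<alpha> + t * (b \<bullet> \<alpha>))\<^sup>2 + \<epsilon>\<^sup>2) * (2 * (x \<bullet> \<alpha> + t * (b \<bullet> \<alpha>)) * (b \<bullet> \<alpha>))) (at t)"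
      by (simp add: inner_add_left)
    have e: "k \<alpha> / 2 * (1 / M * (2 * T * B)) = k \<alpha> * T * B / M" for M T B :: real by simp
    from DERIV_cmult[OF d, of "k \<alpha> / 2"] show ?thesis unfolding inner_add_left inner_scaleR_left
      by (rule DERIV_cong) (rule e)
  qed
  from DERIV_exp[THEN DERIV_chain2, OF DERIV_sum[OF this]]
  show ?thesis unfolding smoothed_weight_exp[OF e] .
qed

lemma smoothed_weight_mono:
  assumes "0 \<le> \<epsilon>" "\<epsilon> \<le> \<epsilon>'"
  shows "smoothed_weight R k \<epsilon> x \<le> smoothed_weight R k \<epsilon>' x"
  unfolding smoothed_weight_def
proof (intro prod_mono conjI powr_mono2)
  show "(x \<bullet> \<alpha>)\<^sup>2 + \<epsilon>\<^sup>2 \<le> (x \<bullet> \<alpha>)\<^sup>2 + \<epsilon>'\<^sup>2" for \<alpha>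
    using assms by (simp add: power_mono)
qed (use k_pos in \<open>auto intro: less_imp_le\<close>)

lemma smoothed_weight_nonneg: "0 \<le> smoothed_weight R k \<epsilon> x"
  unfolding smoothed_weight_def by (intro prod_nonneg) auto

lemma smoothed_weight_tendsto:
  assumes "\<epsilon> \<longlonglongrightarrow> 0"
  shows "(\<lambda>n. smoothed_weight R k (\<epsilon> n) x) \<longlonglongrightarrow> w x"
proof -
  have "(\<lambda>n. ((x \<bullet> \<alpha>)\<^sup>2 + (\<epsilon> n)\<^sup>2) powr (k \<alpha> / 2)) \<longlonglongrightarrow> \<bar>x \<bullet> \<alpha>\<bar> powr k \<alpha>" if "\<alpha> \<in> R" for \<alpha>
  proof -
    have "(\<lambda>n. (x \<bullet> \<alpha>)\<^sup>2 + (\<epsilon> n)\<^sup>2) \<longlonglongrightarrow> (x \<bullet> \<alpha>)\<^sup>2 + 0\<^sup>2"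
      using assms by (intro tendsto_intros)
    then have "(\<lambda>n. ((x \<bullet> \<alpha>)\<^sup>2 + (\<epsilon> n)\<^sup>2) powr (k \<alpha> / 2)) \<longlonglongrightarrow> ((x \<bullet> \<alpha>)\<^sup>2) powr (k \<alpha> / 2)"
      using k_pos[OF that] by (intro tendsto_powr') auto
    also have "((x \<bullet> \<alpha>)\<^sup>2) powr (k \<alpha> / 2) = \<bar>x \<bullet> \<alpha>\<bar> powr k \<alpha>"
    proof (cases "x \<bullet> \<alpha> = 0")
      case False
      then have "(x \<bullet> \<alpha>)\<^sup>2 = \<bar>x \<bullet> \<alpha>\<bar> powr 2" by simp
      then show ?thesis by (simp only: powr_powr) simp
    qed simp
    finally show ?thesis .
  qed
  then show ?thesis unfolding smoothed_weight_def dunkl_weight_def by (intro tendsto_prod)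
qed

text \<open>Integrate the divergence of the compactly supported field \<open>W (f \<nabla>p - p \<nabla>f)\<close>, where \<open>W\<close> is the smoothed weight;
its logarithmic derivative produces the drift terms.\<close>

lemma smoothed_green:
  assumes f: "has_grad_hess f gf Hf" and p: "has_grad_hess p gp Hp"
    and z: "\<And>x. norm x > \<rho> \<Longrightarrow> p x = 0" and e: "\<epsilon> \<noteq> 0"
  shows "(LINT x|lborel. smoothed_weight R k \<epsilon> x *
      ((\<Sum>b\<in>Basis. f x * (Hp x b \<bullet> b) - p x * (Hf x b \<bullet> b))
       + (\<Sum>\<alpha>\<in>R. k \<alpha> * ((f x * (gp x \<bullet> \<alpha>) - p x * (gf x \<bullet> \<alpha>)) * (x \<bullet> \<alpha>) / ((x \<bullet> \<alpha>)\<^sup>2 + \<epsilon>\<^sup>2))))) = 0"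
    (is "(LINT x|lborel. ?J x) = 0")
proof -
  define W where "W = smoothed_weight R k \<epsilon>"
  define V where "V = (\<lambda>x b. \<Sum>\<alpha>\<in>R. k \<alpha> * (x \<bullet> \<alpha>) * (b \<bullet> \<alpha>) / ((x \<bullet> \<alpha>)\<^sup>2 + \<epsilon>\<^sup>2))"
  define G where "G = (\<lambda>b x. W x * (f x * (gp x \<bullet> b) - p x * (gf x \<bullet> b)))"
  define D where "D = (\<lambda>b x. W x * V x b * (f x * (gp x \<bullet> b) - p x * (gf x \<bullet> b))
      + W x * (f x * (Hp x b \<bullet> b) - p x * (Hf x b \<bullet> b)))"
  have *: "((x \<bullet> \<alpha>)\<^sup>2 + \<epsilon>\<^sup>2) \<noteq> 0" for x \<alpha> :: 'a
    using e by (metis sum_power2_eq_zero_iff)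
  note cont = has_grad_hess_continuous[OF f] has_grad_hess_continuous[OF p]
    has_grad_hessD(3)[OF f] has_grad_hessD(3)[OF p]
  have cW: "continuous_on UNIV W" unfolding W_def by (rule smoothed_weight_continuous[OF e])
  have cV: "continuous_on UNIV (\<lambda>x. V x b)" for b
    unfolding V_def by (intro continuous_intros ballI *)
  have cG: "continuous_on UNIV (G b)" for b
    unfolding G_def by (intro continuous_intros cont cW)
  have cD: "continuous_on UNIV (D b)" for b
    unfolding D_def by (intro continuous_intros cont cW cV)
  have der: "((\<lambda>t. G b (x + t *\<^sub>R b)) has_real_derivative D b (x + t *\<^sub>R b)) (at t)" for b x t
  proof -
    have dW: "((\<lambda>t. W (x + t *\<^sub>R b)) has_real_derivative W (x + t *\<^sub>R b) * V (x + t *\<^sub>R b) b) (at t)"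
      using smoothed_weight_deriv[OF e] unfolding W_def V_def by simp
    show ?thesis unfolding G_def D_def
      by (rule DERIV_cong, rule DERIV_mult[OF dW DERIV_diff[OF
          DERIV_mult[OF has_grad_hess_line(1)[OF f] has_grad_hess_line(2)[OF p]]
          DERIV_mult[OF has_grad_hess_line(1)[OF p] has_grad_hess_line(2)[OF f]]]])
        (simp add: algebra_simps)
  qed
  have zz: "G b x = 0" "D b x = 0" if "norm x > \<rho>" for x b
    using z[OF that] has_grad_hess_support[OF p z that] by (simp_all add: G_def D_def)
  have "(LINT x|lborel. D b x) = 0" for b
    by (rule integral_directional_derivative[where \<rho> = \<rho>, OF der cG cD]) (rule zz)
  moreover have "integrable lborel (D b)" for b
    by (rule integrable_compact_support[OF cD]) (rule zz)
  ultimately have "(LINT x|lborel. (\<Sum>b\<in>Basis. D b x)) = 0"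
    by (subst Bochner_Integration.integral_sum) auto
  also have "(\<lambda>x. \<Sum>b\<in>Basis. D b x) = ?J"
  proof
    fix x
    have "(\<Sum>b\<in>Basis. V x b * (f x * (gp x \<bullet> b) - p x * (gf x \<bullet> b)))
      = (\<Sum>b\<in>Basis. \<Sum>\<alpha>\<in>R. k \<alpha> * (x \<bullet> \<alpha>) / ((x \<bullet> \<alpha>)\<^sup>2 + \<epsilon>\<^sup>2) *
          ((b \<bullet> \<alpha>) * ((f x *\<^sub>R gp x - p x *\<^sub>R gf x) \<bullet> b)))"
      unfolding V_def sum_distrib_right by (intro sum.cong refl) (simp add: inner_diff_left)
    also have "\<dots> = (\<Sum>\<alpha>\<in>R. k \<alpha> * (x \<bullet> \<alpha>) / ((x \<bullet> \<alpha>)\<^sup>2 + \<epsilon>\<^sup>2) *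
          (\<Sum>b\<in>Basis. (b \<bullet> \<alpha>) * ((f x *\<^sub>R gp x - p x *\<^sub>R gf x) \<bullet> b)))"
      by (subst sum.swap) (simp add: sum_distrib_left)
    also have "\<dots> = (\<Sum>\<alpha>\<in>R. k \<alpha> * (x \<bullet> \<alpha>) / ((x \<bullet> \<alpha>)\<^sup>2 + \<epsilon>\<^sup>2) * ((f x *\<^sub>R gp x - p x *\<^sub>R gf x) \<bullet> \<alpha>))"
      by (subst (2) euclidean_inner) (simp add: inner_commute mult.commute)
    also have "\<dots> = (\<Sum>\<alpha>\<in>R. k \<alpha> * ((f x * (gp x \<bullet> \<alpha>) - p x * (gf x \<bullet> \<alpha>)) * (x \<bullet> \<alpha>) / ((x \<bullet> \<alpha>)\<^sup>2 + \<epsilon>\<^sup>2)))"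
      by (intro sum.cong refl) (simp add: inner_diff_left mult_ac)
    finally have S: "(\<Sum>b\<in>Basis. V x b * (f x * (gp x \<bullet> b) - p x * (gf x \<bullet> b))) =
      (\<Sum>\<alpha>\<in>R. k \<alpha> * ((f x * (gp x \<bullet> \<alpha>) - p x * (gf x \<bullet> \<alpha>)) * (x \<bullet> \<alpha>) / ((x \<bullet> \<alpha>)\<^sup>2 + \<epsilon>\<^sup>2)))" .
    show "(\<Sum>b\<in>Basis. D b x) = ?J x"
      unfolding D_def W_def[symmetric] sum.distrib mult.assoc sum_distrib_left[symmetric] S
      by (simp only: distrib_left add.commute)
  qed
  finally show ?thesis .
qed

text \<open>The substitution \<open>x \<mapsto> refl_hyp \<alpha> x\<close> interchanges the two products and leaves the weight and \<open>(x \<bullet> \<alpha>)\<^sup>2\<close> unchanged.\<close>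

lemma smoothed_refl_exchange:
  assumes f: "continuous_on UNIV f" and p: "continuous_on UNIV p"
    and z: "\<And>x. norm x > \<rho> \<Longrightarrow> p x = 0" and e: "\<epsilon> \<noteq> 0" and a: "\<alpha> \<in> R"
  shows "(LINT x|lborel. smoothed_weight R k \<epsilon> x *
      ((f x * p (refl_hyp \<alpha> x) - p x * f (refl_hyp \<alpha> x)) / ((x \<bullet> \<alpha>)\<^sup>2 + \<epsilon>\<^sup>2))) = 0"
proof -
  have *: "((x \<bullet> \<alpha>)\<^sup>2 + \<epsilon>\<^sup>2) \<noteq> 0" for x
    using e by (metis sum_power2_eq_zero_iff)
  define F where "F = (\<lambda>x. smoothed_weight R k \<epsilon> x * (f (refl_hyp \<alpha> x) * p x / ((x \<bullet> \<alpha>)\<^sup>2 + \<epsilon>\<^sup>2)))"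
  have cF: "continuous_on UNIV F" unfolding F_def
    by (intro continuous_intros smoothed_weight_continuous[OF e] p
      continuous_on_compose2[OF f] ballI *) auto
  have r: "F (refl_hyp \<alpha> x) = smoothed_weight R k \<epsilon> x * (f x * p (refl_hyp \<alpha> x) / ((x \<bullet> \<alpha>)\<^sup>2 + \<epsilon>\<^sup>2))" for x
    using inner_refl_hyp_self[OF R_nonzero[OF a], of x]
    by (simp add: F_def smoothed_weight_refl[OF a] inner_commute)
  have i1: "integrable lborel F"
    by (rule integrable_compact_support[OF cF, of \<rho>]) (simp add: F_def z)
  have i2: "integrable lborel (\<lambda>x. F (refl_hyp \<alpha> x))"
  proof (rule integrable_compact_support)
    show "continuous_on UNIV (\<lambda>x. F (refl_hyp \<alpha> x))"
      by (rule continuous_on_compose2[OF cF continuous_refl_hyp[OF continuous_on_id]]) auto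
    show "F (refl_hyp \<alpha> x) = 0" if "norm x > \<rho>" for x
      using z[of "refl_hyp \<alpha> x"] that by (simp add: F_def)
  qed
  have "(LINT x|lborel. F (refl_hyp \<alpha> x) - F x) = 0"
    using i1 i2 integral_refl_hyp[of F \<alpha>] borel_measurable_continuous_onI[OF cF] by simp
  then show ?thesis unfolding r by (simp add: F_def right_diff_distrib diff_divide_distrib mult.commute)
qed

text \<open>The gradient terms and the difference terms of a single root are separately unbounded near its mirror.  With denominators
\<open>(x \<bullet> \<alpha>)\<^sup>2 + \<epsilon>\<^sup>2\<close> each of them integrates to zero, the former together with the second-order terms, and their sum is the
continuous function \<open>E \<alpha>\<close> below times \<open>(x \<bullet> \<alpha>)\<^sup>2 / ((x \<bullet> \<alpha>)\<^sup>2 + \<epsilon>\<^sup>2) \<le> 1\<close>, so dominated convergence applies.\<close>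

lemma dunkl_green:
  assumes f: "has_grad_hess f gf Hf" and p: "has_grad_hess p gp Hp"
    and z: "\<And>x. norm x > \<rho> \<Longrightarrow> p x = 0"
  shows "(LINT x|lborel. f x * dunkl_laplacian R k p x * w x)
       = (LINT x|lborel. dunkl_laplacian R k f x * p x * w x)"
proof -
  define E where "E = (\<lambda>\<alpha> x. f x * dunkl_term_C2 \<alpha> p gp Hp x - p x * dunkl_term_C2 \<alpha> f gf Hf x)"
  define L where "L = (\<lambda>x. \<Sum>b\<in>Basis. f x * (Hp x b \<bullet> b) - p x * (Hf x b \<bullet> b))"
  define W where "W = smoothed_weight R k"
  note cont = has_grad_hess_continuous[OF f] has_grad_hess_continuous[OF p]
    has_grad_hessD(3)[OF f] has_grad_hessD(3)[OF p]
  have cE: "continuous_on UNIV (E \<alpha>)" if "\<alpha> \<in> R" for \<alpha>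
    unfolding E_def using R_nonzero[OF that] by (intro continuous_intros cont continuous_dunkl_term_C2[OF f]
      continuous_dunkl_term_C2[OF p])
  have cL: "continuous_on UNIV L" unfolding L_def by (intro continuous_intros cont)
  have zE: "E \<alpha> x = 0" and zL: "L x = 0" if "norm x > \<rho>" for \<alpha> x
    using z[OF that] dunkl_term_C2_support[OF p z that] has_grad_hess_support[OF p z that]
    by (simp_all add: E_def L_def)
  define J where "J = (\<lambda>\<epsilon> x. W \<epsilon> x * (L x + (\<Sum>\<alpha>\<in>R. k \<alpha> * (E \<alpha> x * ((x \<bullet> \<alpha>)\<^sup>2 / ((x \<bullet> \<alpha>)\<^sup>2 + \<epsilon>\<^sup>2))))))"
  define K where "K = (\<lambda>x. w x * (L x + (\<Sum>\<alpha>\<in>R. k \<alpha> * E \<alpha> x)))"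
  have J0: "(LINT x|lborel. J \<epsilon> x) = 0" if e: "\<epsilon> \<noteq> 0" for \<epsilon>
  proof -
    have *: "((x \<bullet> \<alpha>)\<^sup>2 + \<epsilon>\<^sup>2) \<noteq> 0" for x \<alpha> :: 'a
      using e by (metis sum_power2_eq_zero_iff)
    have cW: "continuous_on UNIV (W \<epsilon>)" unfolding W_def by (rule smoothed_weight_continuous[OF e])
    define A where "A = (\<lambda>x. W \<epsilon> x * (L x
       + (\<Sum>\<alpha>\<in>R. k \<alpha> * ((f x * (gp x \<bullet> \<alpha>) - p x * (gf x \<bullet> \<alpha>)) * (x \<bullet> \<alpha>) / ((x \<bullet> \<alpha>)\<^sup>2 + \<epsilon>\<^sup>2)))))"
    define B where "B = (\<lambda>\<alpha> x. W \<epsilon> x *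
       ((f x * p (refl_hyp \<alpha> x) - p x * f (refl_hyp \<alpha> x)) / ((x \<bullet> \<alpha>)\<^sup>2 + \<epsilon>\<^sup>2)))"
    have iA: "integrable lborel A"
    proof (rule integrable_compact_support)
      show "continuous_on UNIV A" unfolding A_def by (intro continuous_intros cW cL cont ballI *)
      fix x :: 'a assume "norm x > \<rho>"
      then show "A x = 0" using zL z has_grad_hess_support[OF p z] by (simp add: A_def)
    qed
    have iB: "integrable lborel (B \<alpha>)" for \<alpha>
    proof (rule integrable_compact_support)
      show "continuous_on UNIV (B \<alpha>)" unfolding B_def
        by (intro continuous_intros cW cont continuous_on_compose2[OF cont(1)]
           continuous_on_compose2[OF cont(3)] ballI *) auto
      fix x :: 'a assume "norm x > \<rho>"
      then show "B \<alpha> x = 0" using z[of x] z[of "refl_hyp \<alpha> x"] by (simp add: B_def)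
    qed
    have A0: "integral\<^sup>L lborel A = 0"
      using smoothed_green[OF f p z e] unfolding A_def L_def W_def by simp
    have B0: "integral\<^sup>L lborel (B \<alpha>) = 0" if "\<alpha> \<in> R" for \<alpha>
      using smoothed_refl_exchange[OF cont(1,3) z e that] unfolding B_def W_def by simp
    (* On the mirror both sides vanish; off the mirror this is the definition of E. *)
    have bracket: "E \<alpha> x * ((x \<bullet> \<alpha>)\<^sup>2 / ((x \<bullet> \<alpha>)\<^sup>2 + \<epsilon>\<^sup>2))
       = (f x * (gp x \<bullet> \<alpha>) - p x * (gf x \<bullet> \<alpha>)) * (x \<bullet> \<alpha>) / ((x \<bullet> \<alpha>)\<^sup>2 + \<epsilon>\<^sup>2)
        + (norm \<alpha>)\<^sup>2 / 2 * ((f x * p (refl_hyp \<alpha> x) - p x * f (refl_hyp \<alpha> x)) / ((x \<bullet> \<alpha>)\<^sup>2 + \<epsilon>\<^sup>2))" for \<alpha> x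
    proof (cases "x \<bullet> \<alpha> = 0")
      case True
      then have "refl_hyp \<alpha> x = x" by (simp add: refl_hyp_def inner_commute)
      then show ?thesis using True by simp
    next
      case False
      have "(F * (P / t - N * ((q - q') / t\<^sup>2)) - q * (P' / t - N * ((F - F') / t\<^sup>2))) * (t\<^sup>2 / M)
          = (F * P - q * P') * t / M + N * ((F * q' - q * F') / M)" if "t \<noteq> 0"
        for F P N q q' P' F' M t :: real
      proof -
        have "P / t = P * t / t\<^sup>2" "P' / t = P' * t / t\<^sup>2"
          using that by (simp_all add: power2_eq_square)
        then have "F * (P / t - N * ((q - q') / t\<^sup>2)) - q * (P' / t - N * ((F - F') / t\<^sup>2))
            = ((F * P - q * P') * t + N * (F * q' - q * F')) / t\<^sup>2"
          by (simp only:) (simp add: divide_inverse algebra_simps)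
        moreover have "Y / t\<^sup>2 * (t\<^sup>2 / M) = Y / M" for Y using that by simp
        ultimately show ?thesis by (simp only:) (simp add: add_divide_distrib)
      qed
      then show ?thesis
        using False unfolding E_def dunkl_term_C2_def inner_commute[of x \<alpha>]
        by (simp only: not_False_eq_True if_True simp_thms)
    qed
    have "J \<epsilon> x = A x + (\<Sum>\<alpha>\<in>R. k \<alpha> * ((norm \<alpha>)\<^sup>2 / 2) * B \<alpha> x)" for x
      unfolding J_def A_def B_def bracket
      by (simp add: distrib_left sum.distrib sum_distrib_left mult.assoc mult.left_commute)
    then have "(LINT x|lborel. J \<epsilon> x) = (LINT x|lborel. A x + (\<Sum>\<alpha>\<in>R. k \<alpha> * ((norm \<alpha>)\<^sup>2 / 2) * B \<alpha> x))"
      by simp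
    also have "\<dots> = 0" using iA iB A0 B0
      by (subst Bochner_Integration.integral_add)
        (auto simp: Bochner_Integration.integral_sum)
    finally show ?thesis .
  qed
  define \<epsilon> where "\<epsilon> = (\<lambda>n. inverse (real (Suc n)))"
  have eps: "\<epsilon> n > 0" "\<epsilon> n \<le> 1" for n by (auto simp: \<epsilon>_def divide_simps inverse_eq_divide)
  have eps0: "\<epsilon> \<longlonglongrightarrow> 0" unfolding \<epsilon>_def by (rule LIMSEQ_inverse_real_of_nat)
  define M where "M = (\<lambda>x. W 1 x * (\<bar>L x\<bar> + (\<Sum>\<alpha>\<in>R. k \<alpha> * \<bar>E \<alpha> x\<bar>)))"
  have JM: "\<bar>L x + (\<Sum>\<alpha>\<in>R. k \<alpha> * (E \<alpha> x * ((x \<bullet> \<alpha>)\<^sup>2 / ((x \<bullet> \<alpha>)\<^sup>2 + e\<^sup>2))))\<bar>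
      \<le> \<bar>L x\<bar> + (\<Sum>\<alpha>\<in>R. k \<alpha> * \<bar>E \<alpha> x\<bar>)" for x e
  proof -
    have "\<bar>\<Sum>\<alpha>\<in>R. k \<alpha> * (E \<alpha> x * ((x \<bullet> \<alpha>)\<^sup>2 / ((x \<bullet> \<alpha>)\<^sup>2 + e\<^sup>2)))\<bar>
       \<le> (\<Sum>\<alpha>\<in>R. \<bar>k \<alpha> * (E \<alpha> x * ((x \<bullet> \<alpha>)\<^sup>2 / ((x \<bullet> \<alpha>)\<^sup>2 + e\<^sup>2)))\<bar>)" by (rule sum_abs)
    also have "\<dots> \<le> (\<Sum>\<alpha>\<in>R. k \<alpha> * \<bar>E \<alpha> x\<bar>)"
    proof (rule sum_mono)
      fix \<alpha> assume "\<alpha> \<in> R"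
      have q: "0 \<le> (x \<bullet> \<alpha>)\<^sup>2 / ((x \<bullet> \<alpha>)\<^sup>2 + e\<^sup>2)" "(x \<bullet> \<alpha>)\<^sup>2 / ((x \<bullet> \<alpha>)\<^sup>2 + e\<^sup>2) \<le> 1"
        by (auto simp: divide_le_eq_1 not_less sum_power2_le_zero_iff)
      show "\<bar>k \<alpha> * (E \<alpha> x * ((x \<bullet> \<alpha>)\<^sup>2 / ((x \<bullet> \<alpha>)\<^sup>2 + e\<^sup>2)))\<bar> \<le> k \<alpha> * \<bar>E \<alpha> x\<bar>"
      proof -
        have "\<bar>E \<alpha> x\<bar> * ((x \<bullet> \<alpha>)\<^sup>2 / ((x \<bullet> \<alpha>)\<^sup>2 + e\<^sup>2)) \<le> \<bar>E \<alpha> x\<bar>"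
          using mult_left_mono[OF q(2), of "\<bar>E \<alpha> x\<bar>"] by simp
        from mult_left_mono[OF this, of "k \<alpha>"] show ?thesis
          using k_pos[OF \<open>\<alpha> \<in> R\<close>] unfolding abs_mult abs_of_nonneg[OF q(1)] by simp
      qed
    qed
    finally show ?thesis by linarith
  qed
  have "(\<lambda>n. integral\<^sup>L lborel (J (\<epsilon> n))) \<longlonglongrightarrow> integral\<^sup>L lborel K"
  proof (rule integral_dominated_convergence[where w = M])
    have cK: "continuous_on UNIV K"
      unfolding K_def by (intro continuous_intros continuous_weight cL cE)
    then show "K \<in> borel_measurable lborel" by (auto intro: borel_measurable_continuous_onI)
    show "J (\<epsilon> n) \<in> borel_measurable lborel" for n
    proof -
      have *: "((x \<bullet> \<alpha>)\<^sup>2 + (\<epsilon> n)\<^sup>2) \<noteq> 0" for x \<alpha> :: 'a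
        using eps(1)[of n] by (metis sum_power2_eq_zero_iff less_irrefl)
      have "continuous_on UNIV (J (\<epsilon> n))" unfolding J_def W_def
        using eps(1)[of n] by (intro continuous_intros smoothed_weight_continuous cL cE ballI *) auto
      then show ?thesis by (auto intro: borel_measurable_continuous_onI)
    qed
    show "integrable lborel M"
    proof (rule integrable_compact_support)
      show "continuous_on UNIV M"
        unfolding M_def W_def by (intro continuous_intros smoothed_weight_continuous cL cE) auto
      show "M x = 0" if "norm x > \<rho>" for x using zL[OF that] zE[OF that] by (simp add: M_def)
    qed
    show "AE x in lborel. norm (J (\<epsilon> n) x) \<le> M x" for n
    proof (rule AE_I2)
      fix x
      have "W (\<epsilon> n) x \<le> W 1 x" "0 \<le> W (\<epsilon> n) x"
        unfolding W_def using eps[of n] by (auto intro: smoothed_weight_mono smoothed_weight_nonneg)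
      then show "norm (J (\<epsilon> n) x) \<le> M x"
        unfolding J_def M_def real_norm_def abs_mult using JM[of x "\<epsilon> n"] by (intro mult_mono) auto
    qed
    show "AE x in lborel. (\<lambda>n. J (\<epsilon> n) x) \<longlonglongrightarrow> K x"
    proof (rule AE_I2)
      fix x
      have lw: "(\<lambda>n. W (\<epsilon> n) x) \<longlonglongrightarrow> w x" unfolding W_def by (rule smoothed_weight_tendsto[OF eps0])
      show "(\<lambda>n. J (\<epsilon> n) x) \<longlonglongrightarrow> K x"
      proof (cases "\<exists>\<alpha>\<in>R. x \<bullet> \<alpha> = 0")
        case True
        then have "w x = 0" unfolding dunkl_weight_def using k_pos by (auto intro!: prod_zero)
        then have "(\<lambda>n. W (\<epsilon> n) x * (\<bar>L x\<bar> + (\<Sum>\<alpha>\<in>R. k \<alpha> * \<bar>E \<alpha> x\<bar>))) \<longlonglongrightarrow> 0"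
          using tendsto_mult_right[OF lw] by simp
        then have "(\<lambda>n. J (\<epsilon> n) x) \<longlonglongrightarrow> 0"
        proof (rule Lim_null_comparison[rotated], intro always_eventually allI)
          fix n
          show "norm (J (\<epsilon> n) x) \<le> W (\<epsilon> n) x * (\<bar>L x\<bar> + (\<Sum>\<alpha>\<in>R. k \<alpha> * \<bar>E \<alpha> x\<bar>))"
            unfolding J_def real_norm_def abs_mult using JM[of x "\<epsilon> n"]
            by (intro mult_mono) (auto simp: W_def smoothed_weight_nonneg)
        qed
        then show ?thesis by (simp add: K_def \<open>w x = 0\<close>)
      next
        case False
        have "(\<lambda>n. (x \<bullet> \<alpha>)\<^sup>2 / ((x \<bullet> \<alpha>)\<^sup>2 + (\<epsilon> n)\<^sup>2)) \<longlonglongrightarrow> (x \<bullet> \<alpha>)\<^sup>2 / ((x \<bullet> \<alpha>)\<^sup>2 + 0\<^sup>2)" if "\<alpha> \<in> R" for \<alpha>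
          using False that by (intro tendsto_intros eps0) auto
        then have l1: "(\<lambda>n. (x \<bullet> \<alpha>)\<^sup>2 / ((x \<bullet> \<alpha>)\<^sup>2 + (\<epsilon> n)\<^sup>2)) \<longlonglongrightarrow> 1" if "\<alpha> \<in> R" for \<alpha>
          using False that by fastforce
        have "(\<lambda>n. J (\<epsilon> n) x) \<longlonglongrightarrow> w x * (L x + (\<Sum>\<alpha>\<in>R. k \<alpha> * (E \<alpha> x * 1)))"
          unfolding J_def by (intro tendsto_intros lw l1)
        then show ?thesis by (simp add: K_def)
      qed
    qed
  qed
  moreover have "integral\<^sup>L lborel (J (\<epsilon> n)) = 0" for n
    using J0[of "\<epsilon> n"] eps(1)[of n] by simp
  ultimately have "(\<lambda>n::nat. 0 :: real) \<longlonglongrightarrow> integral\<^sup>L lborel K" by simp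
  then have K0: "integral\<^sup>L lborel K = 0" by (simp add: LIMSEQ_const_iff)
  have KE: "K x = f x * dunkl_laplacian R k p x * w x - dunkl_laplacian R k f x * p x * w x" for x
    unfolding K_def L_def E_def dunkl_laplacian_eq[OF f] dunkl_laplacian_eq[OF p]
    by (simp add: sum.distrib sum_subtractf sum_distrib_left algebra_simps)
  have "integrable lborel (\<lambda>x. f x * dunkl_laplacian R k p x * w x)"
  proof (rule integrable_compact_support)
    show "continuous_on UNIV (\<lambda>x. f x * dunkl_laplacian R k p x * w x)"
      by (intro continuous_intros cont continuous_dunkl_laplacian[OF p] continuous_weight)
    fix x :: 'a assume "norm x > \<rho>"
    then show "f x * dunkl_laplacian R k p x * w x = 0"
      using dunkl_term_C2_support[OF p z] has_grad_hess_support[OF p z] by (simp add: dunkl_laplacian_eq[OF p])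
  qed
  moreover have "integrable lborel (\<lambda>x. dunkl_laplacian R k f x * p x * w x)"
    by (rule integrable_compact_support[of _ \<rho>])
      (auto intro!: continuous_intros cont continuous_dunkl_laplacian[OF f] continuous_weight simp: z)
  ultimately show ?thesis using K0 unfolding KE by simp
qed

end

section \<open>Maximum principles\<close>

lemma second_derivative_at_max:
  fixes l :: "real \<Rightarrow> real"
  assumes d: "d > 0" and der: "\<And>t. \<bar>t\<bar> < d \<Longrightarrow> (l has_real_derivative l1 t) (at t)"
    and der2: "(l1 has_real_derivative D) (at 0)" and max: "\<And>t. \<bar>t\<bar> < d \<Longrightarrow> l t \<le> l 0"
  shows "l1 0 = 0" "D \<le> 0"
proof -
  show 0: "l1 0 = 0"
    by (rule DERIV_local_max[OF der d]) (use d max in auto)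
  show "D \<le> 0"
  proof (rule ccontr)
    assume "\<not> D \<le> 0"
    then obtain d' where d': "d' > 0" "\<And>h. 0 < h \<Longrightarrow> h < d' \<Longrightarrow> l1 0 < l1 (0 + h)"
      using DERIV_pos_inc_right[OF der2] by auto
    define h where "h = min d d' / 2"
    have h: "0 < h" "h < d" "h < d'" using d d' by (auto simp: h_def)
    obtain z where z: "0 < z" "z < h" "l h - l 0 = (h - 0) * l1 z"
      using MVT2[OF h(1), of l l1] der h by fastforce
    have "l1 z > 0" using d'(2)[of z] z h 0 by simp
    then have "(h - 0) * l1 z > 0" using h by simp
    then have "l h > l 0" using z by linarith
    moreover have "l h \<le> l 0" using max[of h] h by simp
    ultimately show False by simp
  qed
qed

context dunkl_setting
begin

lemma m_pos: "m > 0" using m_gt by simp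

text \<open>At a maximum of \<open>p - U(\<bar>x\<bar>\<^sup>2/2)\<close> the first two derivatives of \<open>p\<close> are controlled by those of the radial function, and
the reflection difference satisfies \<open>p x0 - p (refl_hyp \<alpha> x0) \<ge> 0\<close> because the mirror point has the same norm.
The right-hand side is the Dunkl Laplacian of the radial function.\<close>

lemma dunkl_laplacian_at_max:
  assumes f: "has_grad_hess p g H"
    and U: "\<And>s. 0 \<le> s \<Longrightarrow> s < \<rho>\<^sup>2 / 2 \<Longrightarrow> (U has_real_derivative dU s) (at s)"
    and ddU: "(dU has_real_derivative ddU) (at ((norm x0)\<^sup>2 / 2))"
    and x0: "norm x0 < \<rho>"
    and max: "\<And>x. norm x < \<rho> \<Longrightarrow> p x - U ((norm x)\<^sup>2 / 2) \<le> p x0 - U ((norm x0)\<^sup>2 / 2)"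
  shows "dunkl_laplacian R k p x0 \<le> (norm x0)\<^sup>2 * ddU + m * dU ((norm x0)\<^sup>2 / 2)"
proof -
  define s0 where "s0 = (norm x0)\<^sup>2 / 2"
  have line: "g x0 \<bullet> b = dU s0 * (x0 \<bullet> b) \<and> H x0 b \<bullet> b \<le> ddU * (x0 \<bullet> b)\<^sup>2 + dU s0 * (norm b)\<^sup>2" for b
  proof -
    define l where "l = (\<lambda>t. p (x0 + t *\<^sub>R b) - U ((norm (x0 + t *\<^sub>R b))\<^sup>2 / 2))"
    define l1 where "l1 = (\<lambda>t. g (x0 + t *\<^sub>R b) \<bullet> b - dU ((norm (x0 + t *\<^sub>R b))\<^sup>2 / 2) * ((x0 + t *\<^sub>R b) \<bullet> b))"
    define d where "d = (\<rho> - norm x0) / (norm b + 1)"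
    have nb: "norm b + 1 > 0" using norm_ge_zero[of b] by linarith
    have d: "d > 0" using x0 nb by (simp add: d_def)
    have in_ball: "norm (x0 + t *\<^sub>R b) < \<rho>" if "\<bar>t\<bar> < d" for t
    proof -
      have "\<bar>t\<bar> * norm b \<le> \<bar>t\<bar> * (norm b + 1)" by (intro mult_left_mono) auto
      also have "\<dots> < d * (norm b + 1)" using that nb by (intro mult_strict_right_mono) auto
      also have "\<dots> = \<rho> - norm x0" using nb by (simp add: d_def)
      finally show ?thesis using norm_triangle_ineq[of x0 "t *\<^sub>R b"] by simp
    qed
    have sq: "((\<lambda>t. (norm (x0 + t *\<^sub>R b))\<^sup>2 / 2) has_real_derivative (x0 + t *\<^sub>R b) \<bullet> b) (at t)" for t
    proof -
      have "((\<lambda>t. ((x0 \<bullet> x0) + 2 * t * (x0 \<bullet> b) + t\<^sup>2 * (b \<bullet> b)) / 2) has_real_derivative (x0 \<bullet> b + t * (b \<bullet> b))) (at t)"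
        by (auto intro!: derivative_eq_intros)
      moreover have "(norm (x0 + t *\<^sub>R b))\<^sup>2 = (x0 \<bullet> x0) + 2 * t * (x0 \<bullet> b) + t\<^sup>2 * (b \<bullet> b)" for t
        unfolding power2_norm_eq_inner
        by (simp add: inner_add_left inner_add_right inner_commute[of b x0] power2_eq_square distrib_left)
      ultimately show ?thesis by (simp only: inner_add_left inner_scaleR_left)
    qed
    have "(l has_real_derivative l1 t) (at t)" if "\<bar>t\<bar> < d" for t
    proof -
      have "(norm (x0 + t *\<^sub>R b))\<^sup>2 / 2 < \<rho>\<^sup>2 / 2"
        using in_ball[OF that] by (simp add: power_strict_mono)
      from DERIV_chain2[OF U[OF _ this] sq] show ?thesis
        unfolding l_def l1_def by (intro DERIV_diff has_grad_hess_line(1)[OF f]) auto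
    qed
    moreover have "(l1 has_real_derivative H x0 b \<bullet> b - (ddU * (x0 \<bullet> b) * (x0 \<bullet> b) + dU s0 * (b \<bullet> b))) (at 0)"
    proof -
      have u: "((\<lambda>t. dU ((norm (x0 + t *\<^sub>R b))\<^sup>2 / 2)) has_real_derivative ddU * ((x0 + 0 *\<^sub>R b) \<bullet> b)) (at 0)"
        by (rule DERIV_chain2[OF _ sq]) (simp add: ddU)
      have v: "((\<lambda>t. (x0 + t *\<^sub>R b) \<bullet> b) has_real_derivative b \<bullet> b) (at 0)"
        unfolding inner_add_left inner_scaleR_left by (auto intro!: derivative_eq_intros)
      show ?thesis unfolding l1_def
        by (rule DERIV_cong, rule DERIV_diff[OF has_grad_hess_line(2)[OF f] DERIV_mult[OF u v]])
          (simp add: s0_def)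
    qed
    moreover have "l t \<le> l 0" if "\<bar>t\<bar> < d" for t
      using max[OF in_ball[OF that]] by (simp add: l_def)
    ultimately have "l1 0 = 0" "H x0 b \<bullet> b - (ddU * (x0 \<bullet> b) * (x0 \<bullet> b) + dU s0 * (b \<bullet> b)) \<le> 0"
      using second_derivative_at_max[OF d] by blast+
    then show ?thesis by (simp add: l1_def s0_def power2_eq_square power2_norm_eq_inner[unfolded power2_eq_square])
  qed
  have "(\<Sum>b\<in>Basis. H x0 b \<bullet> b) \<le> (\<Sum>b\<in>Basis. ddU * (x0 \<bullet> b)\<^sup>2 + dU s0 * (norm b)\<^sup>2)"
    by (intro sum_mono) (rule conjunct2[OF line])
  also have "\<dots> = ddU * (norm x0)\<^sup>2 + dU s0 * real DIM('a)"
  proof -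
    have "(norm x0)\<^sup>2 = (\<Sum>b\<in>Basis. (x0 \<bullet> b)\<^sup>2)"
      unfolding power2_norm_eq_inner by (subst euclidean_inner) (simp add: power2_eq_square)
    then show ?thesis by (simp add: sum.distrib sum_distrib_left[symmetric])
  qed
  finally have lap: "(\<Sum>b\<in>Basis. H x0 b \<bullet> b) \<le> ddU * (norm x0)\<^sup>2 + dU s0 * real DIM('a)" .
  have term_le: "dunkl_term_C2 \<alpha> p g H x0 \<le> dU s0" if a: "\<alpha> \<in> R" for \<alpha>
  proof (cases "\<alpha> \<bullet> x0 = 0")
    case True
    have "norm \<alpha> > 0" using R_nonzero[OF a] by simp
    then show ?thesis using True line[of \<alpha>]
      by (simp add: dunkl_term_C2_def divide_le_eq inner_commute)
  next
    case False
    have "p (refl_hyp \<alpha> x0) \<le> p x0" using max[of "refl_hyp \<alpha> x0"] x0 by simp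
    then have "(norm \<alpha>)\<^sup>2 / 2 * ((p x0 - p (refl_hyp \<alpha> x0)) / (\<alpha> \<bullet> x0)\<^sup>2) \<ge> 0" by simp
    moreover have "g x0 \<bullet> \<alpha> / (\<alpha> \<bullet> x0) = dU s0"
      using line[of \<alpha>] False by (simp add: inner_commute)
    ultimately show ?thesis using False by (simp add: dunkl_term_C2_def)
  qed
  have "(\<Sum>\<alpha>\<in>R. k \<alpha> * dunkl_term_C2 \<alpha> p g H x0) \<le> (\<Sum>\<alpha>\<in>R. k \<alpha> * dU s0)"
    using term_le k_pos by (intro sum_mono mult_left_mono) (auto intro: less_imp_le)
  also have "\<dots> = (\<Sum>\<alpha>\<in>R. k \<alpha>) * dU s0" by (simp add: sum_distrib_right)
  finally show ?thesis using lap unfolding dunkl_laplacian_eq[OF f] m_eq s0_def[symmetric]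
    by (simp add: algebra_simps)
qed

lemma dunkl_laplacian_cmult:
  assumes "has_grad_hess f g H"
  shows "dunkl_laplacian R k (\<lambda>x. c * f x) x = c * dunkl_laplacian R k f x"
  using dunkl_laplacian_linear[OF has_grad_hess_const assms, of 0 c x] by (simp add: dunkl_laplacian_const)

text \<open>Compare with the radial function \<open>- (2 \<eta> / m) (\<bar>x\<bar>\<^sup>2 / 2)\<close>, whose Dunkl Laplacian is \<open>- 2 \<eta>\<close>.\<close>

lemma weak_max_principle:
  assumes f: "has_grad_hess p g H" and \<rho>: "\<rho> > 0" and \<eta>: "\<eta> > 0"
    and L: "\<And>x. norm x < \<rho> \<Longrightarrow> dunkl_laplacian R k p x \<ge> - \<eta>"
    and b: "\<And>x. norm x = \<rho> \<Longrightarrow> p x \<le> M" and x: "norm x \<le> \<rho>"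
  shows "p x \<le> M + \<eta> * \<rho>\<^sup>2 / m"
proof -
  define c where "c = 2 * \<eta> / m"
  define U where "U = (\<lambda>s::real. - c * s)"
  have c: "c > 0" using \<eta> m_pos by (simp add: c_def)
  have "continuous_on (cball 0 \<rho>) (\<lambda>x. p x - U ((norm x)\<^sup>2 / 2))"
    unfolding U_def by (intro continuous_intros continuous_on_subset[OF has_grad_hess_continuous(1)[OF f]]) auto
  moreover have "cball (0::'a) \<rho> \<noteq> {}" using \<rho> by simp
  ultimately have "\<exists>x0\<in>cball 0 \<rho>. \<forall>y\<in>cball 0 \<rho>. p y - U ((norm y)\<^sup>2 / 2) \<le> p x0 - U ((norm x0)\<^sup>2 / 2)"
    by (intro continuous_attains_sup compact_cball)
  then obtain x0 where x0: "norm x0 \<le> \<rho>"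
    "\<And>y. norm y \<le> \<rho> \<Longrightarrow> p y - U ((norm y)\<^sup>2 / 2) \<le> p x0 - U ((norm x0)\<^sup>2 / 2)"
    by auto
  have "norm x0 = \<rho>"
  proof (rule ccontr)
    assume "norm x0 \<noteq> \<rho>"
    then have n: "norm x0 < \<rho>" using x0 by simp
    have d: "(U has_real_derivative - c) (at s)" for s
      unfolding U_def by (auto intro!: derivative_eq_intros)
    have "dunkl_laplacian R k p x0 \<le> (norm x0)\<^sup>2 * 0 + m * (- c)"
      by (rule dunkl_laplacian_at_max[OF f, where U = U and dU = "\<lambda>_. - c" and \<rho> = \<rho>])
        (use d n x0 in auto)
    also have "\<dots> = - 2 * \<eta>" using m_pos by (simp add: c_def)
    finally show False using L[OF n] \<eta> by simp
  qed
  then have "p x - U ((norm x)\<^sup>2 / 2) \<le> M - U (\<rho>\<^sup>2 / 2)" using x0(2)[OF x] b[of x0] by simp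
  moreover have "U ((norm x)\<^sup>2 / 2) \<le> 0" using c by (simp add: U_def)
  moreover have "U (\<rho>\<^sup>2 / 2) = - (\<eta> * \<rho>\<^sup>2 / m)" by (simp add: U_def c_def)
  ultimately show ?thesis by linarith
qed

lemma weak_max_principle_abs:
  assumes f: "has_grad_hess p g H" and \<rho>: "\<rho> > 0" and \<eta>: "\<eta> > 0"
    and L: "\<And>x. norm x < \<rho> \<Longrightarrow> \<bar>dunkl_laplacian R k p x\<bar> \<le> \<eta>"
    and b: "\<And>x. norm x = \<rho> \<Longrightarrow> \<bar>p x\<bar> \<le> M" and x: "norm x \<le> \<rho>"
  shows "\<bar>p x\<bar> \<le> M + \<eta> * \<rho>\<^sup>2 / m"
proof -
  have "p x \<le> M + \<eta> * \<rho>\<^sup>2 / m"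
  proof (rule weak_max_principle[OF f \<rho> \<eta> _ _ x])
    show "- \<eta> \<le> dunkl_laplacian R k p y" if "norm y < \<rho>" for y using L[OF that] by linarith
    show "p y \<le> M" if "norm y = \<rho>" for y using b[OF that] by linarith
  qed
  moreover have "-1 * p x \<le> M + \<eta> * \<rho>\<^sup>2 / m"
  proof (rule weak_max_principle[OF has_grad_hess_cmult[OF f] \<rho> \<eta> _ _ x])
    show "- \<eta> \<le> dunkl_laplacian R k (\<lambda>x. -1 * p x) y" if "norm y < \<rho>" for y
      using L[OF that] unfolding dunkl_laplacian_cmult[OF f] by linarith
    show "-1 * p y \<le> M" if "norm y = \<rho>" for y using b[OF that] by linarith
  qed
  ultimately show ?thesis by linarith
qed

lemma dunkl_harmonic_zero:
  assumes f: "has_grad_hess p g H" and \<rho>: "\<rho> > 0"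
    and L: "\<And>x. norm x < \<rho> \<Longrightarrow> dunkl_laplacian R k p x = 0"
    and b: "\<And>x. norm x = \<rho> \<Longrightarrow> p x = 0" and x: "norm x \<le> \<rho>"
  shows "p x = 0"
proof -
  define q where "q = \<rho>\<^sup>2 / m"
  have q: "q > 0" using \<rho> m_pos by (simp add: q_def)
  have le: "\<bar>p x\<bar> \<le> \<eta> * q" if e: "\<eta> > 0" for \<eta>
  proof -
    have "\<bar>p x\<bar> \<le> 0 + \<eta> * \<rho>\<^sup>2 / m"
    proof (rule weak_max_principle_abs[OF f \<rho> e _ _ x])
      show "\<bar>dunkl_laplacian R k p y\<bar> \<le> \<eta>" if "norm y < \<rho>" for y using L[OF that] e by simp
      show "\<bar>p y\<bar> \<le> 0" if "norm y = \<rho>" for y using b[OF that] by simp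
    qed
    then show ?thesis by (simp add: q_def)
  qed
  have "\<bar>p x\<bar> \<le> 0 + e" if "e > 0" for e
    using le[of "e / q"] that q by simp
  then have "\<bar>p x\<bar> \<le> 0" by (rule field_le_epsilon)
  then show ?thesis by simp
qed

end

section \<open>Polynomials and the Dirichlet problem\<close>

text \<open>Finite-dimensional linear algebra for a subspace of a possibly infinite-dimensional space and a map that is linear only
there: the map sends a basis to an independent set of the same size.\<close>

lemma (in vector_space) injective_endomorphism_surjective:
  assumes V: "subspace V" and S: "finite S" "V \<subseteq> span S"
    and LV: "\<And>x. x \<in> V \<Longrightarrow> L x \<in> V"
    and Ladd: "\<And>x y. x \<in> V \<Longrightarrow> y \<in> V \<Longrightarrow> L (x + y) = L x + L y"
    and Lscale: "\<And>c x. x \<in> V \<Longrightarrow> L (scale c x) = scale c (L x)"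
    and Linj: "\<And>x. x \<in> V \<Longrightarrow> L x = 0 \<Longrightarrow> x = 0" and f: "f \<in> V"
  shows "\<exists>q\<in>V. L q = f"
proof -
  interpret pr: vector_space_pair scale scale ..
  obtain B where B: "B \<subseteq> V" "independent B" "V \<subseteq> span B"
    using maximal_independent_subset by blast
  have spB: "span B = V" using span_minimal[OF B(1) V] B(3) by simp
  have finB: "finite B" using independent_span_bound[OF S(1) B(2)] B(1) S(2) by blast
  obtain L' where L': "Vector_Spaces.linear scale scale L'" "\<forall>x\<in>B. L' x = L x"
    using pr.linear_independent_extend[OF B(2), of L] by blast
  interpret L': Vector_Spaces.linear scale scale L' by (rule L'(1))
  have "x \<in> V \<and> L' x = L x" if "x \<in> span B" for x
    using that
  proof (induction rule: span_induct_alt)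
    case base
    have "L (scale 0 0) = scale 0 (L 0)" using V by (intro Lscale) (simp add: subspace_0)
    then show ?case using V by (simp add: subspace_0)
  next
    case (step c x y)
    then have x: "x \<in> V" "L' x = L x" using B(1) L'(2) by auto
    then have "scale c x \<in> V" using V by (simp add: subspace_scale)
    then show ?case using step x V
      by (simp add: subspace_add L'.add L'.scale Ladd Lscale)
  qed
  then have eq: "L' x = L x" if "x \<in> V" for x using that spB by blast
  have inj: "inj_on L' (span B)"
  proof (rule inj_onI)
    fix x y assume xy: "x \<in> span B" "y \<in> span B" "L' x = L' y"
    have V': "x - y \<in> V" using xy spB V by (simp add: subspace_diff)
    have "L (x - y) = 0" using eq[OF V'] xy(3) by (simp add: L'.diff)
    then show "x = y" using Linj[OF V'] by simp
  qed
  have ind: "independent (L' ` B)"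
    by (rule pr.linear_independent_injective_image[OF L'(1) B(2) inj])
  have card: "card (L' ` B) = card B"
    using inj by (intro card_image) (auto intro: inj_on_subset span_base)
  have "f \<in> span (L' ` B)"
  proof (rule ccontr)
    assume n: "f \<notin> span (L' ` B)"
    then have "independent (insert f (L' ` B))" using ind by (simp add: independent_insertI)
    moreover have "insert f (L' ` B) \<subseteq> span B"
      using f LV eq B(1) spB by auto
    ultimately have "card (insert f (L' ` B)) \<le> card B"
      using independent_span_bound[OF finB] by blast
    moreover have "f \<notin> L' ` B" using n span_base by blast
    ultimately show False using finB card by simp
  qed
  then have "f \<in> L' ` V" using pr.linear_span_image[OF L'(1), of B] spB by simp
  then show ?thesis using eq by auto
qed

interpretation fun_vs: vector_space "\<lambda>c (f::'a \<Rightarrow> real) x. c * f x"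
  by unfold_locales (auto simp: fun_eq_iff algebra_simps)

text \<open>The index bounds the degree strictly, so that \<open>poly_below 0\<close> contains only the zero function and lowering the
degree of a constant or linear polynomial by two is expressed by truncated subtraction.\<close>

inductive poly_below :: "nat \<Rightarrow> ('a::euclidean_space \<Rightarrow> real) \<Rightarrow> bool" where
  zero: "poly_below n (\<lambda>x. 0)"
| const: "poly_below (Suc n) (\<lambda>x. c)"
| add: "poly_below n p \<Longrightarrow> poly_below n q \<Longrightarrow> poly_below n (\<lambda>x. p x + q x)"
| lin: "poly_below n p \<Longrightarrow> poly_below (Suc n) (\<lambda>x. (a \<bullet> x) * p x)"

lemma poly_below_0: "poly_below 0 p \<Longrightarrow> p = (\<lambda>x. 0)"
  by (induction "0::nat" p rule: poly_below.induct) auto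

lemma poly_below_mono: "poly_below n p \<Longrightarrow> n \<le> n' \<Longrightarrow> poly_below n' p"
proof (induction arbitrary: n' rule: poly_below.induct)
  case (const n c) then show ?case by (cases n') (auto intro: poly_below.intros)
next
  case (lin n p a) then show ?case by (cases n') (auto intro: poly_below.intros)
qed (auto intro: poly_below.intros)

lemma poly_below_mult: "poly_below n p \<Longrightarrow> poly_below n' q \<Longrightarrow> poly_below (n + n') (\<lambda>x. p x * q x)"
proof (induction rule: poly_below.induct)
  case (zero n) then show ?case by (simp add: poly_below.zero)
next
  case (const n c)
  have "poly_below n' (\<lambda>x. c * q x)" using const
  proof (induction rule: poly_below.induct)
    case (lin n p a)
    then show ?case using poly_below.lin[of n "\<lambda>x. c * p x" a] by (simp add: mult.left_commute)
  qed (auto intro: poly_below.intros simp: distrib_left)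
  then show ?case by (rule poly_below_mono) simp
next
  case (add n p q')
  then show ?case using poly_below.add by (simp add: distrib_right)
next
  case (lin n p a)
  then show ?case using poly_below.lin[of "n + n'" "\<lambda>x. p x * q x" a] by (simp add: mult.assoc)
qed

lemma poly_below_cmult: "poly_below n p \<Longrightarrow> poly_below n (\<lambda>x. c * p x)"
proof (induction rule: poly_below.induct)
  case (lin n p a)
  then show ?case using poly_below.lin[of n "\<lambda>x. c * p x" a] by (simp add: mult.left_commute)
qed (auto intro: poly_below.intros simp: distrib_left)

lemma poly_below_sum:
  "finite A \<Longrightarrow> (\<And>i. i \<in> A \<Longrightarrow> poly_below n (p i)) \<Longrightarrow> poly_below n (\<lambda>x. \<Sum>i\<in>A. p i x)"
  by (induction rule: finite_induct) (auto intro: poly_below.intros)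

text \<open>Truncated subtraction is harmless here: when \<open>n < j\<close> the polynomial \<open>p\<close> is zero.\<close>

lemma poly_below_lin_diff:
  assumes "poly_below (n - j) p"
  shows "poly_below (Suc n - j) (\<lambda>x. (a \<bullet> x) * p x)"
proof (cases "j \<le> n")
  case True
  then show ?thesis using poly_below.lin[OF assms, of a] by (simp add: Suc_diff_le)
next
  case False
  then have "p = (\<lambda>x. 0)" using assms poly_below_0 by simp
  then show ?thesis by (simp add: poly_below.zero)
qed

lemma poly_below_refl: "poly_below n p \<Longrightarrow> poly_below n (\<lambda>x. p (refl_hyp \<alpha> x))"
proof (induction rule: poly_below.induct)
  case (lin n p a)
  then show ?case using poly_below.lin[of n "\<lambda>x. p (refl_hyp \<alpha> x)" "refl_hyp \<alpha> a"]
    by (simp add: refl_hyp_adjoint)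
qed (auto intro: poly_below.intros)

text \<open>Together with \<open>dunkl_term_C2\<close> this divided difference satisfies a twisted Leibniz rule under multiplication by linear
forms, which shows inductively that both map polynomials to polynomials.  On the mirror the value is the limit.\<close>

definition refl_quotient ::
    "'a::euclidean_space \<Rightarrow> ('a \<Rightarrow> real) \<Rightarrow> ('a \<Rightarrow> 'a) \<Rightarrow> 'a \<Rightarrow> real" where
  "refl_quotient \<alpha> p g x =
     (if \<alpha> \<bullet> x \<noteq> 0 then (p x - p (refl_hyp \<alpha> x)) / (\<alpha> \<bullet> x) else 2 * (g x \<bullet> \<alpha>) / (norm \<alpha>)\<^sup>2)"

lemma has_grad_hess_linear: "has_grad_hess (\<lambda>x. a \<bullet> x) (\<lambda>x. a) (\<lambda>x h. 0)"
  unfolding has_grad_hess_def by (auto intro!: derivative_eq_intros)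

lemma refl_quotient_lin:
  assumes "\<alpha> \<noteq> 0"
  shows "refl_quotient \<alpha> (\<lambda>x. (a \<bullet> x) * p x) (\<lambda>x. (a \<bullet> x) *\<^sub>R g x + p x *\<^sub>R a) x
    = (a \<bullet> x) * refl_quotient \<alpha> p g x + 2 * (a \<bullet> \<alpha>) / (norm \<alpha>)\<^sup>2 * p (refl_hyp \<alpha> x)"
proof (cases "\<alpha> \<bullet> x = 0")
  case True
  then have "refl_hyp \<alpha> x = x" by (simp add: refl_hyp_def)
  then show ?thesis using True unfolding refl_quotient_def
    by (simp add: inner_add_left add_divide_distrib distrib_left mult_ac)
next
  case False
  define t N where "t = \<alpha> \<bullet> x" and "N = (norm \<alpha>)\<^sup>2"
  have t: "t \<noteq> 0" using False by (simp add: t_def)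
  have r: "a \<bullet> refl_hyp \<alpha> x = a \<bullet> x - 2 * t / N * (a \<bullet> \<alpha>)"
    by (simp add: refl_hyp_def t_def N_def inner_diff_right)
  have "(A * P - (A - 2 * t / N * C) * Q) / t = A * ((P - Q) / t) + 2 * C / N * Q" for A P Q C :: real
  proof -
    have "A * P - (A - 2 * t / N * C) * Q = A * (P - Q) + t * (2 * C / N * Q)"
      by (simp add: algebra_simps)
    then show ?thesis using t by (simp add: add_divide_distrib)
  qed
  then show ?thesis using False unfolding refl_quotient_def r t_def[symmetric] N_def[symmetric] by simp
qed

lemma dunkl_term_C2_lin:
  assumes "\<alpha> \<noteq> 0"
  shows "dunkl_term_C2 \<alpha> (\<lambda>x. (a \<bullet> x) * p x) (\<lambda>x. (a \<bullet> x) *\<^sub>R g x + p x *\<^sub>R a)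
      (\<lambda>x h. (a \<bullet> x) *\<^sub>R H x h + (a \<bullet> h) *\<^sub>R g x + p x *\<^sub>R 0 + (g x \<bullet> h) *\<^sub>R a) x
    = (a \<bullet> x) * dunkl_term_C2 \<alpha> p g H x + (a \<bullet> \<alpha>) * refl_quotient \<alpha> p g x"
proof (cases "\<alpha> \<bullet> x = 0")
  case True
  then show ?thesis unfolding refl_quotient_def dunkl_term_C2_def
    by (simp add: inner_add_left add_divide_distrib)
next
  case False
  define t N where "t = \<alpha> \<bullet> x" and "N = (norm \<alpha>)\<^sup>2"
  have t: "t \<noteq> 0" using False by (simp add: t_def)
  have N: "N \<noteq> 0" using assms by (simp add: N_def)
  have r: "a \<bullet> refl_hyp \<alpha> x = a \<bullet> x - 2 * t / N * (a \<bullet> \<alpha>)"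
    by (simp add: refl_hyp_def t_def N_def inner_diff_right)
  have "(A * G + P * C) / t - N / 2 * ((A * P - (A - 2 * t / N * C) * Q) / t\<^sup>2)
      = A * (G / t - N / 2 * ((P - Q) / t\<^sup>2)) + C * ((P - Q) / t)" for A G P Q C :: real
  proof -
    have "N / 2 * ((A * P - (A - 2 * t / N * C) * Q)) = N / 2 * (A * (P - Q)) + t * C * Q"
      using N by (simp add: algebra_simps)
    then have "N / 2 * ((A * P - (A - 2 * t / N * C) * Q) / t\<^sup>2) = A * (N / 2 * ((P - Q) / t\<^sup>2)) + C * Q / t"
      using t by (simp add: add_divide_distrib power2_eq_square)
    then show ?thesis by (simp only:) (simp add: add_divide_distrib diff_divide_distrib algebra_simps)
  qed
  then show ?thesis using False
    unfolding refl_quotient_def dunkl_term_C2_def r t_def[symmetric] N_def[symmetric] inner_add_left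
    by simp
qed

text \<open>All degree bounds are proved in one induction because the rule for \<open>dunkl_term_C2\<close> of a product involves
\<open>refl_quotient\<close>, and that of \<open>refl_quotient\<close> involves the reflected polynomial.\<close>

lemma poly_below_data:
  assumes "poly_below n p"
  shows "\<exists>g H. has_grad_hess p g H \<and> (\<forall>b. poly_below (n - 1) (\<lambda>x. g x \<bullet> b))
    \<and> (\<forall>b c. poly_below (n - 2) (\<lambda>x. H x b \<bullet> c))
    \<and> (\<forall>\<alpha>. \<alpha> \<noteq> 0 \<longrightarrow> poly_below (n - 1) (refl_quotient \<alpha> p g) \<and> poly_below (n - 2) (dunkl_term_C2 \<alpha> p g H))"
  using assms
proof (induction rule: poly_below.induct)
  case (zero n)
  have "refl_quotient \<alpha> (\<lambda>x. 0) (\<lambda>x. 0) = (\<lambda>x. 0)" "dunkl_term_C2 \<alpha> (\<lambda>x. 0) (\<lambda>x. 0) (\<lambda>x h. 0) = (\<lambda>x. 0)"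
    for \<alpha> :: 'a by (auto simp: fun_eq_iff refl_quotient_def dunkl_term_C2_def)
  then show ?case using has_grad_hess_const[of 0]
    by (intro exI[of _ "\<lambda>x. 0"] exI[of _ "\<lambda>x h. 0"]) (auto intro: poly_below.zero)
next
  case (const n c)
  have "refl_quotient \<alpha> (\<lambda>x. c) (\<lambda>x. 0) = (\<lambda>x. 0)" "dunkl_term_C2 \<alpha> (\<lambda>x. c) (\<lambda>x. 0) (\<lambda>x h. 0) = (\<lambda>x. 0)"
    for \<alpha> :: 'a by (auto simp: fun_eq_iff refl_quotient_def dunkl_term_C2_def)
  then show ?case using has_grad_hess_const[of c]
    by (intro exI[of _ "\<lambda>x. 0"] exI[of _ "\<lambda>x h. 0"]) (auto intro: poly_below.zero)
next
  case (add n p q)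
  from add.IH obtain g H where p: "has_grad_hess p g H" "\<And>b. poly_below (n - 1) (\<lambda>x. g x \<bullet> b)"
    "\<And>b c. poly_below (n - 2) (\<lambda>x. H x b \<bullet> c)"
    "\<And>\<alpha>. \<alpha> \<noteq> 0 \<Longrightarrow> poly_below (n - 1) (refl_quotient \<alpha> p g)"
    "\<And>\<alpha>. \<alpha> \<noteq> 0 \<Longrightarrow> poly_below (n - 2) (dunkl_term_C2 \<alpha> p g H)" by blast
  from add.IH obtain g' H' where q: "has_grad_hess q g' H'" "\<And>b. poly_below (n - 1) (\<lambda>x. g' x \<bullet> b)"
    "\<And>b c. poly_below (n - 2) (\<lambda>x. H' x b \<bullet> c)"
    "\<And>\<alpha>. \<alpha> \<noteq> 0 \<Longrightarrow> poly_below (n - 1) (refl_quotient \<alpha> q g')"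
    "\<And>\<alpha>. \<alpha> \<noteq> 0 \<Longrightarrow> poly_below (n - 2) (dunkl_term_C2 \<alpha> q g' H')" by blast
  have e1: "refl_quotient \<alpha> (\<lambda>x. p x + q x) (\<lambda>x. g x + g' x)
      = (\<lambda>x. refl_quotient \<alpha> p g x + refl_quotient \<alpha> q g' x)" for \<alpha>
    by (auto simp: fun_eq_iff refl_quotient_def inner_add_left add_divide_distrib diff_divide_distrib distrib_left)
  have e2: "dunkl_term_C2 \<alpha> (\<lambda>x. p x + q x) (\<lambda>x. g x + g' x) (\<lambda>x h. H x h + H' x h)
      = (\<lambda>x. dunkl_term_C2 \<alpha> p g H x + dunkl_term_C2 \<alpha> q g' H' x)" for \<alpha>
    using dunkl_term_C2_linear[of \<alpha> p 1 q g g' H H'] by (simp add: fun_eq_iff)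
  show ?case
    by (rule exI[of _ "\<lambda>x. g x + g' x"], rule exI[of _ "\<lambda>x h. H x h + H' x h"])
      (auto simp: e1 e2 inner_add_left simp del: One_nat_def intro!: poly_below.add has_grad_hess_add p q)
next
  case (lin n p a)
  from lin.IH obtain g H where p: "has_grad_hess p g H" "\<And>b. poly_below (n - 1) (\<lambda>x. g x \<bullet> b)"
    "\<And>b c. poly_below (n - 2) (\<lambda>x. H x b \<bullet> c)"
    "\<And>\<alpha>. \<alpha> \<noteq> 0 \<Longrightarrow> poly_below (n - 1) (refl_quotient \<alpha> p g)"
    "\<And>\<alpha>. \<alpha> \<noteq> 0 \<Longrightarrow> poly_below (n - 2) (dunkl_term_C2 \<alpha> p g H)" by blast
  let ?g = "\<lambda>x. (a \<bullet> x) *\<^sub>R g x + p x *\<^sub>R a"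
  let ?H = "\<lambda>x h. (a \<bullet> x) *\<^sub>R H x h + (a \<bullet> h) *\<^sub>R g x + p x *\<^sub>R 0 + (g x \<bullet> h) *\<^sub>R a"
  have 1: "has_grad_hess (\<lambda>x. (a \<bullet> x) * p x) ?g ?H"
    by (rule has_grad_hess_mult[OF has_grad_hess_linear p(1)])
  have 2: "poly_below (Suc n - 1) (\<lambda>x. ?g x \<bullet> b)" for b
    using poly_below.add[OF poly_below_lin_diff[OF p(2)[of b], simplified] poly_below_cmult[OF lin.hyps, of "a \<bullet> b"], of a]
    by (simp add: inner_add_left mult.commute[of "p _"])
  have s: "Suc n - 2 = n - 1" by simp
  have 3: "poly_below (Suc n - 2) (\<lambda>x. ?H x b \<bullet> c)" for b c
    using poly_below.add[OF poly_below.add[OF poly_below_lin_diff[OF p(3)[of b c], of a]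
        poly_below_cmult[OF p(2)[of c], of "a \<bullet> b", folded s]]
        poly_below_cmult[OF p(2)[of b], of "a \<bullet> c", folded s]]
    by (simp add: inner_add_left mult.commute[of "g _ \<bullet> _" "a \<bullet> c"])
  have 4: "poly_below (Suc n - 1) (refl_quotient \<alpha> (\<lambda>x. (a \<bullet> x) * p x) ?g)" if "\<alpha> \<noteq> 0" for \<alpha>
    unfolding refl_quotient_lin[OF that, abs_def]
    using poly_below.add[OF poly_below_lin_diff[OF p(4)[OF that], simplified]
      poly_below_cmult[OF poly_below_refl[OF lin.hyps, of \<alpha>], of "2 * (a \<bullet> \<alpha>) / (norm \<alpha>)\<^sup>2"], of a] by simp
  have 5: "poly_below (Suc n - 2) (dunkl_term_C2 \<alpha> (\<lambda>x. (a \<bullet> x) * p x) ?g ?H)" if "\<alpha> \<noteq> 0" for \<alpha>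
    unfolding dunkl_term_C2_lin[OF that, abs_def]
    using poly_below.add[OF poly_below_lin_diff[OF p(5)[OF that]]
      poly_below_cmult[OF p(4)[OF that], of "a \<bullet> \<alpha>", folded s], of a] by simp
  show ?case using 1 2 3 4 5 by blast
qed

lemma poly_below_grad_hess:
  assumes "poly_below n p"
  obtains g H where "has_grad_hess p g H"
  using poly_below_data[OF assms] by blast

lemma poly_below_inner_self_mult:
  assumes "poly_below n q"
  shows "poly_below (Suc (Suc n)) (\<lambda>x. (x \<bullet> x) * q x)"
proof -
  have "poly_below (Suc (Suc n)) (\<lambda>x. \<Sum>b\<in>Basis. (b \<bullet> x) * ((b \<bullet> x) * q x))"
    by (intro poly_below_sum poly_below.lin assms finite_Basis)
  also have "(\<lambda>x. \<Sum>b\<in>Basis. (b \<bullet> x) * ((b \<bullet> x) * q x)) = (\<lambda>x. (x \<bullet> x) * q x)"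
  proof
    fix x :: 'a
    have "x \<bullet> x = (\<Sum>b\<in>Basis. (b \<bullet> x) * (b \<bullet> x))"
      using euclidean_inner[of x x] by (simp add: inner_commute)
    then show "(\<Sum>b\<in>Basis. (b \<bullet> x) * ((b \<bullet> x) * q x)) = (x \<bullet> x) * q x"
      by (simp add: sum_distrib_right mult.assoc)
  qed
  finally show ?thesis .
qed

lemma poly_below_boundary_factor:
  assumes "poly_below n q"
  shows "poly_below (Suc (Suc n)) (\<lambda>x. (c - x \<bullet> x) * q x)"
  using poly_below.add[OF poly_below_mono[OF poly_below_cmult[OF assms, of c], of "Suc (Suc n)"]
      poly_below_cmult[OF poly_below_inner_self_mult[OF assms], of "-1", simplified]]
  by (simp add: left_diff_distrib)

text \<open>Reduces the identity theorem for polynomials to one variable.\<close>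

lemma poly_below_ray:
  assumes "poly_below n p"
  shows "\<exists>P. \<forall>t. p (t *\<^sub>R x) = poly P t"
  using assms
proof (induction rule: poly_below.induct)
  case (zero n) show ?case by (intro exI[of _ 0]) simp
next
  case (const n c) show ?case by (intro exI[of _ "[:c:]"]) simp
next
  case (add n p q)
  then obtain P Q where "\<forall>t. p (t *\<^sub>R x) = poly P t" "\<forall>t. q (t *\<^sub>R x) = poly Q t" by blast
  then show ?case by (intro exI[of _ "P + Q"]) simp
next
  case (lin n p a)
  then obtain P where "\<forall>t. p (t *\<^sub>R x) = poly P t" by blast
  then show ?case by (intro exI[of _ "[:0, a \<bullet> x:] * P"]) simp
qed

lemma poly_below_zero_on_ball:
  assumes p: "poly_below n p" and \<rho>: "\<rho> > 0" and z: "\<And>x. norm x < \<rho> \<Longrightarrow> p x = 0"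
  shows "p x = 0"
proof -
  obtain P where P: "\<And>t. p (t *\<^sub>R x) = poly P t" using poly_below_ray[OF p] by blast
  define e where "e = \<rho> / (norm x + 1)"
  have nx: "norm x + 1 > 0" using norm_ge_zero[of x] by linarith
  have e: "e > 0" using \<rho> nx by (simp add: e_def)
  have "poly P t = 0" if "t \<in> {0<..<e}" for t
  proof -
    have "t * norm x \<le> t * (norm x + 1)" using that by (intro mult_left_mono) auto
    also have "\<dots> < e * (norm x + 1)" using that nx by (intro mult_strict_right_mono) auto
    also have "\<dots> = \<rho>" using nx by (simp add: e_def)
    finally have "norm (t *\<^sub>R x) < \<rho>" using that by simp
    from z[OF this] P show ?thesis by metis
  qed
  then have "{0<..<e} \<subseteq> {t. poly P t = 0}" by blast
  moreover have "infinite {0<..<e}" using e by (simp add: infinite_Ioo)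
  ultimately have "P = 0" using poly_roots_finite finite_subset by blast
  then show ?thesis using P[of 1] by simp
qed

primrec monomials_below :: "nat \<Rightarrow> ('a::euclidean_space \<Rightarrow> real) set" where
  "monomials_below 0 = {}"
| "monomials_below (Suc n) = {\<lambda>x. 1} \<union> monomials_below n \<union> (\<lambda>(b, f) x. (b \<bullet> x) * f x) ` (Basis \<times> monomials_below n)"

lemma finite_monomials_below: "finite (monomials_below n)"
  by (induction n) auto

lemma poly_below_in_span:
  "poly_below n p \<Longrightarrow> p \<in> fun_vs.span (monomials_below n)"
proof (induction rule: poly_below.induct)
  case (zero n)
  then show ?case using fun_vs.span_zero[of "monomials_below n"] by (simp add: zero_fun_def)
next
  case (const n c)
  have "(\<lambda>x. c * (\<lambda>x. 1) x) \<in> fun_vs.span (monomials_below (Suc n))"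
    by (rule fun_vs.span_scale, rule fun_vs.span_base) simp
  then show ?case by simp
next
  case (add n p q)
  then show ?case using fun_vs.span_add[of p _ q] by (simp add: plus_fun_def)
next
  case (lin n p a)
  have b: "(\<lambda>x. (b \<bullet> x) * p x) \<in> fun_vs.span (monomials_below (Suc n))" if "b \<in> Basis" for b
    using lin.IH
  proof (induction rule: fun_vs.span_induct_alt)
    case base
    then show ?case using fun_vs.span_zero by (simp add: zero_fun_def)
  next
    case (step c f g)
    have "(\<lambda>x. (b \<bullet> x) * f x) \<in> fun_vs.span (monomials_below (Suc n))"
      using step(1) that by (intro fun_vs.span_base) (auto intro!: image_eqI[of _ _ "(b, f)"])
    from fun_vs.span_add[OF fun_vs.span_scale[OF this, of c] step(2)]
    show ?case by (simp add: plus_fun_def distrib_left mult.left_commute)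
  qed
  have "(\<Sum>b\<in>Basis. (\<lambda>x. (a \<bullet> b) * ((b \<bullet> x) * p x))) \<in> fun_vs.span (monomials_below (Suc n))"
    by (rule fun_vs.span_sum, rule fun_vs.span_scale, rule b)
  also have "(\<Sum>b\<in>Basis. (\<lambda>x. (a \<bullet> b) * ((b \<bullet> x) * p x))) = (\<lambda>x. (a \<bullet> x) * p x)"
  proof
    fix x
    have "(\<Sum>b\<in>Basis. (\<lambda>x. (a \<bullet> b) * ((b \<bullet> x) * p x))) x = (\<Sum>b\<in>Basis. (a \<bullet> b) * ((b \<bullet> x) * p x))"
      by (induction rule: infinite_finite_induct[of _ "Basis :: 'a set"]) auto
    also have "\<dots> = (a \<bullet> x) * p x"
    proof -
      have "a \<bullet> x = (\<Sum>b\<in>Basis. (a \<bullet> b) * (b \<bullet> x))"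
        using euclidean_inner[of a x] by (simp add: inner_commute)
      then show ?thesis by (simp add: sum_distrib_right mult.assoc)
    qed
    finally show "(\<Sum>b\<in>Basis. (\<lambda>x. (a \<bullet> b) * ((b \<bullet> x) * p x))) x = (a \<bullet> x) * p x" .
  qed
  finally show ?case .
qed

context dunkl_setting
begin

lemma poly_below_dunkl_laplacian:
  assumes "poly_below n p"
  shows "poly_below (n - 2) (dunkl_laplacian R k p)"
proof -
  obtain g H where p: "has_grad_hess p g H" "\<And>b c. poly_below (n - 2) (\<lambda>x. H x b \<bullet> c)"
    "\<And>\<alpha>. \<alpha> \<noteq> 0 \<Longrightarrow> poly_below (n - 2) (dunkl_term_C2 \<alpha> p g H)" using poly_below_data[OF assms] by blast
  have "poly_below (n - 2) (\<lambda>x. (\<Sum>b\<in>Basis. H x b \<bullet> b) + (\<Sum>\<alpha>\<in>R. k \<alpha> * dunkl_term_C2 \<alpha> p g H x))"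
    by (intro poly_below.add poly_below_sum finite_Basis finite_R poly_below_cmult p(2) p(3) R_nonzero)
  also have "(\<lambda>x. (\<Sum>b\<in>Basis. H x b \<bullet> b) + (\<Sum>\<alpha>\<in>R. k \<alpha> * dunkl_term_C2 \<alpha> p g H x)) = dunkl_laplacian R k p"
    using dunkl_laplacian_eq[OF p(1)] by auto
  finally show ?thesis .
qed

text \<open>The kernel of \<open>q \<mapsto> \<Delta>\<^sub>k ((\<rho>\<^sup>2 - \<bar>x\<bar>\<^sup>2) q)\<close> is trivial by the maximum principle, since the argument vanishes on the
sphere; multiplication by \<open>\<rho>\<^sup>2 - \<bar>x\<bar>\<^sup>2\<close> raises the degree by the two that \<open>\<Delta>\<^sub>k\<close> takes away.\<close>

lemma dirichlet_polynomial:
  assumes f: "poly_below n f" and \<rho>: "\<rho> > 0"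
  obtains q where "poly_below n q" "dunkl_laplacian R k (\<lambda>x. (\<rho>\<^sup>2 - x \<bullet> x) * q x) = f"
proof -
  define L where "L = (\<lambda>q. dunkl_laplacian R k (\<lambda>x. (\<rho>\<^sup>2 - x \<bullet> x) * q x))"
  have gh: "\<exists>g H. has_grad_hess (\<lambda>x. (\<rho>\<^sup>2 - x \<bullet> x) * q x) g H" if "poly_below n q" for q
    using poly_below_data[OF poly_below_boundary_factor[OF that]] by blast
  have "\<exists>q\<in>Collect (poly_below n). L q = f"
  proof (rule fun_vs.injective_endomorphism_surjective[of _ "monomials_below n"])
    show "fun_vs.subspace (Collect (poly_below n :: ('a \<Rightarrow> real) \<Rightarrow> bool))"
      unfolding fun_vs.subspace_def
      by (auto simp: zero_fun_def plus_fun_def intro: poly_below.zero poly_below.add poly_below_cmult)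
    show "finite (monomials_below n :: ('a \<Rightarrow> real) set)" by (rule finite_monomials_below)
    show "Collect (poly_below n) \<subseteq> fun_vs.span (monomials_below n :: ('a \<Rightarrow> real) set)"
      using poly_below_in_span by blast
    show "L q \<in> Collect (poly_below n)" if "q \<in> Collect (poly_below n)" for q
      using poly_below_dunkl_laplacian[OF poly_below_boundary_factor, of n q] that by (simp add: L_def)
    show "f \<in> Collect (poly_below n)" using f by simp
    show "L (p + q) = L p + L q" if pq: "p \<in> Collect (poly_below n)" "q \<in> Collect (poly_below n)" for p q
    proof
      fix x
      obtain g H g' H' where "has_grad_hess (\<lambda>x. (\<rho>\<^sup>2 - x \<bullet> x) * p x) g H"
        "has_grad_hess (\<lambda>x. (\<rho>\<^sup>2 - x \<bullet> x) * q x) g' H'" using gh pq by blast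
      from dunkl_laplacian_linear[OF this, of 1 x] show "L (p + q) x = (L p + L q) x"
        by (simp add: L_def distrib_left)
    qed
    show "L (\<lambda>x. c * q x) = (\<lambda>x. c * L q x)" if q: "q \<in> Collect (poly_below n)" for c q
    proof
      fix x
      obtain g H where "has_grad_hess (\<lambda>x. (\<rho>\<^sup>2 - x \<bullet> x) * q x) g H" using gh q by blast
      from dunkl_laplacian_cmult[OF this, of c x] show "L (\<lambda>x. c * q x) x = c * L q x"
        by (simp add: L_def mult.left_commute)
    qed
    show "q = 0" if q: "q \<in> Collect (poly_below n)" and z: "L q = 0" for q
    proof -
      obtain g H where gh': "has_grad_hess (\<lambda>x. (\<rho>\<^sup>2 - x \<bullet> x) * q x) g H" using gh q by blast
      have "q x = 0" if x: "norm x < \<rho>" for x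
      proof -
        have "(\<rho>\<^sup>2 - x \<bullet> x) * q x = 0"
        proof (rule dunkl_harmonic_zero[OF gh' \<rho>])
          show "dunkl_laplacian R k (\<lambda>x. (\<rho>\<^sup>2 - x \<bullet> x) * q x) y = 0" for y
            using fun_cong[OF z, of y] by (simp add: L_def)
          show "(\<rho>\<^sup>2 - y \<bullet> y) * q y = 0" if "norm y = \<rho>" for y
            using that by (simp add: power2_norm_eq_inner[symmetric])
        qed (use x in simp)
        moreover have "x \<bullet> x < \<rho>\<^sup>2"
          unfolding power2_norm_eq_inner[symmetric] using x by (intro power_strict_mono) auto
        ultimately show ?thesis by simp
      qed
      from poly_below_zero_on_ball[OF _ \<rho> this] q show "q = 0" by (auto simp: fun_eq_iff)
    qed
  qed
  then show ?thesis using that by (auto simp: L_def)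
qed

end

lemma real_polynomial_function_poly_below:
  fixes p :: "'a::euclidean_space \<Rightarrow> real"
  assumes "real_polynomial_function p"
  shows "\<exists>n. poly_below n p"
  using assms
proof (induction rule: real_polynomial_function.induct)
  case (linear f)
  then have l: "linear f" by (rule bounded_linear.linear)
  define a where "a = (\<Sum>b\<in>Basis. f b *\<^sub>R b)"
  have "f x = (a \<bullet> x) * 1" for x
    using Linear_Algebra.linear_componentwise[OF l, of x 1]
    by (simp add: a_def inner_sum_left inner_sum_right inner_commute mult.commute)
  then have "f = (\<lambda>x. (a \<bullet> x) * 1)" by blast
  then show ?case using poly_below.lin[OF poly_below.const[of 0 1], of a] by metis
next
  case (const c)
  then show ?case using poly_below.const by blast
next
  case (add f g)
  then obtain n n' where "poly_below n f" "poly_below n' g" by blast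
  then have "poly_below (max n n') f" "poly_below (max n n') g" by (auto intro: poly_below_mono)
  then show ?case using poly_below.add by blast
next
  case (mult f g)
  then show ?case using poly_below_mult by blast
qed

lemma polynomial_approximation:
  fixes f :: "'a::euclidean_space \<Rightarrow> real"
  assumes "compact S" "continuous_on S f" "e > 0"
  obtains n p where "poly_below n p" "\<And>x. x \<in> S \<Longrightarrow> \<bar>f x - p x\<bar> < e"
  using Stone_Weierstrass_real_polynomial_function[OF assms] real_polynomial_function_poly_below by metis

section \<open>Smooth cut-offs of a ball\<close>

text \<open>For \<open>\<delta> > 0\<close> this family is closed under differentiation up to linear combinations, including at \<open>0\<close>, where
all members vanish to infinite order.\<close>

definition flat_exp :: "real \<Rightarrow> nat \<Rightarrow> real \<Rightarrow> real" where
  "flat_exp \<delta> n \<tau> = (if \<tau> > 0 then exp (- \<delta> / \<tau>) / \<tau> ^ n else 0)"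

lemma flat_exp_mult: "\<tau> * flat_exp \<delta> (Suc n) \<tau> = flat_exp \<delta> n \<tau>"
  by (simp add: flat_exp_def)

lemma flat_exp_at_0:
  assumes "\<delta> > 0"
  shows "(flat_exp \<delta> n \<longlongrightarrow> 0) (at 0)"
proof -
  have 1: "((\<lambda>y::real. y ^ n / exp y / \<delta> ^ n) \<longlongrightarrow> 0 / \<delta> ^ n) at_top"
    by (intro tendsto_divide tendsto_power_div_exp_0 tendsto_const) (use assms in auto)
  have 2: "filterlim (\<lambda>t. \<delta> * inverse t) at_top (at_right 0)"
    by (rule filterlim_tendsto_pos_mult_at_top[OF tendsto_const assms filterlim_inverse_at_top_right])
  have "((\<lambda>t. (\<delta> * inverse t) ^ n / exp (\<delta> * inverse t) / \<delta> ^ n) \<longlongrightarrow> 0) (at_right 0)"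
    using filterlim_compose[OF 1 2] by simp
  moreover have "\<forall>\<^sub>F t in at_right 0. (\<delta> * inverse t) ^ n / exp (\<delta> * inverse t) / \<delta> ^ n = flat_exp \<delta> n t"
    unfolding eventually_at_filter using assms
    by (intro always_eventually) (auto simp: flat_exp_def exp_minus power_mult_distrib divide_inverse power_inverse)
  ultimately have r: "(flat_exp \<delta> n \<longlongrightarrow> 0) (at_right 0)" using Lim_transform_eventually by fast
  have "\<forall>\<^sub>F t in at_left (0::real). 0 = flat_exp \<delta> n t"
    unfolding eventually_at_filter by (intro always_eventually) (auto simp: flat_exp_def)
  then have l: "(flat_exp \<delta> n \<longlongrightarrow> 0) (at_left 0)" using Lim_transform_eventually[OF tendsto_const] by fast
  show ?thesis using l r by (rule filterlim_split_at_real)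
qed

lemma flat_exp_deriv:
  assumes d: "\<delta> > 0"
  shows "(flat_exp \<delta> n has_real_derivative (\<delta> * flat_exp \<delta> (Suc (Suc n)) \<tau> - real n * flat_exp \<delta> (Suc n) \<tau>)) (at \<tau>)"
proof -
  consider "\<tau> > 0" | "\<tau> < 0" | "\<tau> = 0" by linarith
  then show ?thesis
  proof cases
    case 1
    have "((\<lambda>\<tau>. exp (- \<delta> / \<tau>) / \<tau> ^ n) has_real_derivative
        (\<delta> * flat_exp \<delta> (Suc (Suc n)) \<tau> - real n * flat_exp \<delta> (Suc n) \<tau>)) (at \<tau>)"
    proof -
      have e: "((\<lambda>\<tau>. exp (- \<delta> / \<tau>)) has_real_derivative exp (- \<delta> / \<tau>) * (\<delta> / \<tau>\<^sup>2)) (at \<tau>)"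
        using 1 by (auto intro!: derivative_eq_intros simp: power2_eq_square)
      have "((\<lambda>\<tau>. exp (- \<delta> / \<tau>) / \<tau> ^ n) has_real_derivative
          (exp (- \<delta> / \<tau>) * (\<delta> / \<tau>\<^sup>2) * \<tau> ^ n - exp (- \<delta> / \<tau>) * (real n * \<tau> ^ (n - Suc 0))) / (\<tau> ^ n * \<tau> ^ n)) (at \<tau>)"
        using 1 by (intro DERIV_divide e DERIV_pow) simp
      moreover have "(X * (\<delta> / \<tau>\<^sup>2) * \<tau> ^ n - X * (real n * \<tau> ^ (n - Suc 0))) / (\<tau> ^ n * \<tau> ^ n)
          = \<delta> * (X / \<tau> ^ Suc (Suc n)) - real n * (X / \<tau> ^ Suc n)" for X
        using 1 by (cases n) (simp_all add: field_simps power2_eq_square)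
      ultimately show ?thesis using 1 by (simp only: flat_exp_def if_True)
    qed
    then show ?thesis
      by (rule DERIV_cong_ev[OF refl _ refl, THEN iffD1, rotated])
        (rule eventually_mono[OF eventually_nhds_in_open[of "{0<..}"]], use 1 in \<open>auto simp: flat_exp_def\<close>)
  next
    case 2
    have "((\<lambda>\<tau>. 0) has_real_derivative (\<delta> * flat_exp \<delta> (Suc (Suc n)) \<tau> - real n * flat_exp \<delta> (Suc n) \<tau>)) (at \<tau>)"
      using 2 by (simp add: flat_exp_def)
    then show ?thesis
      by (rule DERIV_cong_ev[OF refl _ refl, THEN iffD1, rotated])
        (rule eventually_mono[OF eventually_nhds_in_open[of "{..<0}"]], use 2 in \<open>auto simp: flat_exp_def\<close>)
  next
    case 3
    have "\<forall>\<^sub>F t in at (0::real). flat_exp \<delta> (Suc n) t = (flat_exp \<delta> n t - flat_exp \<delta> n 0) / (t - 0)"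
      unfolding eventually_at_filter by (intro always_eventually) (auto simp: flat_exp_def)
    from Lim_transform_eventually[OF flat_exp_at_0[OF d] this]
    have "(flat_exp \<delta> n has_real_derivative 0) (at 0)" by (simp add: has_field_derivative_iff)
    then show ?thesis using 3 by (simp add: flat_exp_def)
  qed
qed

text \<open>A class of functions closed under partial derivatives all of whose members are differentiable, hence smooth.\<close>

inductive flat_class :: "real \<Rightarrow> real \<Rightarrow> ('a::euclidean_space \<Rightarrow> real) \<Rightarrow> bool" for \<delta> c where
  base: "flat_class \<delta> c (\<lambda>x. flat_exp \<delta> n (c - x \<bullet> x))"
| add: "flat_class \<delta> c p \<Longrightarrow> flat_class \<delta> c q \<Longrightarrow> flat_class \<delta> c (\<lambda>x. p x + q x)"
| cmult: "flat_class \<delta> c p \<Longrightarrow> flat_class \<delta> c (\<lambda>x. a * p x)"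
| lin: "flat_class \<delta> c p \<Longrightarrow> flat_class \<delta> c (\<lambda>x. (b \<bullet> x) * p x)"

lemma flat_class_deriv:
  assumes "flat_class \<delta> c f" and d: "\<delta> > 0"
  shows "\<exists>D. (\<forall>x. (f has_derivative (\<lambda>h. D x \<bullet> h)) (at x)) \<and> (\<forall>b. flat_class \<delta> c (\<lambda>x. D x \<bullet> b))"
  using assms(1)
proof (induction rule: flat_class.induct)
  case (base n)
  let ?G = "\<lambda>x::'a. \<delta> * flat_exp \<delta> (Suc (Suc n)) (c - x \<bullet> x) - real n * flat_exp \<delta> (Suc n) (c - x \<bullet> x)"
  let ?D = "\<lambda>x::'a. (-2 * ?G x) *\<^sub>R x"
  have "((\<lambda>x. flat_exp \<delta> n (c - x \<bullet> x)) has_derivative (\<lambda>h. ?D x \<bullet> h)) (at x)" for x :: 'a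
  proof -
    have i: "((\<lambda>x. c - x \<bullet> x) has_derivative (\<lambda>h. - 2 * (x \<bullet> h))) (at x)"
      by (auto intro!: derivative_eq_intros simp: inner_commute)
    show ?thesis
      by (rule has_derivative_eq_rhs[OF has_derivative_compose[OF i
            flat_exp_deriv[OF d, of n "c - x \<bullet> x", unfolded has_field_derivative_def]]])
        (simp add: fun_eq_iff algebra_simps)
  qed
  moreover have "flat_class \<delta> c (\<lambda>x::'a. ?D x \<bullet> b)" for b
  proof -
    have "flat_class \<delta> c (\<lambda>x::'a. (b \<bullet> x) * ((-2 * \<delta>) * flat_exp \<delta> (Suc (Suc n)) (c - x \<bullet> x)
       + (2 * real n) * flat_exp \<delta> (Suc n) (c - x \<bullet> x)))"
      by (intro flat_class.intros)
    also have "(\<lambda>x::'a. (b \<bullet> x) * ((-2 * \<delta>) * flat_exp \<delta> (Suc (Suc n)) (c - x \<bullet> x)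
       + (2 * real n) * flat_exp \<delta> (Suc n) (c - x \<bullet> x))) = (\<lambda>x. ?D x \<bullet> b)"
      by (auto simp: fun_eq_iff algebra_simps inner_commute)
    finally show ?thesis .
  qed
  ultimately show ?case by (intro exI[of _ ?D] conjI allI)
next
  case (add p q)
  then obtain D E where "\<forall>x. (p has_derivative (\<lambda>h. D x \<bullet> h)) (at x)" "\<forall>b. flat_class \<delta> c (\<lambda>x. D x \<bullet> b)"
    "\<forall>x. (q has_derivative (\<lambda>h. E x \<bullet> h)) (at x)" "\<forall>b. flat_class \<delta> c (\<lambda>x. E x \<bullet> b)" by blast
  then show ?case unfolding inner_add_left[symmetric]
    by (intro exI[of _ "\<lambda>x. D x + E x"]) (auto simp only: inner_add_left intro!: has_derivative_add flat_class.add)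
next
  case (cmult p a)
  then obtain D where "\<forall>x. (p has_derivative (\<lambda>h. D x \<bullet> h)) (at x)" "\<forall>b. flat_class \<delta> c (\<lambda>x. D x \<bullet> b)" by blast
  then show ?case
    by (intro exI[of _ "\<lambda>x. a *\<^sub>R D x"]) (auto simp only: inner_scaleR_left intro!: has_derivative_mult_right flat_class.cmult)
next
  case (lin p a)
  then obtain D where D: "\<And>x. (p has_derivative (\<lambda>h. D x \<bullet> h)) (at x)" "\<And>b. flat_class \<delta> c (\<lambda>x. D x \<bullet> b)" by blast
  have "((\<lambda>x. (a \<bullet> x) * p x) has_derivative (\<lambda>h. ((a \<bullet> x) *\<^sub>R D x + p x *\<^sub>R a) \<bullet> h)) (at x)" for x
    by (rule has_derivative_eq_rhs, rule has_derivative_mult[OF _ D(1)], rule has_derivative_inner_right,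
       rule has_derivative_ident) (auto simp: fun_eq_iff algebra_simps)
  moreover have "flat_class \<delta> c (\<lambda>x. ((a \<bullet> x) *\<^sub>R D x + p x *\<^sub>R a) \<bullet> b)" for b
    using flat_class.add[OF flat_class.lin[OF D(2)[of b], of a] flat_class.cmult[OF lin.hyps, of "a \<bullet> b"]]
    by (simp add: inner_add_left mult.commute)
  ultimately show ?case by (intro exI[of _ "\<lambda>x. (a \<bullet> x) *\<^sub>R D x + p x *\<^sub>R a"]) blast
qed

lemma flat_class_smooth:
  assumes f: "flat_class \<delta> c f" and d: "\<delta> > 0"
  shows "smooth f"
proof -
  have part: "flat_class \<delta> c (partial b h)" if h: "flat_class \<delta> c h" for h :: "'a \<Rightarrow> real" and b
  proof -
    obtain D where D: "\<And>x. (h has_derivative (\<lambda>v. D x \<bullet> v)) (at x)" "\<And>b. flat_class \<delta> c (\<lambda>x. D x \<bullet> b)"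
      using flat_class_deriv[OF h d] by blast
    have "partial b h = (\<lambda>x. D x \<bullet> b)"
      unfolding partial_def using frechet_derivative_at[OF D(1)] by metis
    then show ?thesis using D(2) by simp
  qed
  have "flat_class \<delta> c (foldr partial bs f)" for bs
    using f part by (induction bs) auto
  moreover have "h differentiable_on UNIV" if "flat_class \<delta> c h" for h :: "'a \<Rightarrow> real"
    unfolding differentiable_on_def differentiable_def
    using flat_class_deriv[OF that d] by auto
  ultimately show ?thesis by (simp add: smooth_def)
qed

lemma flat_class_mult_poly:
  assumes "poly_below n q" "flat_class \<delta> c f"
  shows "flat_class \<delta> c (\<lambda>x. f x * q x)"
  using assms(1)
proof (induction rule: poly_below.induct)
  case (zero n) show ?case using flat_class.cmult[OF assms(2), of 0] by simp
next
  case (const n a) show ?case using flat_class.cmult[OF assms(2), of a] by (simp add: mult.commute)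
next
  case (add n p q) then show ?case using flat_class.add by (simp add: distrib_left)
next
  case (lin n p a) then show ?case using flat_class.lin[of \<delta> c "\<lambda>x. f x * p x" a] by (simp add: mult.left_commute)
qed

text \<open>A smooth version of the positive part of \<open>\<tau>\<close>, to which it converges as \<open>\<delta>\<close> decreases to \<open>0\<close>.\<close>

definition soft :: "real \<Rightarrow> real \<Rightarrow> real" where
  "soft \<delta> \<tau> = \<tau> * flat_exp \<delta> 0 \<tau>"

lemma soft_test_function:
  assumes q: "poly_below n q" and d: "\<delta> > 0" and \<rho>: "\<rho> > 0"
  shows "(\<lambda>x::'a::euclidean_space. soft \<delta> (\<rho>\<^sup>2 - x \<bullet> x) * q x) \<in> test_functions"
proof -
  have p: "poly_below (Suc (Suc n)) (\<lambda>x. (\<rho>\<^sup>2 - x \<bullet> x) * q x)" by (rule poly_below_boundary_factor[OF q])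
  have "flat_class \<delta> (\<rho>\<^sup>2) (\<lambda>x. soft \<delta> (\<rho>\<^sup>2 - x \<bullet> x) * q x)"
    using flat_class_mult_poly[OF p flat_class.base[of \<delta> "\<rho>\<^sup>2" 0]]
    by (simp add: soft_def mult.assoc mult.left_commute mult.commute)
  moreover have "{x. soft \<delta> (\<rho>\<^sup>2 - x \<bullet> x) * q x \<noteq> 0} \<subseteq> cball 0 \<rho>"
  proof
    fix x assume "x \<in> {x. soft \<delta> (\<rho>\<^sup>2 - x \<bullet> x) * q x \<noteq> 0}"
    then have "(norm x)\<^sup>2 < \<rho>\<^sup>2" by (auto simp: soft_def flat_exp_def power2_norm_eq_inner split: if_splits)
    then have "norm x < \<rho>" using \<rho> by (simp add: power2_less_imp_less)
    then show "x \<in> cball 0 \<rho>" by simp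
  qed
  then have "compact (closure {x. soft \<delta> (\<rho>\<^sup>2 - x \<bullet> x) * q x \<noteq> 0})"
    using bounded_subset[OF bounded_cball] by (simp add: compact_closure)
  ultimately show ?thesis unfolding test_functions_def using flat_class_smooth[OF _ d] by blast
qed

lemma soft_deriv:
  assumes "\<delta> > 0"
  shows "(soft \<delta> has_real_derivative flat_exp \<delta> 0 \<tau> + \<delta> * flat_exp \<delta> 1 \<tau>) (at \<tau>)"
    "((\<lambda>\<tau>. flat_exp \<delta> 0 \<tau> + \<delta> * flat_exp \<delta> 1 \<tau>) has_real_derivative \<delta>\<^sup>2 * flat_exp \<delta> 3 \<tau>) (at \<tau>)"
proof -
  show "(soft \<delta> has_real_derivative flat_exp \<delta> 0 \<tau> + \<delta> * flat_exp \<delta> 1 \<tau>) (at \<tau>)"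
    unfolding soft_def
    by (rule DERIV_cong, rule DERIV_mult[OF DERIV_ident flat_exp_deriv[OF assms]])
      (simp add: mult.commute[of _ \<tau>] mult.left_commute[of \<tau>] flat_exp_mult)
  show "((\<lambda>\<tau>. flat_exp \<delta> 0 \<tau> + \<delta> * flat_exp \<delta> 1 \<tau>) has_real_derivative \<delta>\<^sup>2 * flat_exp \<delta> 3 \<tau>) (at \<tau>)"
    by (rule DERIV_cong, rule DERIV_add[OF flat_exp_deriv[OF assms] DERIV_cmult[OF flat_exp_deriv[OF assms]]])
      (simp add: algebra_simps power2_eq_square numeral_3_eq_3)
qed

text \<open>The bounds are uniform in \<open>\<delta>\<close>: the first derivative lies between 0 and 1, by \<open>1 + y \<le> exp y\<close> with \<open>y = \<delta> / \<tau>\<close>, and away from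
\<open>\<tau> = 0\<close> the second derivative \<open>\<delta>\<^sup>2 exp (- \<delta> / \<tau>) / \<tau>\<^sup>3\<close> is of order \<open>\<delta>\<^sup>2\<close>.\<close>

lemma soft_bounds:
  assumes d: "\<delta> > 0"
  shows "0 \<le> soft \<delta> \<tau>" "\<tau> \<ge> 0 \<Longrightarrow> soft \<delta> \<tau> \<le> \<tau>"
    "0 \<le> flat_exp \<delta> 0 \<tau> + \<delta> * flat_exp \<delta> 1 \<tau>" "flat_exp \<delta> 0 \<tau> + \<delta> * flat_exp \<delta> 1 \<tau> \<le> 1"
    "0 \<le> flat_exp \<delta> n \<tau>" "0 < \<kappa> \<Longrightarrow> \<kappa> \<le> \<tau> \<Longrightarrow> flat_exp \<delta> n \<tau> \<le> 1 / \<kappa> ^ n"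
proof -
  show "0 \<le> soft \<delta> \<tau>" "0 \<le> flat_exp \<delta> 0 \<tau> + \<delta> * flat_exp \<delta> 1 \<tau>" "0 \<le> flat_exp \<delta> n \<tau>"
    using d by (auto simp: soft_def flat_exp_def)
  show "soft \<delta> \<tau> \<le> \<tau>" if "\<tau> \<ge> 0"
    using that d by (auto simp: soft_def flat_exp_def mult_le_cancel_left1)
  show "flat_exp \<delta> 0 \<tau> + \<delta> * flat_exp \<delta> 1 \<tau> \<le> 1"
  proof (cases "\<tau> > 0")
    case True
    have "exp (- \<delta> / \<tau>) * (1 + \<delta> / \<tau>) \<le> exp (- \<delta> / \<tau>) * exp (\<delta> / \<tau>)"
      by (intro mult_left_mono exp_ge_add_one_self) auto
    also have "\<dots> = 1" by (simp flip: exp_add)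
    finally show ?thesis using True by (simp add: flat_exp_def algebra_simps)
  qed (simp add: flat_exp_def)
  show "flat_exp \<delta> n \<tau> \<le> 1 / \<kappa> ^ n" if "0 < \<kappa>" "\<kappa> \<le> \<tau>"
    using that d unfolding flat_exp_def by (auto intro!: frac_le power_mono)
qed

lemma soft_limits:
  assumes t: "\<tau> > 0" and e: "\<epsilon> \<longlonglongrightarrow> 0"
  shows "(\<lambda>n. soft (\<epsilon> n) \<tau>) \<longlonglongrightarrow> \<tau>"
    "(\<lambda>n. flat_exp (\<epsilon> n) 0 \<tau> + \<epsilon> n * flat_exp (\<epsilon> n) 1 \<tau>) \<longlonglongrightarrow> 1"
proof -
  have "(\<lambda>n. exp (- \<epsilon> n / \<tau>)) \<longlonglongrightarrow> exp (- 0 / \<tau>)" using t by (intro tendsto_intros e) auto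
  then have l: "(\<lambda>n. exp (- \<epsilon> n / \<tau>)) \<longlonglongrightarrow> 1" by simp
  show "(\<lambda>n. soft (\<epsilon> n) \<tau>) \<longlonglongrightarrow> \<tau>"
    using tendsto_mult_left[OF l, of \<tau>] t by (simp add: soft_def flat_exp_def)
  have "(\<lambda>n. exp (- \<epsilon> n / \<tau>) + \<epsilon> n * (exp (- \<epsilon> n / \<tau>) / \<tau>)) \<longlonglongrightarrow> 1 + 0 * (1 / \<tau>)"
    using t by (intro tendsto_intros l e) auto
  then show "(\<lambda>n. flat_exp (\<epsilon> n) 0 \<tau> + \<epsilon> n * flat_exp (\<epsilon> n) 1 \<tau>) \<longlonglongrightarrow> 1"
    using t by (simp add: flat_exp_def)
qed

lemma has_grad_hess_radial:
  fixes V :: "real \<Rightarrow> real"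
  assumes V: "\<And>s. (V has_real_derivative dV s) (at s)" and dV: "\<And>s. (dV has_real_derivative ddV s) (at s)"
    and c: "continuous_on UNIV ddV"
  shows "has_grad_hess (\<lambda>x::'a::euclidean_space. V (x \<bullet> x)) (\<lambda>x. (2 * dV (x \<bullet> x)) *\<^sub>R x)
    (\<lambda>x h. (2 * dV (x \<bullet> x)) *\<^sub>R h + (4 * ddV (x \<bullet> x) * (x \<bullet> h)) *\<^sub>R x)"
  unfolding has_grad_hess_def
proof (intro conjI allI)
  fix x b :: 'a
  have i: "((\<lambda>x. x \<bullet> x) has_derivative (\<lambda>h. 2 * (x \<bullet> h))) (at x)"
    by (auto intro!: derivative_eq_intros simp: inner_commute)
  show "((\<lambda>x. V (x \<bullet> x)) has_derivative (\<lambda>h. (2 * dV (x \<bullet> x)) *\<^sub>R x \<bullet> h)) (at x)"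
    by (rule has_derivative_eq_rhs[OF has_derivative_compose[OF i V[of "x \<bullet> x", unfolded has_field_derivative_def]]])
      (simp add: fun_eq_iff)
  have j: "((\<lambda>x. dV (x \<bullet> x)) has_derivative (\<lambda>h. 2 * ddV (x \<bullet> x) * (x \<bullet> h))) (at x)"
    by (rule has_derivative_eq_rhs[OF has_derivative_compose[OF i dV[of "x \<bullet> x", unfolded has_field_derivative_def]]])
      (simp add: fun_eq_iff)
  show "((\<lambda>x. (2 * dV (x \<bullet> x)) *\<^sub>R x) has_derivative
      (\<lambda>h. (2 * dV (x \<bullet> x)) *\<^sub>R h + (4 * ddV (x \<bullet> x) * (x \<bullet> h)) *\<^sub>R x)) (at x)"
    by (rule has_derivative_eq_rhs[OF has_derivative_scaleR[OF has_derivative_mult_right[OF j] has_derivative_ident]])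
      (auto simp: fun_eq_iff)
  have "continuous_on UNIV dV" by (intro continuous_at_imp_continuous_on ballI DERIV_isCont[OF dV])
  then have "continuous_on UNIV (\<lambda>x::'a. dV (x \<bullet> x))" "continuous_on UNIV (\<lambda>x::'a. ddV (x \<bullet> x))"
    using c by (auto intro!: continuous_on_compose2[of UNIV _ UNIV "\<lambda>x::'a. x \<bullet> x"] continuous_intros)
  then show "continuous_on UNIV (\<lambda>x. (2 * dV (x \<bullet> x)) *\<^sub>R b + (4 * ddV (x \<bullet> x) * (x \<bullet> b)) *\<^sub>R x)"
    by (intro continuous_intros)
qed

context dunkl_setting
begin

text \<open>A radial factor is invariant under all reflections, so the Leibniz rule has no twisted terms.\<close>

lemma dunkl_laplacian_radial_mult:
  fixes V :: "real \<Rightarrow> real"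
  assumes V: "\<And>s. (V has_real_derivative dV s) (at s)" and dV: "\<And>s. (dV has_real_derivative ddV s) (at s)"
    and c: "continuous_on UNIV ddV" and q: "has_grad_hess q g H"
  shows "dunkl_laplacian R k (\<lambda>x. V (x \<bullet> x) * q x) x =
    V (x \<bullet> x) * dunkl_laplacian R k q x + q x * (2 * m * dV (x \<bullet> x) + 4 * ddV (x \<bullet> x) * (x \<bullet> x))
     + 4 * dV (x \<bullet> x) * (x \<bullet> g x)"
proof -
  define E A D where "E = V (x \<bullet> x)" and "A = dV (x \<bullet> x)" and "D = ddV (x \<bullet> x)"
  note r = has_grad_hess_radial[OF V dV c]
  note gh = has_grad_hess_mult[OF r q]
  have t: "dunkl_term_C2 \<alpha> (\<lambda>x. V (x \<bullet> x) * q x) (\<lambda>x. V (x \<bullet> x) *\<^sub>R g x + q x *\<^sub>R (2 * dV (x \<bullet> x)) *\<^sub>R x)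
     (\<lambda>x h. V (x \<bullet> x) *\<^sub>R H x h + ((2 * dV (x \<bullet> x)) *\<^sub>R x \<bullet> h) *\<^sub>R g x
        + q x *\<^sub>R ((2 * dV (x \<bullet> x)) *\<^sub>R h + (4 * ddV (x \<bullet> x) * (x \<bullet> h)) *\<^sub>R x)
        + (g x \<bullet> h) *\<^sub>R (2 * dV (x \<bullet> x)) *\<^sub>R x) x
     = E * dunkl_term_C2 \<alpha> q g H x + 2 * A * q x" if a: "\<alpha> \<in> R" for \<alpha>
  proof (cases "\<alpha> \<bullet> x = 0")
    case True
    then have "x \<bullet> \<alpha> = 0" by (simp add: inner_commute)
    moreover have "norm \<alpha> \<noteq> 0" using R_nonzero[OF a] by simp
    ultimately show ?thesis unfolding dunkl_term_C2_def E_def A_def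
      using True by (simp add: inner_add_left add_divide_distrib flip: power2_norm_eq_inner)
  next
    case False
    have n: "refl_hyp \<alpha> x \<bullet> refl_hyp \<alpha> x = x \<bullet> x"
      unfolding power2_norm_eq_inner[symmetric] by simp
    show ?thesis using False unfolding dunkl_term_C2_def n E_def A_def
      by (simp add: inner_add_left inner_commute[of x \<alpha>] add_divide_distrib right_diff_distrib diff_divide_distrib mult_ac)
  qed
  have xs: "(\<Sum>b\<in>Basis. (x \<bullet> b) * (y \<bullet> b)) = x \<bullet> y" for y by (rule euclidean_inner[symmetric])
  have lap: "(\<Sum>b\<in>Basis. (E *\<^sub>R H x b + ((2 * A) *\<^sub>R x \<bullet> b) *\<^sub>R g x
        + q x *\<^sub>R ((2 * A) *\<^sub>R b + (4 * D * (x \<bullet> b)) *\<^sub>R x)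
        + (g x \<bullet> b) *\<^sub>R (2 * A) *\<^sub>R x) \<bullet> b)
     = E * (\<Sum>b\<in>Basis. H x b \<bullet> b) + 4 * A * (x \<bullet> g x) + q x * (2 * A * real DIM('a) + 4 * D * (x \<bullet> x))"
  proof -
    have "(\<Sum>b\<in>Basis. (E *\<^sub>R H x b + ((2 * A) *\<^sub>R x \<bullet> b) *\<^sub>R g x
        + q x *\<^sub>R ((2 * A) *\<^sub>R b + (4 * D * (x \<bullet> b)) *\<^sub>R x)
        + (g x \<bullet> b) *\<^sub>R (2 * A) *\<^sub>R x) \<bullet> b)
      = (\<Sum>b\<in>Basis. E * (H x b \<bullet> b) + 4 * A * ((x \<bullet> b) * (g x \<bullet> b)) + q x * (2 * A) + q x * (4 * D) * ((x \<bullet> b) * (x \<bullet> b)))"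
      by (intro sum.cong refl) (simp add: inner_add_left algebra_simps)
    also have "\<dots> = E * (\<Sum>b\<in>Basis. H x b \<bullet> b) + 4 * A * (x \<bullet> g x) + q x * (2 * A) * real DIM('a) + q x * (4 * D) * (x \<bullet> x)"
      unfolding sum.distrib sum_distrib_left[symmetric] xs by simp
    finally show ?thesis by (simp add: algebra_simps)
  qed
  have "(\<Sum>\<alpha>\<in>R. k \<alpha> * (E * dunkl_term_C2 \<alpha> q g H x + 2 * A * q x))
     = E * (\<Sum>\<alpha>\<in>R. k \<alpha> * dunkl_term_C2 \<alpha> q g H x) + (\<Sum>\<alpha>\<in>R. k \<alpha>) * (2 * A * q x)"
    by (simp add: distrib_left sum.distrib sum_distrib_left sum_distrib_right mult.left_commute)
  then show ?thesis
    unfolding dunkl_laplacian_eq[OF gh] dunkl_laplacian_eq[OF q] m_eq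
    using lap t by (simp add: E_def A_def D_def algebra_simps)
qed

lemma dunkl_laplacian_soft:
  assumes d: "\<delta> > 0" and q: "has_grad_hess q g H"
  shows "dunkl_laplacian R k (\<lambda>x. soft \<delta> (c - x \<bullet> x) * q x) x =
    soft \<delta> (c - x \<bullet> x) * dunkl_laplacian R k q x
    - (flat_exp \<delta> 0 (c - x \<bullet> x) + \<delta> * flat_exp \<delta> 1 (c - x \<bullet> x)) * (2 * m * q x + 4 * (x \<bullet> g x))
    + 4 * (x \<bullet> x) * (\<delta>\<^sup>2 * flat_exp \<delta> 3 (c - x \<bullet> x)) * q x" (is ?A)
    "\<exists>g H. has_grad_hess (\<lambda>x. soft \<delta> (c - x \<bullet> x) * q x) g H" (is ?B)
proof -
  let ?V = "\<lambda>s. soft \<delta> (c - s)" and ?dV = "\<lambda>s. - (flat_exp \<delta> 0 (c - s) + \<delta> * flat_exp \<delta> 1 (c - s))"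
  let ?ddV = "\<lambda>s. \<delta>\<^sup>2 * flat_exp \<delta> 3 (c - s)"
  have i: "((\<lambda>s. c - s) has_real_derivative -1) (at s)" for s
    by (auto intro!: derivative_eq_intros)
  have V: "(?V has_real_derivative ?dV s) (at s)" for s
    using DERIV_chain2[OF soft_deriv(1)[OF d] i] by simp
  have dV: "(?dV has_real_derivative ?ddV s) (at s)" for s
    using DERIV_minus[OF DERIV_chain2[OF soft_deriv(2)[OF d] i]] by simp
  have fc: "continuous_on UNIV (flat_exp \<delta> 3)"
    by (intro continuous_at_imp_continuous_on ballI DERIV_isCont[OF flat_exp_deriv[OF d]])
  have c: "continuous_on UNIV ?ddV"
    by (intro continuous_intros continuous_on_compose2[OF fc]) auto
  show ?A unfolding dunkl_laplacian_radial_mult[OF V dV c q] by (simp add: algebra_simps)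
  show ?B using has_grad_hess_mult[OF has_grad_hess_radial[OF V dV c] q] by blast
qed

lemma dunkl_laplacian_boundary_factor:
  assumes q: "has_grad_hess q g H"
  shows "dunkl_laplacian R k (\<lambda>x. (c - x \<bullet> x) * q x) x =
    (c - x \<bullet> x) * dunkl_laplacian R k q x - (2 * m * q x + 4 * (x \<bullet> g x))"
proof -
  have V: "((\<lambda>s. c - s) has_real_derivative -1) (at s)" for s
    by (auto intro!: derivative_eq_intros)
  have dV: "((\<lambda>s::real. -1) has_real_derivative (0::real)) (at s)" for s by simp
  show ?thesis by (subst dunkl_laplacian_radial_mult[OF V dV _ q]) auto
qed

end

section \<open>Polynomial approximation of distributional solutions\<close>

lemma continuous_AE_zero:
  fixes f :: "'a::euclidean_space \<Rightarrow> real"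
  assumes c: "continuous_on UNIV f" and z: "AE x in lborel. f x = 0"
  shows "f x = 0"
proof -
  have op: "open {x. f x \<noteq> 0}" by (intro open_Collect_neq c continuous_on_const)
  have "AE x in lborel. x \<notin> {x. f x \<noteq> 0}" using z by simp
  then have "{x. f x \<noteq> 0} \<in> null_sets lborel" using op by (subst AE_iff_null_sets) auto
  then have "negligible {x. f x \<noteq> 0}" by (simp add: negligible_iff_null_sets null_sets_completionI)
  then have "{x. f x \<noteq> 0} = {}" using open_not_negligible[OF op] by blast
  then show ?thesis by blast
qed

lemma integral_mult_bound:
  fixes f h :: "'a \<Rightarrow> real"
  assumes h: "integrable M h" and fh: "integrable M (\<lambda>x. f x * h x)"
    and b: "\<And>x. h x \<noteq> 0 \<Longrightarrow> \<bar>f x\<bar> \<le> c"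
  shows "\<bar>LINT x|M. f x * h x\<bar> \<le> c * (LINT x|M. \<bar>h x\<bar>)"
proof -
  have "\<bar>LINT x|M. f x * h x\<bar> \<le> (LINT x|M. \<bar>f x * h x\<bar>)" by (rule integral_abs_bound)
  also have "\<dots> \<le> (LINT x|M. c * \<bar>h x\<bar>)"
  proof (rule integral_mono)
    show "\<bar>f x * h x\<bar> \<le> c * \<bar>h x\<bar>" for x
      using b[of x] by (cases "h x = 0") (auto simp: abs_mult intro: mult_right_mono)
  qed (use h fh in auto)
  finally show ?thesis by simp
qed

text \<open>Uniform continuity, applied to a point and its radial projection to the sphere.\<close>

lemma small_near_sphere:
  fixes z :: "'a::euclidean_space \<Rightarrow> real"
  assumes c: "continuous_on UNIV z" and z0: "\<And>x. norm x \<ge> \<rho> \<Longrightarrow> z x = 0" and \<rho>: "\<rho> > 0" and e: "e > 0"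
  obtains \<kappa> where "\<kappa> > 0" "\<And>x. norm x \<le> \<rho> \<Longrightarrow> \<rho>\<^sup>2 - x \<bullet> x < \<kappa> \<Longrightarrow> \<bar>z x\<bar> \<le> e"
proof -
  have "uniformly_continuous_on (cball 0 \<rho>) z"
    by (intro compact_uniformly_continuous compact_cball continuous_on_subset[OF c]) auto
  then obtain d where d: "d > 0"
    "\<And>x y. x \<in> cball 0 \<rho> \<Longrightarrow> y \<in> cball 0 \<rho> \<Longrightarrow> dist y x < d \<Longrightarrow> dist (z y) (z x) < e"
    using e unfolding uniformly_continuous_on_def by metis
  define d' where "d' = min d \<rho>"
  have d': "d' > 0" "d' \<le> d" "d' \<le> \<rho>" using d \<rho> by (auto simp: d'_def)
  show ?thesis
  proof (rule that[of "\<rho> * d'"])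
    show "\<rho> * d' > 0" using \<rho> d' by simp
    fix x :: 'a assume x: "norm x \<le> \<rho>" "\<rho>\<^sup>2 - x \<bullet> x < \<rho> * d'"
    have "\<rho> * (\<rho> - norm x) \<le> (\<rho> + norm x) * (\<rho> - norm x)" using x by (intro mult_right_mono) auto
    also have "\<dots> = \<rho>\<^sup>2 - x \<bullet> x"
      by (simp add: power2_norm_eq_inner[symmetric] power2_eq_square algebra_simps)
    finally have "\<rho> - norm x < d'" using x(2) \<rho> by (metis mult_less_cancel_left_pos le_less_trans)
    then have nx: "norm x > 0" "\<rho> - norm x < d" using d' by linarith+
    define y where "y = (\<rho> / norm x) *\<^sub>R x"
    have y: "norm y = \<rho>" using nx \<rho> by (simp add: y_def)
    have "x - y = (1 - \<rho> / norm x) *\<^sub>R x" by (simp add: y_def algebra_simps)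
    then have "norm (x - y) = \<bar>1 - \<rho> / norm x\<bar> * norm x" by simp
    also have "\<dots> = \<bar>(1 - \<rho> / norm x) * norm x\<bar>" by (simp add: abs_mult)
    also have "(1 - \<rho> / norm x) * norm x = norm x - \<rho>" using nx by (simp add: left_diff_distrib)
    finally have "dist x y < d" using nx x by (simp add: dist_norm)
    from d(2)[OF _ _ this] x y z0[of y] show "\<bar>z x\<bar> \<le> e" by (simp add: dist_real_def)
  qed
qed

context dunkl_setting
begin

lemma weight_pos_AE: "AE x in lborel. w x > 0"
proof -
  have "AE x in lborel. \<alpha> \<bullet> x \<noteq> 0" if "\<alpha> \<in> R" for \<alpha>
  proof -
    have cl: "closed {x. \<alpha> \<bullet> x = 0}" by (rule closed_hyperplane)
    have "negligible {x. \<alpha> \<bullet> x = 0}" by (rule negligible_hyperplane) (use R_nonzero[OF that] in simp)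
    then have "{x. \<alpha> \<bullet> x = 0} \<in> null_sets lborel"
      using cl by (simp add: negligible_iff_null_sets null_sets_completion_iff borel_closed)
    then show ?thesis by (rule AE_not_in[THEN AE_mp]) simp
  qed
  then have "AE x in lborel. \<forall>\<alpha>\<in>R. \<alpha> \<bullet> x \<noteq> 0" by (intro AE_finite_allI) auto
  then show ?thesis
    by (rule AE_mp) (auto simp: dunkl_weight_def inner_commute intro!: prod_pos)
qed

text \<open>The second derivatives of the cut-off blow up near the sphere as \<open>\<delta>\<close> tends to 0, but their weighted integral stays
bounded: the Dunkl Laplacian of the cut-off integrates to zero, so the second-order part equals the first-order
part, which is bounded.\<close>

lemma soft_mass_bound:
  assumes d: "\<delta> > 0" and \<rho>: "\<rho> > 0"
  shows "integrable lborel (\<lambda>x. 4 * (x \<bullet> x) * (\<delta>\<^sup>2 * flat_exp \<delta> 3 (\<rho>\<^sup>2 - x \<bullet> x)) * w x)"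
    "(LINT x|lborel. 4 * (x \<bullet> x) * (\<delta>\<^sup>2 * flat_exp \<delta> 3 (\<rho>\<^sup>2 - x \<bullet> x)) * w x)
      \<le> 2 * m * (LINT x|lborel. indicator (cball 0 \<rho>) x * w x)"
proof -
  let ?S = "\<lambda>x. \<delta>\<^sup>2 * flat_exp \<delta> 3 (\<rho>\<^sup>2 - x \<bullet> x)"
  let ?T = "\<lambda>x. flat_exp \<delta> 0 (\<rho>\<^sup>2 - x \<bullet> x) + \<delta> * flat_exp \<delta> 1 (\<rho>\<^sup>2 - x \<bullet> x)"
  have fc: "continuous_on UNIV (flat_exp \<delta> n)" for n
    by (intro continuous_at_imp_continuous_on ballI DERIV_isCont[OF flat_exp_deriv[OF d]])
  have cf: "continuous_on UNIV (\<lambda>x::'a. flat_exp \<delta> n (\<rho>\<^sup>2 - x \<bullet> x))" for n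
    by (rule continuous_on_compose2[OF fc]) (auto intro!: continuous_intros)
  have out: "flat_exp \<delta> n (\<rho>\<^sup>2 - x \<bullet> x) = 0" if "norm x > \<rho>" for n and x :: 'a
  proof -
    have "\<rho>\<^sup>2 < x \<bullet> x" unfolding power2_norm_eq_inner[symmetric]
      using that \<rho> by (intro power_strict_mono) auto
    then show ?thesis by (simp add: flat_exp_def)
  qed
  show i1: "integrable lborel (\<lambda>x. 4 * (x \<bullet> x) * ?S x * w x)"
    by (rule integrable_compact_support[of _ \<rho>])
      (auto simp: out intro!: continuous_on_mult cf continuous_weight continuous_intros)
  have i2: "integrable lborel (\<lambda>x. ?T x * w x)"
    by (rule integrable_compact_support[of _ \<rho>])
      (auto simp: out intro!: continuous_on_mult continuous_on_add cf continuous_weight continuous_intros)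
  have i3: "integrable lborel (\<lambda>x. indicator (cball 0 \<rho>) x * w x)"
    using borel_integrable_compact[OF compact_cball continuous_on_subset[OF continuous_weight], of 0 \<rho>] by simp
  have one: "has_grad_hess (\<lambda>x::'a. 1) (\<lambda>x. 0) (\<lambda>x h. 0)" by (rule has_grad_hess_const)
  obtain g H where gh: "has_grad_hess (\<lambda>x::'a. soft \<delta> (\<rho>\<^sup>2 - x \<bullet> x) * 1) g H"
    using dunkl_laplacian_soft(2)[OF d one, of "\<rho>\<^sup>2"] by blast
  have "(LINT x|lborel. 1 * dunkl_laplacian R k (\<lambda>x. soft \<delta> (\<rho>\<^sup>2 - x \<bullet> x) * 1) x * w x)
     = (LINT x|lborel. dunkl_laplacian R k (\<lambda>x. 1) x * (soft \<delta> (\<rho>\<^sup>2 - x \<bullet> x) * 1) * w x)"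
    by (rule dunkl_green[OF one gh, of \<rho>]) (simp add: soft_def out)
  then have "(LINT x|lborel. 4 * (x \<bullet> x) * ?S x * w x - 2 * m * (?T x * w x)) = 0"
    unfolding dunkl_laplacian_soft(1)[OF d one] dunkl_laplacian_const by (simp add: algebra_simps)
  then have "(LINT x|lborel. 4 * (x \<bullet> x) * ?S x * w x) = 2 * m * (LINT x|lborel. ?T x * w x)"
    using i1 i2 by simp
  also have "\<dots> \<le> 2 * m * (LINT x|lborel. indicator (cball 0 \<rho>) x * w x)"
  proof (intro mult_left_mono integral_mono i2 i3)
    fix x :: 'a
    show "?T x * w x \<le> indicator (cball 0 \<rho>) x * w x"
      using mult_right_mono[OF soft_bounds(4)[OF d, of "\<rho>\<^sup>2 - x \<bullet> x"] weight_nonneg[of x]] out[of x]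
      by (cases "norm x \<le> \<rho>") auto
  qed (use m_pos in auto)
  finally show "(LINT x|lborel. 4 * (x \<bullet> x) * ?S x * w x)
      \<le> 2 * m * (LINT x|lborel. indicator (cball 0 \<rho>) x * w x)" .
qed

text \<open>In the Dunkl Laplacian of \<open>soft \<delta> \<tau> \<cdot> q\<close> the terms with \<open>soft\<close> and its first derivative converge boundedly to those of
\<open>\<tau> \<cdot> q\<close>.  The term with the second derivative concentrates at the sphere with bounded mass, where \<open>z\<close> vanishes, so
it contributes nothing in the limit.\<close>

lemma orthogonal_boundary_factor:
  assumes \<rho>: "\<rho> > 0" and zc: "continuous_on UNIV z" and z0: "\<And>x. norm x \<ge> \<rho> \<Longrightarrow> z x = 0"
    and q: "poly_below n q"
    and tst: "\<And>\<delta>. \<delta> > 0 \<Longrightarrow>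
      (LINT x|lborel. z x * dunkl_laplacian R k (\<lambda>x. soft \<delta> (\<rho>\<^sup>2 - x \<bullet> x) * q x) x * w x) = 0"
  shows "(LINT x|lborel. z x * dunkl_laplacian R k (\<lambda>x. (\<rho>\<^sup>2 - x \<bullet> x) * q x) x * w x) = 0"
proof -
  obtain g H where gh: "has_grad_hess q g H" using poly_below_grad_hess[OF q] by blast
  define Lq where "Lq = dunkl_laplacian R k q"
  define Mq where "Mq = (\<lambda>x. 2 * m * q x + 4 * (x \<bullet> g x))"
  define \<epsilon> where "\<epsilon> = (\<lambda>n. inverse (real (Suc n)))"
  have eps: "\<epsilon> n > 0" for n by (simp add: \<epsilon>_def)
  have eps0: "\<epsilon> \<longlonglongrightarrow> 0" unfolding \<epsilon>_def by (rule LIMSEQ_inverse_real_of_nat)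
  let ?\<tau> = "\<lambda>x::'a. \<rho>\<^sup>2 - x \<bullet> x"
  let ?T = "\<lambda>n x. flat_exp (\<epsilon> n) 0 (?\<tau> x) + \<epsilon> n * flat_exp (\<epsilon> n) 1 (?\<tau> x)"
  let ?S = "\<lambda>n x. (\<epsilon> n)\<^sup>2 * flat_exp (\<epsilon> n) 3 (?\<tau> x)"
  define A where "A = (\<lambda>n x. z x * (soft (\<epsilon> n) (?\<tau> x) * Lq x - ?T n x * Mq x) * w x)"
  define B where "B = (\<lambda>n x. (z x * q x) * (4 * (x \<bullet> x) * ?S n x * w x))"
  define C where "C = (\<lambda>x. z x * (?\<tau> x * Lq x - Mq x) * w x)"
  have fc: "continuous_on UNIV (flat_exp (\<epsilon> n) j)" for n j
    by (intro continuous_at_imp_continuous_on ballI DERIV_isCont[OF flat_exp_deriv[OF eps]])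
  have cf: "continuous_on UNIV (\<lambda>x::'a. flat_exp (\<epsilon> n) j (?\<tau> x))" for n j
    by (rule continuous_on_compose2[OF fc]) (auto intro!: continuous_intros)
  have cs: "continuous_on UNIV (\<lambda>x::'a. soft (\<epsilon> n) (?\<tau> x))" for n
    unfolding soft_def by (intro continuous_intros cf)
  have cL: "continuous_on UNIV Lq" unfolding Lq_def by (rule continuous_dunkl_laplacian[OF gh])
  have cM: "continuous_on UNIV Mq" unfolding Mq_def
    by (intro continuous_intros has_grad_hess_continuous[OF gh])
  have cA: "continuous_on UNIV (A n)" for n unfolding A_def
    by (intro continuous_intros zc cs cL cM cf continuous_weight)
  have cB: "continuous_on UNIV (B n)" for n unfolding B_def
    by (intro continuous_intros zc has_grad_hess_continuous[OF gh] cf continuous_weight)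
  have cC: "continuous_on UNIV C" unfolding C_def
    by (intro continuous_intros zc cL cM continuous_weight)
  have iA: "integrable lborel (A n)" for n
    by (rule integrable_compact_support[OF cA, of \<rho>]) (simp add: A_def z0)
  have iB: "integrable lborel (B n)" for n
    by (rule integrable_compact_support[OF cB, of \<rho>]) (simp add: B_def z0)
  have AB: "integral\<^sup>L lborel (A n) + integral\<^sup>L lborel (B n) = 0" for n
  proof -
    have "z x * dunkl_laplacian R k (\<lambda>x. soft (\<epsilon> n) (?\<tau> x) * q x) x * w x = A n x + B n x" for x
      unfolding dunkl_laplacian_soft(1)[OF eps gh] A_def B_def Lq_def Mq_def
      by (simp add: algebra_simps)
    then show ?thesis using tst[OF eps[of n]] iA iB by simp
  qed
  have limA: "(\<lambda>n. integral\<^sup>L lborel (A n)) \<longlonglongrightarrow> integral\<^sup>L lborel C"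
  proof (rule integral_dominated_convergence[where w = "\<lambda>x. \<bar>z x\<bar> * (\<rho>\<^sup>2 * \<bar>Lq x\<bar> + \<bar>Mq x\<bar>) * w x"])
    show "C \<in> borel_measurable lborel" using cC by (auto intro: borel_measurable_continuous_onI)
    show "A n \<in> borel_measurable lborel" for n using cA by (auto intro: borel_measurable_continuous_onI)
    show "integrable lborel (\<lambda>x. \<bar>z x\<bar> * (\<rho>\<^sup>2 * \<bar>Lq x\<bar> + \<bar>Mq x\<bar>) * w x)"
      by (rule integrable_compact_support[of _ \<rho>])
        (auto simp: z0 intro!: continuous_intros zc cL cM continuous_weight)
    show "AE x in lborel. norm (A n x) \<le> \<bar>z x\<bar> * (\<rho>\<^sup>2 * \<bar>Lq x\<bar> + \<bar>Mq x\<bar>) * w x" for n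
    proof (rule AE_I2)
      fix x :: 'a
      show "norm (A n x) \<le> \<bar>z x\<bar> * (\<rho>\<^sup>2 * \<bar>Lq x\<bar> + \<bar>Mq x\<bar>) * w x"
      proof (cases "norm x < \<rho>")
        case False then show ?thesis using z0 by (simp add: A_def)
      next
        case True
        have "(norm x)\<^sup>2 \<le> \<rho>\<^sup>2" using True by (intro power_mono) auto
        then have t: "0 \<le> ?\<tau> x" "?\<tau> x \<le> \<rho>\<^sup>2" by (auto simp: power2_norm_eq_inner)
        have "\<bar>soft (\<epsilon> n) (?\<tau> x)\<bar> \<le> \<rho>\<^sup>2"
          using soft_bounds(1,2)[OF eps[of n], of "?\<tau> x"] t by linarith
        then have "\<bar>soft (\<epsilon> n) (?\<tau> x) * Lq x\<bar> \<le> \<rho>\<^sup>2 * \<bar>Lq x\<bar>" by (simp add: abs_mult mult_right_mono)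
        moreover have "\<bar>?T n x\<bar> \<le> 1" using soft_bounds(3,4)[OF eps[of n], of "?\<tau> x"] by linarith
        then have "\<bar>?T n x * Mq x\<bar> \<le> 1 * \<bar>Mq x\<bar>" unfolding abs_mult by (intro mult_right_mono) auto
        ultimately have "\<bar>soft (\<epsilon> n) (?\<tau> x) * Lq x - ?T n x * Mq x\<bar> \<le> \<rho>\<^sup>2 * \<bar>Lq x\<bar> + \<bar>Mq x\<bar>"
          by linarith
        then show ?thesis unfolding A_def real_norm_def abs_mult abs_of_nonneg[OF weight_nonneg]
          by (intro mult_right_mono mult_left_mono weight_nonneg) auto
      qed
    qed
    show "AE x in lborel. (\<lambda>n. A n x) \<longlonglongrightarrow> C x"
    proof (rule AE_I2)
      fix x :: 'a
      show "(\<lambda>n. A n x) \<longlonglongrightarrow> C x"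
      proof (cases "norm x < \<rho>")
        case False then show ?thesis using z0 by (simp add: A_def C_def)
      next
        case True
        have "(norm x)\<^sup>2 < \<rho>\<^sup>2" using True by (intro power_strict_mono) auto
        then have t: "0 < ?\<tau> x" by (auto simp: power2_norm_eq_inner)
        have "(\<lambda>n. A n x) \<longlonglongrightarrow> z x * (?\<tau> x * Lq x - 1 * Mq x) * w x" unfolding A_def
          by (intro tendsto_intros soft_limits[OF t eps0])
        then show ?thesis by (simp add: C_def)
      qed
    qed
  qed
  have limB: "(\<lambda>n. integral\<^sup>L lborel (B n)) \<longlonglongrightarrow> 0"
  proof -
    obtain Cz where Cz: "Cz > 0" "\<And>x. norm x \<le> \<rho> \<Longrightarrow> \<bar>z x\<bar> \<le> Cz"
      using continuous_bounded_cball[OF zc] by blast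
    obtain Cq where Cq: "Cq > 0" "\<And>x. norm x \<le> \<rho> \<Longrightarrow> \<bar>q x\<bar> \<le> Cq"
      using continuous_bounded_cball[OF has_grad_hess_continuous(1)[OF gh]] by blast
    define I where "I = (LINT x|lborel. indicator (cball 0 \<rho>) x * w x)"
    have iI: "integrable lborel (\<lambda>x. indicator (cball 0 \<rho>) x * w x)"
      using borel_integrable_compact[OF compact_cball continuous_on_subset[OF continuous_weight], of 0 \<rho>] by simp
    have I0: "I \<ge> 0" unfolding I_def by (intro integral_nonneg_AE AE_I2) (simp add: weight_nonneg)
    have bound: "\<bar>integral\<^sup>L lborel (B n)\<bar> \<le> Cq * (e * (2 * m * I) + Cz * (4 * \<rho>\<^sup>2) / \<kappa> ^ 3 * I * (\<epsilon> n)\<^sup>2)"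
      if e: "e > 0" and \<kappa>: "\<kappa> > 0" "\<And>x. norm x \<le> \<rho> \<Longrightarrow> ?\<tau> x < \<kappa> \<Longrightarrow> \<bar>z x\<bar> \<le> e" for e \<kappa> n
    proof -
      let ?h = "\<lambda>x::'a. 4 * (x \<bullet> x) * ?S n x * w x"
      let ?D = "\<lambda>x. e * ?h x + Cz * (4 * \<rho>\<^sup>2) / \<kappa> ^ 3 * (\<epsilon> n)\<^sup>2 * (indicator (cball 0 \<rho>) x * w x)"
      have iD: "integrable lborel ?D" using soft_mass_bound(1)[OF eps \<rho>] iI by simp
      have "\<bar>B n x\<bar> \<le> Cq * ?D x" for x
      proof (cases "norm x \<le> \<rho>")
        case False
        then show ?thesis using z0[of x] e Cq(1) soft_bounds(5)[OF eps] weight_nonneg[of x]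
          by (simp add: B_def)
      next
        case True
        have hp: "0 \<le> ?h x" using soft_bounds(5)[OF eps] weight_nonneg[of x] by simp
        have "\<bar>z x\<bar> * ?h x \<le> ?D x"
        proof (cases "?\<tau> x < \<kappa>")
          case True
          from mult_right_mono[OF \<kappa>(2)[OF \<open>norm x \<le> \<rho>\<close> True] hp]
          have "\<bar>z x\<bar> * ?h x \<le> e * ?h x" .
          moreover have "0 \<le> Cz * (4 * \<rho>\<^sup>2) / \<kappa> ^ 3 * (\<epsilon> n)\<^sup>2 * (indicator (cball 0 \<rho>) x * w x)"
            using Cz(1) \<kappa>(1) weight_nonneg[of x] by simp
          ultimately show ?thesis by linarith
        next
          case False
          have xx: "x \<bullet> x \<le> \<rho>\<^sup>2" unfolding power2_norm_eq_inner[symmetric]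
            using \<open>norm x \<le> \<rho>\<close> by (intro power_mono) auto
          have S1: "?S n x \<le> (\<epsilon> n)\<^sup>2 * (1 / \<kappa> ^ 3)"
            using soft_bounds(6)[OF eps[of n] \<kappa>(1), of "?\<tau> x" 3] False by (intro mult_left_mono) auto
          have "4 * (x \<bullet> x) * ?S n x \<le> (4 * \<rho>\<^sup>2) * ((\<epsilon> n)\<^sup>2 * (1 / \<kappa> ^ 3))"
            by (rule mult_mono[OF _ S1]) (use xx soft_bounds(5)[OF eps[of n]] in simp_all)
          then have hw: "?h x \<le> (4 * \<rho>\<^sup>2) * ((\<epsilon> n)\<^sup>2 * (1 / \<kappa> ^ 3)) * w x"
            by (intro mult_right_mono weight_nonneg)
          have "\<bar>z x\<bar> * ?h x \<le> Cz * ((4 * \<rho>\<^sup>2) * ((\<epsilon> n)\<^sup>2 * (1 / \<kappa> ^ 3)) * w x)"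
            by (rule mult_mono[OF Cz(2)[OF \<open>norm x \<le> \<rho>\<close>] hw _ hp]) (use Cz(1) in simp)
          also have "\<dots> = Cz * (4 * \<rho>\<^sup>2) / \<kappa> ^ 3 * (\<epsilon> n)\<^sup>2 * (indicator (cball 0 \<rho>) x * w x)"
            using \<open>norm x \<le> \<rho>\<close> by simp
          moreover have "0 \<le> e * ?h x" using e hp by simp
          ultimately show ?thesis by linarith
        qed
        moreover have "\<bar>B n x\<bar> = \<bar>q x\<bar> * (\<bar>z x\<bar> * ?h x)"
        proof -
          have "\<bar>B n x\<bar> = \<bar>z x * q x\<bar> * \<bar>?h x\<bar>" unfolding B_def by (rule abs_mult)
          also have "\<bar>?h x\<bar> = ?h x" by (rule abs_of_nonneg[OF hp])
          also have "\<bar>z x * q x\<bar> = \<bar>q x\<bar> * \<bar>z x\<bar>" by (simp add: abs_mult)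
          finally show ?thesis by (simp only: mult.assoc)
        qed
        ultimately show ?thesis using Cq(2)[OF True] hp Cq(1) by (simp only:) (intro mult_mono, auto)
      qed
      then have "\<bar>integral\<^sup>L lborel (B n)\<bar> \<le> (LINT x|lborel. Cq * ?D x)"
        using iB iD by (intro order_trans[OF integral_abs_bound] integral_mono) auto
      also have "\<dots> = Cq * (e * (LINT x|lborel. ?h x) + Cz * (4 * \<rho>\<^sup>2) / \<kappa> ^ 3 * (\<epsilon> n)\<^sup>2 * I)"
        using soft_mass_bound(1)[OF eps \<rho>] iI by (simp add: I_def)
      also have "\<dots> \<le> Cq * (e * (2 * m * I) + Cz * (4 * \<rho>\<^sup>2) / \<kappa> ^ 3 * (\<epsilon> n)\<^sup>2 * I)"
        using soft_mass_bound(2)[OF eps[of n] \<rho>] e Cq(1)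
        by (intro mult_left_mono add_right_mono) (simp_all add: I_def mult.assoc)
      finally show ?thesis by (simp add: mult_ac)
    qed
    show ?thesis
    proof (rule LIMSEQ_I)
      fix r :: real assume r: "r > 0"
      define Dn where "Dn = Cq * (2 * m * I + 1)"
      have den: "Dn > 0" using Cq(1) m_pos I0 by (simp add: Dn_def add_nonneg_pos)
      define e where "e = r / 2 / Dn"
      have e: "e > 0" using r den by (simp add: e_def)
      have "Cq * (e * (2 * m * I)) \<le> e * Dn"
        using e Cq(1) by (simp add: Dn_def algebra_simps)
      also have "\<dots> = r / 2" using den by (simp add: e_def)
      finally have 1: "Cq * (e * (2 * m * I)) \<le> r / 2" .
      obtain \<kappa> where \<kappa>: "\<kappa> > 0" "\<And>x. norm x \<le> \<rho> \<Longrightarrow> ?\<tau> x < \<kappa> \<Longrightarrow> \<bar>z x\<bar> \<le> e"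
        using small_near_sphere[OF zc z0 \<rho> e] by blast
      have "(\<lambda>n. Cq * (Cz * (4 * \<rho>\<^sup>2) / \<kappa> ^ 3 * I * (\<epsilon> n)\<^sup>2)) \<longlonglongrightarrow> Cq * (Cz * (4 * \<rho>\<^sup>2) / \<kappa> ^ 3 * I * 0\<^sup>2)"
        by (intro tendsto_intros eps0) (use \<kappa>(1) in auto)
      then have "\<forall>\<^sub>F n in sequentially. Cq * (Cz * (4 * \<rho>\<^sup>2) / \<kappa> ^ 3 * I * (\<epsilon> n)\<^sup>2) < r / 2"
        using r by (intro order_tendstoD(2)) auto
      then obtain N where N: "\<And>n. n \<ge> N \<Longrightarrow> Cq * (Cz * (4 * \<rho>\<^sup>2) / \<kappa> ^ 3 * I * (\<epsilon> n)\<^sup>2) < r / 2"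
        unfolding eventually_sequentially by blast
      have "norm (integral\<^sup>L lborel (B n) - 0) < r" if "n \<ge> N" for n
        using bound[OF e \<kappa>, of n] 1 N[OF that] unfolding distrib_left by simp
      then show "\<exists>N. \<forall>n\<ge>N. norm (integral\<^sup>L lborel (B n) - 0) < r" by blast
    qed
  qed
  have "(\<lambda>n. integral\<^sup>L lborel (A n) + integral\<^sup>L lborel (B n)) \<longlonglongrightarrow> integral\<^sup>L lborel C + 0"
    by (rule tendsto_add[OF limA limB])
  then have "integral\<^sup>L lborel C = 0" unfolding AB by (simp add: LIMSEQ_const_iff)
  then show ?thesis
    unfolding C_def Lq_def Mq_def dunkl_laplacian_boundary_factor[OF gh] .
qed

text \<open>Approximating \<open>z\<close> itself by polynomials gives \<open>\<integral> z\<^sup>2 w = 0\<close>, and the weight is positive almost everywhere.\<close>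

lemma zero_if_orthogonal_to_polynomials:
  assumes zc: "continuous_on UNIV z" and z0: "\<And>x. norm x \<ge> \<rho> \<Longrightarrow> z x = 0"
    and o: "\<And>n f. poly_below n f \<Longrightarrow> (LINT x|lborel. z x * f x * w x) = 0"
  shows "z x = 0"
proof -
  have iz: "integrable lborel (\<lambda>x. z x * w x)"
    by (rule integrable_compact_support[of _ \<rho>]) (auto simp: z0 intro!: continuous_intros zc continuous_weight)
  have izz: "integrable lborel (\<lambda>x. z x * (z x * w x))"
    by (rule integrable_compact_support[of _ \<rho>]) (auto simp: z0 intro!: continuous_intros zc continuous_weight)
  define I where "I = (LINT x|lborel. \<bar>z x * w x\<bar>)"
  have I0: "I \<ge> 0" unfolding I_def by (intro integral_nonneg_AE AE_I2) simp
  have "\<bar>LINT x|lborel. z x * (z x * w x)\<bar> \<le> 0 + e" if e: "e > 0" for e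
  proof -
    have e': "e / (I + 1) > 0" using e I0 by simp
    have c: "continuous_on (cball 0 \<rho>) z" using zc continuous_on_subset by blast
    obtain n f where f: "poly_below n f" "\<And>x. x \<in> cball 0 \<rho> \<Longrightarrow> \<bar>z x - f x\<bar> < e / (I + 1)"
      using polynomial_approximation[OF compact_cball c e'] by blast
    obtain g H where "has_grad_hess f g H" using poly_below_grad_hess[OF f(1)] .
    then have cf: "continuous_on UNIV f" by (rule has_grad_hess_continuous)
    have if': "integrable lborel (\<lambda>x. f x * (z x * w x))"
      by (rule integrable_compact_support[of _ \<rho>]) (auto simp: z0 intro!: continuous_intros zc cf continuous_weight)
    have f0: "(LINT x|lborel. f x * (z x * w x)) = 0"
      using o[OF f(1)] by (simp add: mult_ac)
    have id: "integrable lborel (\<lambda>x. (z x - f x) * (z x * w x))"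
      unfolding left_diff_distrib using izz if' by simp
    have "(LINT x|lborel. (z x - f x) * (z x * w x)) = (LINT x|lborel. z x * (z x * w x))"
      unfolding left_diff_distrib using izz if' f0 by simp
    moreover have "\<bar>LINT x|lborel. (z x - f x) * (z x * w x)\<bar> \<le> e / (I + 1) * (LINT x|lborel. \<bar>z x * w x\<bar>)"
    proof (rule integral_mult_bound[OF iz id])
      fix x assume "z x * w x \<noteq> 0"
      then have "norm x \<le> \<rho>" using z0[of x] by (cases "norm x \<le> \<rho>") auto
      then show "\<bar>z x - f x\<bar> \<le> e / (I + 1)" using f(2)[of x] by simp
    qed
    moreover have "e / (I + 1) * I \<le> e" using e I0 by (simp add: divide_le_eq mult_left_mono)
    ultimately show ?thesis by (simp add: I_def)
  qed
  then have "\<bar>LINT x|lborel. z x * (z x * w x)\<bar> \<le> 0" by (rule field_le_epsilon)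
  then have "(LINT x|lborel. z x * (z x * w x)) = 0" by simp
  moreover have nn: "0 \<le> z x * (z x * w x)" for x
    using weight_nonneg[of x] by (simp add: mult.assoc[symmetric])
  ultimately have "AE x in lborel. z x * (z x * w x) = 0"
    using integral_nonneg_eq_0_iff_AE[OF izz] by simp
  then have "AE x in lborel. z x = 0"
    using weight_pos_AE by eventually_elim auto
  then show ?thesis by (rule continuous_AE_zero[OF zc])
qed

text \<open>Substitute for mollification: a continuous distributional solution of \<open>\<Delta>\<^sub>k v = F\<close> is, on every ball, a uniform limit of
polynomials whose Dunkl Laplacians converge uniformly to \<open>F\<close>.\<close>

lemma distributional_approximation:
  assumes vc: "continuous_on UNIV v" and Fc: "continuous_on UNIV F"
    and weak: "\<And>\<psi>. \<psi> \<in> test_functions \<Longrightarrow>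
      (LINT x|lborel. v x * dunkl_laplacian R k \<psi> x * w x) = (LINT x|lborel. F x * \<psi> x * w x)"
    and \<rho>: "\<rho> > 0" and e: "e > 0"
  obtains p g H where "has_grad_hess p g H" "\<And>x. norm x \<le> \<rho> \<Longrightarrow> \<bar>v x - p x\<bar> \<le> e"
    "\<And>x. norm x \<le> \<rho> \<Longrightarrow> \<bar>dunkl_laplacian R k p x - F x\<bar> \<le> e"
proof -
  define \<epsilon> where "\<epsilon> = (\<lambda>n. inverse (real (Suc n)))"
  have eps: "\<epsilon> n > 0" for n by (simp add: \<epsilon>_def)
  have eps0: "\<epsilon> \<longlonglongrightarrow> 0" unfolding \<epsilon>_def by (rule LIMSEQ_inverse_real_of_nat)
  have ex: "\<exists>p. (\<exists>g H. has_grad_hess p g H) \<and> (\<forall>x. norm x = \<rho> \<longrightarrow> \<bar>v x - p x\<bar> \<le> \<epsilon> j) \<and>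
     (\<forall>x. norm x \<le> \<rho> \<longrightarrow> \<bar>dunkl_laplacian R k p x - F x\<bar> \<le> \<epsilon> j)" for j
  proof -
    have vc': "continuous_on (cball 0 \<rho>) v" and Fc': "continuous_on (cball 0 \<rho>) F"
      using vc Fc continuous_on_subset by blast+
    obtain n G where G: "poly_below n G" "\<And>x. x \<in> cball 0 \<rho> \<Longrightarrow> \<bar>v x - G x\<bar> < \<epsilon> j"
      using polynomial_approximation[OF compact_cball vc' eps] by blast
    obtain n' E where E: "poly_below n' E" "\<And>x. x \<in> cball 0 \<rho> \<Longrightarrow> \<bar>F x - E x\<bar> < \<epsilon> j"
      using polynomial_approximation[OF compact_cball Fc' eps] by blast
    have "poly_below (max n' (n - 2)) (\<lambda>x. E x + (-1) * dunkl_laplacian R k G x)"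
      by (intro poly_below.add poly_below_cmult poly_below_mono[OF E(1)]
        poly_below_mono[OF poly_below_dunkl_laplacian[OF G(1)]]) auto
    then obtain q where q: "poly_below (max n' (n - 2)) q"
      "dunkl_laplacian R k (\<lambda>x. (\<rho>\<^sup>2 - x \<bullet> x) * q x) = (\<lambda>x. E x + (-1) * dunkl_laplacian R k G x)"
      using dirichlet_polynomial[OF _ \<rho>] by blast
    obtain g H where gh: "has_grad_hess G g H" using poly_below_grad_hess[OF G(1)] .
    obtain g' H' where gh': "has_grad_hess (\<lambda>x. (\<rho>\<^sup>2 - x \<bullet> x) * q x) g' H'"
      using poly_below_grad_hess[OF poly_below_boundary_factor[OF q(1)]] .
    show ?thesis
    proof (intro exI conjI allI impI)
      show "has_grad_hess (\<lambda>x. G x + 1 * ((\<rho>\<^sup>2 - x \<bullet> x) * q x)) (\<lambda>x. g x + 1 *\<^sub>R g' x) (\<lambda>x h. H x h + 1 *\<^sub>R H' x h)"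
        by (rule has_grad_hess_add[OF gh has_grad_hess_cmult[OF gh']])
      show "\<bar>v x - (G x + 1 * ((\<rho>\<^sup>2 - x \<bullet> x) * q x))\<bar> \<le> \<epsilon> j" if "norm x = \<rho>" for x
        using G(2)[of x] that by (simp add: power2_norm_eq_inner[symmetric])
      show "\<bar>dunkl_laplacian R k (\<lambda>x. G x + 1 * ((\<rho>\<^sup>2 - x \<bullet> x) * q x)) x - F x\<bar> \<le> \<epsilon> j" if "norm x \<le> \<rho>" for x
        using E(2)[of x] that unfolding dunkl_laplacian_linear[OF gh gh'] q(2) by simp
    qed
  qed
  (* Solutions of the Dirichlet problem with data approximating v on the sphere and F in the ball. *)
  obtain P where P: "\<And>j. \<exists>g H. has_grad_hess (P j) g H"
    "\<And>j x. norm x = \<rho> \<Longrightarrow> \<bar>v x - P j x\<bar> \<le> \<epsilon> j"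
    "\<And>j x. norm x \<le> \<rho> \<Longrightarrow> \<bar>dunkl_laplacian R k (P j) x - F x\<bar> \<le> \<epsilon> j"
    using ex by metis
  define K where "K = 1 + \<rho>\<^sup>2 / m"
  have K: "K > 0" using m_pos by (simp add: K_def add_pos_nonneg)
  (* The maximum principle turns closeness of the data into closeness of the solutions. *)
  have PP: "\<bar>P i x - P j x\<bar> \<le> (\<epsilon> i + \<epsilon> j) * K" if x: "norm x \<le> \<rho>" for i j x
  proof -
    obtain g H g' H' where gh: "has_grad_hess (P i) g H" "has_grad_hess (P j) g' H'" using P(1) by meson
    have "\<bar>P i x + (-1) * P j x\<bar> \<le> (\<epsilon> i + \<epsilon> j) + (\<epsilon> i + \<epsilon> j) * \<rho>\<^sup>2 / m"
    proof (rule weak_max_principle_abs[OF has_grad_hess_add[OF gh(1) has_grad_hess_cmult[OF gh(2)]] \<rho> _ _ _ x])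
      show "\<epsilon> i + \<epsilon> j > 0" using eps by (simp add: add_pos_pos)
      show "\<bar>dunkl_laplacian R k (\<lambda>x. P i x + (-1) * P j x) y\<bar> \<le> \<epsilon> i + \<epsilon> j" if "norm y < \<rho>" for y
        using P(3)[of y i] P(3)[of y j] that unfolding dunkl_laplacian_linear[OF gh] by simp
      show "\<bar>P i y + (-1) * P j y\<bar> \<le> \<epsilon> i + \<epsilon> j" if "norm y = \<rho>" for y
        using P(2)[of y i] P(2)[of y j] that by simp
    qed
    also have "(\<epsilon> i + \<epsilon> j) + (\<epsilon> i + \<epsilon> j) * \<rho>\<^sup>2 / m = (\<epsilon> i + \<epsilon> j) * K"
      unfolding K_def distrib_left[of _ 1] by simp
    finally show ?thesis by simp
  qed
  have conv: "convergent (\<lambda>j. P j x)" if x: "norm x \<le> \<rho>" for x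
  proof (rule Cauchy_convergent, rule metric_CauchyI)
    fix r :: real assume r: "r > 0"
    have "(\<lambda>j. \<epsilon> j * K) \<longlonglongrightarrow> 0 * K" by (intro tendsto_intros eps0)
    then have "\<forall>\<^sub>F j in sequentially. \<epsilon> j * K < r / 2" using r by (intro order_tendstoD(2)) auto
    then obtain N where N: "\<And>j. j \<ge> N \<Longrightarrow> \<epsilon> j * K < r / 2" unfolding eventually_sequentially by blast
    have "dist (P i x) (P j x) < r" if "i \<ge> N" "j \<ge> N" for i j
      using PP[OF x, of i j] N[OF that(1)] N[OF that(2)] unfolding distrib_right dist_real_def by linarith
    then show "\<exists>M. \<forall>i\<ge>M. \<forall>j\<ge>M. dist (P i x) (P j x) < r" by blast
  qed
  define p where "p = (\<lambda>x. lim (\<lambda>j. P j x))"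
  have lim: "(\<lambda>j. P j x) \<longlonglongrightarrow> p x" if "norm x \<le> \<rho>" for x
    using conv[OF that] by (simp add: p_def convergent_LIMSEQ_iff)
  have Pp: "\<bar>P i x - p x\<bar> \<le> \<epsilon> i * K" if x: "norm x \<le> \<rho>" for i x
  proof (rule LIMSEQ_le)
    show "(\<lambda>j. \<bar>P i x - P j x\<bar>) \<longlonglongrightarrow> \<bar>P i x - p x\<bar>" by (intro tendsto_intros lim x)
    have "(\<lambda>j. (\<epsilon> i + \<epsilon> j) * K) \<longlonglongrightarrow> (\<epsilon> i + 0) * K" by (intro tendsto_intros eps0)
    then show "(\<lambda>j. (\<epsilon> i + \<epsilon> j) * K) \<longlonglongrightarrow> \<epsilon> i * K" by simp
    show "\<exists>N. \<forall>n\<ge>N. \<bar>P i x - P n x\<bar> \<le> (\<epsilon> i + \<epsilon> n) * K" using PP[OF x] by blast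
  qed
  have pc: "continuous_on (cball 0 \<rho>) p"
  proof (rule uniform_limit_theorem[of _ P sequentially])
    show "\<forall>\<^sub>F n in sequentially. continuous_on (cball 0 \<rho>) (P n)"
      using P(1) has_grad_hess_continuous(1) continuous_on_subset by (intro always_eventually allI) blast
    show "uniform_limit (cball 0 \<rho>) P p sequentially"
    proof (rule uniform_limitI)
      fix r :: real assume r: "r > 0"
      have "(\<lambda>j. \<epsilon> j * K) \<longlonglongrightarrow> 0 * K" by (intro tendsto_intros eps0)
      then have "\<forall>\<^sub>F j in sequentially. \<epsilon> j * K < r" using r by (intro order_tendstoD(2)) auto
      then show "\<forall>\<^sub>F n in sequentially. \<forall>x\<in>cball 0 \<rho>. dist (P n x) (p x) < r"
        by eventually_elim (auto simp: dist_real_def intro: le_less_trans[OF Pp])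
    qed
  qed simp
  have psphere: "p x = v x" if x: "norm x = \<rho>" for x
  proof -
    have "(\<lambda>j. v x - P j x) \<longlonglongrightarrow> 0"
      by (rule Lim_null_comparison[OF _ eps0]) (use P(2)[OF x] in simp)
    moreover have "(\<lambda>j. v x - P j x) \<longlonglongrightarrow> v x - p x" using x by (intro tendsto_intros lim) simp
    ultimately have "v x - p x = 0" by (rule LIMSEQ_unique[symmetric])
    then show ?thesis by simp
  qed
  (* Continuous because p and v agree on the sphere. *)
  define z where "z = (\<lambda>x. if norm x \<le> \<rho> then v x - p x else 0)"
  have z0: "z x = 0" if "norm x \<ge> \<rho>" for x
    using psphere[of x] that by (auto simp: z_def)
  have zc: "continuous_on UNIV z"
  proof -
    have u: "UNIV = cball (0::'a) \<rho> \<union> {x. norm x \<ge> \<rho>}" by auto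
    have "continuous_on (cball (0::'a) \<rho> \<union> {x. norm x \<ge> \<rho>}) z" unfolding z_def
    proof (rule continuous_on_cases)
      show "closed {x::'a. \<rho> \<le> norm x}" by (intro closed_Collect_le continuous_intros)
      show "continuous_on (cball 0 \<rho>) (\<lambda>x. v x - p x)"
        by (intro continuous_intros pc continuous_on_subset[OF vc]) auto
      show "\<forall>x. (x \<in> cball 0 \<rho> \<and> \<not> norm x \<le> \<rho>) \<or> (x \<in> {x. \<rho> \<le> norm x} \<and> norm x \<le> \<rho>) \<longrightarrow> v x - p x = 0"
        using psphere by auto
    qed auto
    then show ?thesis using u by simp
  qed
  have tst: "(LINT x|lborel. z x * dunkl_laplacian R k \<psi> x * w x) = 0"
    if psi: "\<psi> \<in> test_functions" and gh: "has_grad_hess \<psi> g H" and out: "\<And>x. norm x > \<rho> \<Longrightarrow> \<psi> x = 0" for \<psi> g H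
  proof -
    define L where "L = dunkl_laplacian R k \<psi>"
    have cL: "continuous_on UNIV L" unfolding L_def by (rule continuous_dunkl_laplacian[OF gh])
    have L0: "L x = 0" if "norm x > \<rho>" for x
      using dunkl_term_C2_support[OF gh out that] has_grad_hess_support[OF gh out that]
      by (simp add: L_def dunkl_laplacian_eq[OF gh])
    have cpsi: "continuous_on UNIV \<psi>" by (rule has_grad_hess_continuous[OF gh])
    have iL: "integrable lborel (\<lambda>x. L x * w x)"
      by (rule integrable_compact_support[of _ \<rho>]) (auto simp: L0 intro!: continuous_intros cL continuous_weight)
    have ipsi: "integrable lborel (\<lambda>x. \<psi> x * w x)"
      by (rule integrable_compact_support[of _ \<rho>]) (auto simp: out intro!: continuous_intros cpsi continuous_weight)
    have b: "\<bar>LINT x|lborel. z x * (L x * w x)\<bar> \<le> \<epsilon> j * (K * (LINT x|lborel. \<bar>L x * w x\<bar>) + (LINT x|lborel. \<bar>\<psi> x * w x\<bar>))" for j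
    proof -
      obtain g' H' where ghj: "has_grad_hess (P j) g' H'" using P(1) by blast
      define E where "E = dunkl_laplacian R k (P j)"
      have cP: "continuous_on UNIV (P j)" by (rule has_grad_hess_continuous[OF ghj])
      have cE: "continuous_on UNIV E" unfolding E_def by (rule continuous_dunkl_laplacian[OF ghj])
      have i: "integrable lborel (\<lambda>x. f x * (L x * w x))" "integrable lborel (\<lambda>x. f x * (\<psi> x * w x))"
        if "continuous_on UNIV f" for f
        by (rule integrable_compact_support[of _ \<rho>],
          auto simp: L0 out intro!: continuous_intros that cL cpsi continuous_weight)+
      have 1: "(LINT x|lborel. v x * (L x * w x)) = (LINT x|lborel. F x * (\<psi> x * w x))"
        using weak[OF psi] by (simp add: L_def mult.assoc)
      have 2: "(LINT x|lborel. P j x * (L x * w x)) = (LINT x|lborel. E x * (\<psi> x * w x))"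
        using dunkl_green[OF ghj gh out] by (simp add: L_def E_def mult.assoc)
      have "(LINT x|lborel. z x * (L x * w x)) =
          (LINT x|lborel. (z x - v x + P j x) * (L x * w x)) + (LINT x|lborel. (F x - E x) * (\<psi> x * w x))"
        using 1 2 i[OF zc] i[OF vc] i[OF cP] i[OF Fc] i[OF cE]
        by (simp add: left_diff_distrib distrib_right)
      moreover have "\<bar>LINT x|lborel. (z x - v x + P j x) * (L x * w x)\<bar> \<le> \<epsilon> j * K * (LINT x|lborel. \<bar>L x * w x\<bar>)"
      proof (rule integral_mult_bound[OF iL])
        show "integrable lborel (\<lambda>x. (z x - v x + P j x) * (L x * w x))"
          by (intro i continuous_intros zc vc cP)
        fix x assume "L x * w x \<noteq> 0"
        then have "norm x \<le> \<rho>" using L0[of x] by (cases "norm x \<le> \<rho>") auto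
        then show "\<bar>z x - v x + P j x\<bar> \<le> \<epsilon> j * K" using Pp[of x j] by (simp add: z_def)
      qed
      moreover have "\<bar>LINT x|lborel. (F x - E x) * (\<psi> x * w x)\<bar> \<le> \<epsilon> j * (LINT x|lborel. \<bar>\<psi> x * w x\<bar>)"
      proof (rule integral_mult_bound[OF ipsi])
        show "integrable lborel (\<lambda>x. (F x - E x) * (\<psi> x * w x))"
          by (intro i continuous_intros Fc cE)
        fix x assume "\<psi> x * w x \<noteq> 0"
        then have "norm x \<le> \<rho>" using out[of x] by (cases "norm x \<le> \<rho>") auto
        then show "\<bar>F x - E x\<bar> \<le> \<epsilon> j" using P(3)[of x j] by (simp add: E_def abs_minus_commute)
      qed
      ultimately show ?thesis unfolding distrib_left mult.assoc[symmetric] by linarith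
    qed
    have "(\<lambda>j. \<epsilon> j * (K * (LINT x|lborel. \<bar>L x * w x\<bar>) + (LINT x|lborel. \<bar>\<psi> x * w x\<bar>)))
        \<longlonglongrightarrow> 0 * (K * (LINT x|lborel. \<bar>L x * w x\<bar>) + (LINT x|lborel. \<bar>\<psi> x * w x\<bar>))"
      by (intro tendsto_intros eps0)
    then have "\<bar>LINT x|lborel. z x * (L x * w x)\<bar> \<le> 0"
      using b by (intro LIMSEQ_le_const[of _ 0]) auto
    then show ?thesis by (simp add: L_def mult.assoc)
  qed
  have "z x = 0" for x
  proof (rule zero_if_orthogonal_to_polynomials[OF zc z0])
    fix n f assume f: "poly_below n (f :: 'a \<Rightarrow> real)"
    obtain q where q: "poly_below n q" "dunkl_laplacian R k (\<lambda>x. (\<rho>\<^sup>2 - x \<bullet> x) * q x) = f"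
      using dirichlet_polynomial[OF f \<rho>] .
    obtain g H where gh: "has_grad_hess q g H" using poly_below_grad_hess[OF q(1)] .
    have "(LINT x|lborel. z x * dunkl_laplacian R k (\<lambda>x. (\<rho>\<^sup>2 - x \<bullet> x) * q x) x * w x) = 0"
    proof (rule orthogonal_boundary_factor[OF \<rho> zc z0 q(1)])
      fix \<delta> :: real assume d: "\<delta> > 0"
      obtain g' H' where gh': "has_grad_hess (\<lambda>x. soft \<delta> (\<rho>\<^sup>2 - x \<bullet> x) * q x) g' H'"
        using dunkl_laplacian_soft(2)[OF d gh, of "\<rho>\<^sup>2"] by blast
      show "(LINT x|lborel. z x * dunkl_laplacian R k (\<lambda>x. soft \<delta> (\<rho>\<^sup>2 - x \<bullet> x) * q x) x * w x) = 0"
      proof (rule tst[OF soft_test_function[OF q(1) d \<rho>] gh'])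
        fix x :: 'a assume "norm x > \<rho>"
        then have "\<rho>\<^sup>2 < x \<bullet> x" unfolding power2_norm_eq_inner[symmetric]
          using \<rho> by (intro power_strict_mono) auto
        then show "soft \<delta> (\<rho>\<^sup>2 - x \<bullet> x) * q x = 0" by (simp add: soft_def flat_exp_def)
      qed
    qed
    then show "(LINT x|lborel. z x * f x * w x) = 0" unfolding q(2) .
  qed
  then have vp: "v x = p x" if "norm x \<le> \<rho>" for x
    using that unfolding z_def by (metis eq_iff_diff_eq_0)
  have "(\<lambda>j. \<epsilon> j * K) \<longlonglongrightarrow> 0 * K" by (intro tendsto_intros eps0)
  then have "\<forall>\<^sub>F j in sequentially. \<epsilon> j * K < e" using e by (intro order_tendstoD(2)) auto
  moreover have "\<forall>\<^sub>F j in sequentially. \<epsilon> j < e" using eps0 e by (intro order_tendstoD(2)) auto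
  ultimately have "\<forall>\<^sub>F j in sequentially. \<epsilon> j * K < e \<and> \<epsilon> j < e" by (rule eventually_conj)
  then obtain j where j: "\<epsilon> j * K < e" "\<epsilon> j < e" unfolding eventually_sequentially by blast
  obtain g H where "has_grad_hess (P j) g H" using P(1) by blast
  then show ?thesis
  proof (rule that)
    show "\<bar>v x - P j x\<bar> \<le> e" if "norm x \<le> \<rho>" for x
      using Pp[OF that, of j] vp[OF that] j by (simp add: abs_minus_commute)
    show "\<bar>dunkl_laplacian R k (P j) x - F x\<bar> \<le> e" if "norm x \<le> \<rho>" for x
      using P(3)[OF that, of j] j by simp
  qed
qed

end

section \<open>The one-dimensional equation and the Keller-Osserman condition\<close>

lemma continuous_on_one_over:
  fixes h :: "real \<Rightarrow> real"
  assumes "continuous_on S h" "\<And>t. t \<in> S \<Longrightarrow> h t > 0"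
  shows "continuous_on S (\<lambda>t. 1 / h t)"
  by (intro continuous_on_divide continuous_on_const assms(1) ballI) (metis assms(2) less_irrefl)

lemma integral_one_over_nonneg:
  fixes h :: "real \<Rightarrow> real"
  assumes "continuous_on {c..} h" "\<And>t. c \<le> t \<Longrightarrow> h t > 0"
  shows "0 \<le> integral {c..y} (\<lambda>t. 1 / h t)"
proof (rule integral_nonneg)
  have "continuous_on {c..} (\<lambda>t. 1 / h t)" using assms by (intro continuous_on_one_over) auto
  then show "(\<lambda>t. 1 / h t) integrable_on {c..y}"
    by (intro integrable_continuous_interval) (auto elim: continuous_on_subset)
  show "0 \<le> 1 / h t" if "t \<in> {c..y}" for t
    using assms(2)[of t] that by (simp add: less_imp_le)
qed

lemma integral_derivative_at:
  fixes g :: "real \<Rightarrow> real"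
  assumes "continuous_on {c..} g" "c < y"
  shows "((\<lambda>x. integral {c..x} g) has_real_derivative g y) (at y)"
proof -
  have "((\<lambda>x. integral {c..x} g) has_real_derivative g y) (at y within {c..y + 1})"
    by (rule integral_has_real_derivative) (use assms in \<open>auto intro: continuous_on_subset\<close>)
  moreover have "at y within {c..y + 1} = at y"
    using assms(2) by (intro at_within_interior) simp
  ultimately show ?thesis by simp
qed

text \<open>\<open>Q\<close> is the inverse of \<open>I\<close>; wherever \<open>I\<close> takes the value \<open>s\<close>, it solves \<open>Q' = h(Q)\<close> at \<open>s\<close>.\<close>

lemma separation_of_variables:
  fixes h :: "real \<Rightarrow> real"
  assumes h: "continuous_on {c..} h" "\<And>t. c \<le> t \<Longrightarrow> h t > 0"
  defines "I \<equiv> \<lambda>y. integral {c..y} (\<lambda>t. 1 / h t)"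
  obtains Q where "\<And>y. c < y \<Longrightarrow> Q (I y) = y" "\<And>y. c < y \<Longrightarrow> (Q has_real_derivative h y) (at (I y))"
    "\<And>y y'. c < y \<Longrightarrow> y < y' \<Longrightarrow> I y < I y'"
    "\<And>y y' s. c < y \<Longrightarrow> y \<le> y' \<Longrightarrow> I y \<le> s \<Longrightarrow> s \<le> I y' \<Longrightarrow> \<exists>z. y \<le> z \<and> z \<le> y' \<and> I z = s"
proof -
  have ch: "continuous_on {c..} (\<lambda>t. 1 / h t)"
    using h by (intro continuous_on_one_over) auto
  have der: "(I has_real_derivative 1 / h y) (at y)" if "c < y" for y
    unfolding I_def by (rule integral_derivative_at[OF ch that])
  have mono: "I y < I y'" if "c < y" "y < y'" for y y'
  proof (rule DERIV_pos_imp_increasing[OF that(2)])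
    fix x assume "y \<le> x"
    then show "\<exists>d. (I has_real_derivative d) (at x) \<and> 0 < d"
      using der[of x] h(2)[of x] that(1) by (intro exI[of _ "1 / h x"]) simp
  qed
  have inj: "y = y'" if "c < y" "c < y'" "I y = I y'" for y y'
    using mono[of y y'] mono[of y' y] that by (cases y y' rule: linorder_cases) auto
  have ivt: "\<exists>z. y \<le> z \<and> z \<le> y' \<and> I z = s" if "c < y" "y \<le> y'" "I y \<le> s" "s \<le> I y'" for y y' s
    by (rule IVT[OF that(3,4,2)]) (use that der DERIV_isCont in \<open>auto intro!: DERIV_isCont der\<close>)
  define Q where "Q = (\<lambda>s. SOME y. c < y \<and> I y = s)"
  have Q: "Q (I y) = y" if "c < y" for y
    unfolding Q_def by (rule some_equality) (use that inj in auto)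
  have derQ: "(Q has_real_derivative h y) (at (I y))" if y: "c < y" for y
  proof -
    (* Radius of a neighbourhood of y on which I is invertible; it has to stay to the right of c. *)
    define d where "d = (y - c) / 2"
    have d: "d > 0" "c < y - d" using y by (auto simp: d_def field_simps)
    have "(Q has_real_derivative inverse (1 / h y)) (at (I y))"
    proof (rule DERIV_inverse_function[where f = I and a = "I (y - d)" and b = "I (y + d)"])
      show "(I has_real_derivative 1 / h y) (at (Q (I y)))" using der[OF y] Q[OF y] by simp
      show "1 / h y \<noteq> 0" using h(2)[of y] y by simp
      show "I (y - d) < I y" "I y < I (y + d)" using mono d by auto
      show "I (Q s) = s" if s: "I (y - d) < s" "s < I (y + d)" for s
      proof -
        have "y - d \<le> y + d" "I (y - d) \<le> s" "s \<le> I (y + d)" using d s by auto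
        from ivt[OF d(2) this] obtain z where "y - d \<le> z" "I z = s" by blast
        then show ?thesis using Q[of z] d by auto
      qed
      show "isCont Q (I y)"
      proof (rule isCont_inverse_function[where f = I and x = y and d = d, OF d(1)])
        show "Q (I z) = z" if "\<bar>z - y\<bar> \<le> d" for z using that d by (intro Q) linarith
        show "isCont I z" if "\<bar>z - y\<bar> \<le> d" for z using that d by (intro DERIV_isCont[OF der]) linarith
      qed
    qed
    then show ?thesis by simp
  qed
  show ?thesis by (rule that[OF Q derQ mono ivt])
qed

locale nonlinearity =
  fixes \<phi> :: "real \<Rightarrow> real"
  assumes cont: "continuous_on {0..} \<phi>" and nonneg: "0 \<le> t \<Longrightarrow> 0 \<le> \<phi> t"
    and mono: "0 \<le> s \<Longrightarrow> s \<le> t \<Longrightarrow> \<phi> s \<le> \<phi> t"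
begin

definition \<Phi> :: "real \<Rightarrow> real" where "\<Phi> t = integral {0..t} \<phi>"

lemma \<phi>_integrable: "0 \<le> a \<Longrightarrow> \<phi> integrable_on {a..b}"
  by (rule integrable_continuous_interval) (rule continuous_on_subset[OF cont], auto)

lemma \<Phi>_deriv: "0 < t \<Longrightarrow> (\<Phi> has_real_derivative \<phi> t) (at t)"
  unfolding \<Phi>_def[abs_def] by (rule integral_derivative_at[OF cont])

lemma \<Phi>_diff: "0 \<le> s \<Longrightarrow> s \<le> t \<Longrightarrow> \<Phi> t = \<Phi> s + integral {s..t} \<phi>"
  unfolding \<Phi>_def by (rule Henstock_Kurzweil_Integration.integral_combine[symmetric]) (auto intro: \<phi>_integrable)

lemma \<Phi>_increment_lower:
  assumes "0 \<le> s" "s \<le> t"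
  shows "(t - s) * \<phi> s \<le> \<Phi> t - \<Phi> s"
proof -
  have "integral {s..t} (\<lambda>_. \<phi> s) \<le> integral {s..t} \<phi>"
    by (rule integral_le) (use assms \<phi>_integrable mono in auto)
  then show ?thesis using \<Phi>_diff[OF assms] assms(2) by simp
qed

lemma \<Phi>_mono:
  assumes "0 \<le> s" "s \<le> t"
  shows "\<Phi> s \<le> \<Phi> t"
proof -
  have "0 \<le> (t - s) * \<phi> s" using assms nonneg by simp
  then show ?thesis using \<Phi>_increment_lower[OF assms] by linarith
qed

lemma \<Phi>_nonneg: "0 \<le> t \<Longrightarrow> 0 \<le> \<Phi> t"
  using \<Phi>_mono[of 0 t] by (simp add: \<Phi>_def)

lemma \<Phi>_upper:
  assumes "0 \<le> t"
  shows "\<Phi> t \<le> t * \<phi> t"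
proof -
  have "integral {0..t} \<phi> \<le> integral {0..t} (\<lambda>_. \<phi> t)"
    by (rule integral_le) (use \<phi>_integrable mono in auto)
  then show ?thesis using assms by (simp add: \<Phi>_def)
qed

lemma \<Phi>_continuous: "continuous_on {0<..} \<Phi>"
  by (intro continuous_at_imp_continuous_on ballI DERIV_isCont[OF \<Phi>_deriv]) auto

lemma \<Phi>_zero_imp:
  assumes "\<Phi> t = 0" "0 \<le> s" "s < t"
  shows "\<phi> s = 0"
proof -
  have "(t - s) * \<phi> s \<le> 0"
    using \<Phi>_increment_lower[of s t] \<Phi>_nonneg[of s] assms by simp
  then show ?thesis using assms nonneg[of s] by (simp add: mult_le_0_iff)
qed

lemma keller_osserman_if_flat:
  assumes t: "0 < t" "\<Phi> t = 0"
  shows "keller_osserman \<phi>"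
proof -
  have z: "\<Phi> s = 0" if "0 \<le> s" "s \<le> t" for s
    using \<Phi>_mono[OF that] \<Phi>_nonneg[OF that(1)] t by simp
  have "\<infinity> = (\<integral>\<^sup>+s. \<infinity> * indicator {t/2..t} s \<partial>lborel)"
    using t by (subst nn_integral_cmult_indicator) (auto simp: ennreal_top_mult)
  also have "\<dots> \<le> (\<integral>\<^sup>+s\<in>{t/2..}. inverse (ennreal (sqrt (integral {0..s} \<phi>))) \<partial>lborel)"
    by (rule nn_integral_mono) (use t z in \<open>auto simp: indicator_def \<Phi>_def[symmetric]\<close>)
  finally have "(\<integral>\<^sup>+s\<in>{t/2..}. inverse (ennreal (sqrt (integral {0..s} \<phi>))) \<partial>lborel) = \<infinity>"
    by (simp add: top.extremum_unique)
  then show ?thesis unfolding keller_osserman_def using t by (intro exI[of _ "t/2"]) simp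
qed

end

lemma nn_integral_atLeastAtMost:
  fixes g :: "real \<Rightarrow> real"
  assumes g: "continuous_on {a..b} g" "\<And>t. a \<le> t \<Longrightarrow> t \<le> b \<Longrightarrow> 0 \<le> g t"
  shows "(\<integral>\<^sup>+t. ennreal (g t) * indicator {a..b} t \<partial>lborel) = ennreal (integral {a..b} g)"
proof -
  have i: "set_integrable lborel {a..b} g" by (rule borel_integrable_atLeastAtMost'[OF g(1)])
  have "(\<integral>\<^sup>+t. ennreal (g t) * indicator {a..b} t \<partial>lborel) = (\<integral>\<^sup>+t. ennreal (indicator {a..b} t * g t) \<partial>lborel)"
    by (intro nn_integral_cong) (auto simp: indicator_def)
  also have "\<dots> = ennreal (LINT t|lborel. indicator {a..b} t * g t)"
    using i g(2) by (intro nn_integral_eq_integral) (auto simp: set_integrable_def indicator_def)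
  also have "(LINT t|lborel. indicator {a..b} t * g t) = integral {a..b} g"
    using set_borel_integral_eq_integral(2)[OF i] by (simp add: set_lebesgue_integral_def)
  finally show ?thesis .
qed

text \<open>Links the extended integral in the Keller-Osserman condition to the growth of ordinary integrals.\<close>

lemma nn_integral_atLeast_bound:
  fixes g :: "real \<Rightarrow> real"
  assumes g: "continuous_on {a..} g" "\<And>t. a \<le> t \<Longrightarrow> 0 \<le> g t"
  shows "(\<integral>\<^sup>+t. ennreal (g t) * indicator {a..} t \<partial>lborel) = \<infinity> \<longleftrightarrow> (\<forall>B. \<exists>y\<ge>a. B < integral {a..y} g)"
proof
  have fin: "(\<integral>\<^sup>+t. ennreal (g t) * indicator {a..y} t \<partial>lborel) = ennreal (integral {a..y} g)" for y
    using g by (intro nn_integral_atLeastAtMost) (auto intro: continuous_on_subset)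
  show "\<forall>B. \<exists>y\<ge>a. B < integral {a..y} g" if inf: "(\<integral>\<^sup>+t. ennreal (g t) * indicator {a..} t \<partial>lborel) = \<infinity>"
  proof (rule ccontr)
    assume "\<not> (\<forall>B. \<exists>y\<ge>a. B < integral {a..y} g)"
    then obtain B where B: "\<And>y. a \<le> y \<Longrightarrow> integral {a..y} g \<le> B" by (auto simp: not_less)
    have "(\<integral>\<^sup>+t. ennreal (g t) * indicator {a..} t \<partial>lborel)
        = (\<integral>\<^sup>+t. (SUP n::nat. ennreal (g t) * indicator {a..a + real n} t) \<partial>lborel)"
    proof (rule nn_integral_cong)
      fix t :: real
      obtain n where n: "t \<le> a + real n" using real_arch_simple[of "t - a"] by (auto simp: algebra_simps)
      have "(SUP n::nat. ennreal (g t) * indicator {a..a + real n} t) = ennreal (g t) * indicator {a..} t"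
        by (rule antisym, rule SUP_least)
          (auto simp: indicator_def n intro!: SUP_upper2[of n])
      then show "ennreal (g t) * indicator {a..} t = (SUP n::nat. ennreal (g t) * indicator {a..a + real n} t)" ..
    qed
    also have "\<dots> = (SUP n::nat. \<integral>\<^sup>+t. ennreal (g t) * indicator {a..a + real n} t \<partial>lborel)"
    proof (rule nn_integral_monotone_convergence_SUP)
      show "incseq (\<lambda>n t. ennreal (g t) * indicator {a..a + real n} t)"
        by (auto simp: incseq_def le_fun_def indicator_def)
      show "(\<lambda>t. ennreal (g t) * indicator {a..a + real n} t) \<in> borel_measurable lborel" for n
      proof -
        have "(\<lambda>t. indicator {a..a + real n} t *\<^sub>R g t) \<in> borel_measurable borel"
          using g(1) by (intro borel_measurable_continuous_on_indicator) (auto intro: continuous_on_subset)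
        then have "(\<lambda>t. ennreal (indicator {a..a + real n} t *\<^sub>R g t)) \<in> borel_measurable borel" by measurable
        also have "(\<lambda>t. ennreal (indicator {a..a + real n} t *\<^sub>R g t)) = (\<lambda>t. ennreal (g t) * indicator {a..a + real n} t)"
          by (auto simp: indicator_def fun_eq_iff)
        finally show ?thesis by simp
      qed
    qed
    also have "\<dots> \<le> ennreal B"
      unfolding fin by (intro SUP_least ennreal_leI B) auto
    finally show False using inf by (simp add: top.extremum_unique)
  qed
  show "(\<integral>\<^sup>+t. ennreal (g t) * indicator {a..} t \<partial>lborel) = \<infinity>" if unb: "\<forall>B. \<exists>y\<ge>a. B < integral {a..y} g"
  proof (rule ccontr)
    assume "(\<integral>\<^sup>+t. ennreal (g t) * indicator {a..} t \<partial>lborel) \<noteq> \<infinity>"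
    then obtain B where B: "0 \<le> B" "(\<integral>\<^sup>+t. ennreal (g t) * indicator {a..} t \<partial>lborel) = ennreal B"
      by (cases "(\<integral>\<^sup>+t. ennreal (g t) * indicator {a..} t \<partial>lborel)") auto
    obtain y where y: "y \<ge> a" "B < integral {a..y} g" using unb by blast
    have "ennreal (integral {a..y} g) \<le> ennreal B"
      unfolding fin[symmetric] B(2)[symmetric]
      by (intro nn_integral_mono) (auto simp: indicator_def)
    then show False using y B(1) by (simp add: ennreal_le_iff)
  qed
qed

context nonlinearity
begin

lemma ko_integrand:
  assumes "\<And>t. 0 < t \<Longrightarrow> 0 < \<Phi> t" "0 < a"
  shows "(\<integral>\<^sup>+t\<in>{a..}. inverse (ennreal (sqrt (integral {0..t} \<phi>))) \<partial>lborel) = \<infinity>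
    \<longleftrightarrow> (\<forall>B. \<exists>y\<ge>a. B < integral {a..y} (\<lambda>t. 1 / sqrt (\<Phi> t)))"
proof -
  have "(\<integral>\<^sup>+t\<in>{a..}. inverse (ennreal (sqrt (integral {0..t} \<phi>))) \<partial>lborel)
     = (\<integral>\<^sup>+t. ennreal (1 / sqrt (\<Phi> t)) * indicator {a..} t \<partial>lborel)"
    using assms
    by (intro nn_integral_cong) (auto simp: indicator_def \<Phi>_def[symmetric] inverse_ennreal divide_inverse)
  moreover have "continuous_on {a..} (\<lambda>t. 1 / sqrt (\<Phi> t))"
    using assms by (intro continuous_on_one_over continuous_on_real_sqrt continuous_on_subset[OF \<Phi>_continuous]) auto
  moreover have "0 \<le> 1 / sqrt (\<Phi> t)" if "a \<le> t" for t using assms that by (simp add: \<Phi>_nonneg)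
  ultimately show ?thesis using nn_integral_atLeast_bound[of a "\<lambda>t. 1 / sqrt (\<Phi> t)"] by simp
qed

lemma sqrt_\<Phi>_continuous: "0 < c \<Longrightarrow> continuous_on {c..} (\<lambda>t. sqrt (\<Phi> t))"
  by (intro continuous_intros continuous_on_subset[OF \<Phi>_continuous]) auto

lemma sqrt_\<Phi>_deriv:
  assumes "0 < t" "0 < \<Phi> t"
  shows "((\<lambda>t. sqrt (\<Phi> t)) has_real_derivative \<phi> t / (2 * sqrt (\<Phi> t))) (at t)"
  using DERIV_chain2[OF DERIV_real_sqrt[OF assms(2)] \<Phi>_deriv[OF assms(1)]]
  by (simp add: field_simps)

text \<open>The solution of \<open>q' = c sqrt (\<Phi> q)\<close> with \<open>q 0 = a\<close>, which also satisfies \<open>q'' = c\<^sup>2 \<phi>(q) / 2\<close>; it exists on the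
range of \<open>y \<mapsto> I y - I a\<close>.  The base point \<open>b < a\<close> makes the derivatives at time 0 two-sided.\<close>

lemma separated_solution:
  assumes pos: "\<And>t. 0 < t \<Longrightarrow> 0 < \<Phi> t" and b: "0 < b" "b < a" and c: "0 < c"
  defines "I \<equiv> \<lambda>y. integral {b..y} (\<lambda>t. 1 / sqrt (\<Phi> t)) / c"
  obtains q where "\<And>y. b < y \<Longrightarrow> q (I y - I a) = y"
    "\<And>y. b < y \<Longrightarrow> (q has_real_derivative c * sqrt (\<Phi> y)) (at (I y - I a))"
    "\<And>y. b < y \<Longrightarrow> ((\<lambda>s. c * sqrt (\<Phi> (q s))) has_real_derivative c\<^sup>2 * \<phi> y / 2) (at (I y - I a))"
    "\<And>y y'. b \<le> y \<Longrightarrow> y < y' \<Longrightarrow> I y < I y'"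
    "\<And>s y'. 0 \<le> s \<Longrightarrow> a \<le> y' \<Longrightarrow> s + I a \<le> I y' \<Longrightarrow> \<exists>y\<ge>a. s = I y - I a"
proof -
  define h where "h = (\<lambda>t. c * sqrt (\<Phi> t))"
  have ch: "continuous_on {b / 2..} h" unfolding h_def using b(1)
    by (intro continuous_intros sqrt_\<Phi>_continuous) simp
  have hpos: "h t > 0" if "b / 2 \<le> t" for t using pos[of t] that b(1) c by (simp add: h_def)
  define K where "K = (\<lambda>y. integral {b / 2..y} (\<lambda>t. 1 / h t))"
  obtain Q where Q: "\<And>y. b / 2 < y \<Longrightarrow> Q (K y) = y" "\<And>y. b / 2 < y \<Longrightarrow> (Q has_real_derivative h y) (at (K y))"
    "\<And>y y'. b / 2 < y \<Longrightarrow> y < y' \<Longrightarrow> K y < K y'"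
    "\<And>y y' s. b / 2 < y \<Longrightarrow> y \<le> y' \<Longrightarrow> K y \<le> s \<Longrightarrow> s \<le> K y' \<Longrightarrow> \<exists>z. y \<le> z \<and> z \<le> y' \<and> K z = s"
    using separation_of_variables[OF ch hpos] unfolding K_def by blast
  have KI: "K y = I y + K b" if "b \<le> y" for y
  proof -
    have "continuous_on {b / 2..} (\<lambda>t. 1 / h t)" using ch hpos by (intro continuous_on_one_over) auto
    then have "(\<lambda>t. 1 / h t) integrable_on {b / 2..y}"
      by (intro integrable_continuous_interval) (auto elim: continuous_on_subset)
    then have "K y = K b + integral {b..y} (\<lambda>t. 1 / h t)"
      unfolding K_def using b that by (intro Henstock_Kurzweil_Integration.integral_combine[symmetric]) auto
    also have "integral {b..y} (\<lambda>t. 1 / h t) = integral {b..y} (\<lambda>t. inverse c * (1 / sqrt (\<Phi> t)))"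
      unfolding h_def by (simp add: divide_inverse mult.commute)
    also have "\<dots> = I y" unfolding I_def integral_mult_right by (simp add: divide_inverse mult.commute)
    finally show ?thesis by simp
  qed
  define q where "q = (\<lambda>s. Q (s + K a))"
  have at: "I y - I a + K a = K y" if "b < y" for y using KI[of y] KI[of a] that b by simp
  have qy: "q (I y - I a) = y" if "b < y" for y unfolding q_def at[OF that] using that b by (intro Q) simp
  have qd: "(q has_real_derivative h y) (at (I y - I a))" if y: "b < y" for y
  proof -
    have "((\<lambda>s. Q (s + K a)) has_real_derivative h y * 1) (at (I y - I a))"
      by (rule DERIV_chain2) (use Q(2)[of y] at[OF y] y b in \<open>auto intro!: derivative_eq_intros\<close>)
    then show ?thesis by (simp add: q_def)
  qed
  have hd: "((\<lambda>s. c * sqrt (\<Phi> (q s))) has_real_derivative c\<^sup>2 * \<phi> y / 2) (at (I y - I a))" if y: "b < y" for y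
  proof -
    have yp: "0 < y" using y b by simp
    have "((\<lambda>t. c * sqrt (\<Phi> t)) has_real_derivative c * (\<phi> y / (2 * sqrt (\<Phi> y)))) (at (q (I y - I a)))"
      unfolding qy[OF y] by (rule DERIV_cmult[OF sqrt_\<Phi>_deriv[OF yp pos[OF yp]]])
    from DERIV_chain2[OF this qd[OF y]] show ?thesis
      by (rule DERIV_cong) (use pos[OF yp] in \<open>simp add: h_def power2_eq_square\<close>)
  qed
  have mono: "I y < I y'" if "b \<le> y" "y < y'" for y y'
    using Q(3)[of y y'] KI[of y] KI[of y'] that b by simp
  have hits: "\<exists>y\<ge>a. s = I y - I a" if s: "0 \<le> s" "a \<le> y'" "s + I a \<le> I y'" for s y'
  proof -
    have "K a \<le> s + K a" "s + K a \<le> K y'" using KI[of a] KI[of y'] s b by simp_all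
    then obtain z where z: "a \<le> z" "K z = s + K a" using Q(4)[of a y' "s + K a"] s b by auto
    then show ?thesis using at[of z] b by (intro exI[of _ z]) simp
  qed
  show ?thesis by (rule that[OF qy qd[unfolded h_def] hd mono hits])
qed

text \<open>Take \<open>Q' = c sqrt (\<Phi> Q)\<close>, which reaches infinity in finite time \<open>S\<close>.  Here \<open>2 s Q'' + m Q'\<close> is the radial Laplacian in the
variable \<open>s = \<bar>x\<bar>\<^sup>2 / 2\<close>, which makes \<open>Q(\<bar>x\<bar>\<^sup>2 / 2)\<close> twice differentiable at the origin.  The second-order term is at most
\<open>S c\<^sup>2 \<phi>(Q)\<close>.  The first-order term is controlled by \<open>sqrt (\<Phi> t) \<le> 2 K \<phi> t\<close>, a consequence of the convergence of
the integral, where \<open>K\<close> is a bound for it.  A small \<open>c\<close> makes the sum at most \<open>\<phi>(Q)\<close>.\<close>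

lemma blow_up_supersolution:
  fixes m :: real
  assumes nko: "\<not> keller_osserman \<phi>" and a: "0 < a" and m: "0 < m"
  obtains S Q dQ ddQ where "0 < S" "Q 0 = a"
    "\<And>s. 0 \<le> s \<Longrightarrow> s < S \<Longrightarrow> (Q has_real_derivative dQ s) (at s)"
    "\<And>s. 0 \<le> s \<Longrightarrow> s < S \<Longrightarrow> (dQ has_real_derivative ddQ s) (at s)"
    "\<And>s. 0 \<le> s \<Longrightarrow> s < S \<Longrightarrow> 2 * s * ddQ s + m * dQ s \<le> \<phi> (Q s)"
    "\<And>s. 0 \<le> s \<Longrightarrow> s < S \<Longrightarrow> a \<le> Q s"
    "\<And>M. \<exists>s0. 0 \<le> s0 \<and> s0 < S \<and> (\<forall>s. s0 \<le> s \<and> s < S \<longrightarrow> M \<le> Q s)"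
proof -
  have pos: "0 < \<Phi> t" if "0 < t" for t
    using keller_osserman_if_flat[OF that] nko \<Phi>_nonneg[of t] that by (cases "\<Phi> t = 0") auto
  define b where "b = a / 2"
  have b: "0 < b" "b < a" using a by (auto simp: b_def)
  have "(\<integral>\<^sup>+t\<in>{b..}. inverse (ennreal (sqrt (integral {0..t} \<phi>))) \<partial>lborel) \<noteq> \<infinity>"
    using nko b(1) unfolding keller_osserman_def by blast
  then have "\<not> (\<forall>B. \<exists>y\<ge>b. B < integral {b..y} (\<lambda>t. 1 / sqrt (\<Phi> t)))"
    using ko_integrand[OF pos b(1)] by simp
  then obtain K0 where K0: "\<And>y. b \<le> y \<Longrightarrow> integral {b..y} (\<lambda>t. 1 / sqrt (\<Phi> t)) \<le> K0"
    by (meson not_less)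
  define K where "K = max K0 1"
  have K: "K > 0" "\<And>y. b \<le> y \<Longrightarrow> integral {b..y} (\<lambda>t. 1 / sqrt (\<Phi> t)) \<le> K"
    using K0 by (fastforce simp: K_def)+
  define r where "r = (\<lambda>t. sqrt (\<Phi> t))"
  have rpos: "r t > 0" if "0 < t" for t using pos[OF that] by (simp add: r_def)
  have ci: "continuous_on {b..} (\<lambda>t. 1 / r t)"
  proof (rule continuous_on_one_over)
    show "continuous_on {b..} r" unfolding r_def by (rule sqrt_\<Phi>_continuous[OF b(1)])
    show "0 < r t" if "t \<in> {b..}" for t using that b(1) by (intro rpos) simp
  qed
  (* As r is nondecreasing, the integral over [t/2, t] is at least t / (2 r t); then combine with r t ^ 2 \<le> t \<phi> t. *)
  have r_le: "r t \<le> 2 * K * \<phi> t" if "a \<le> t" for t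
  proof -
    have t: "0 < t" "b \<le> t / 2" using that a by (auto simp: b_def)
    have i1: "(\<lambda>s. 1 / r s) integrable_on {b..t}"
      by (rule integrable_continuous_interval) (rule continuous_on_subset[OF ci], auto)
    have i2: "(\<lambda>s. 1 / r s) integrable_on {t/2..t}"
      by (rule integrable_continuous_interval) (rule continuous_on_subset[OF ci], use t in auto)
    have "t / 2 * (1 / r t) = integral {t/2..t} (\<lambda>_. 1 / r t)" using t by simp
    also have "\<dots> \<le> integral {t/2..t} (\<lambda>s. 1 / r s)"
    proof (rule integral_le[OF _ i2])
      fix s assume "s \<in> {t/2..t}"
      then have "0 < s" "r s \<le> r t" using t \<Phi>_mono[of s t] by (auto simp: r_def)
      then show "1 / r t \<le> 1 / r s" using rpos[of s] by (intro divide_left_mono) auto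
    qed (intro integrable_continuous_interval continuous_on_const)
    also have "\<dots> \<le> integral {b..t} (\<lambda>s. 1 / r s)"
    proof -
      have "integral {b..t} (\<lambda>s. 1 / r s) = integral {b..t/2} (\<lambda>s. 1 / r s) + integral {t/2..t} (\<lambda>s. 1 / r s)"
        by (rule Henstock_Kurzweil_Integration.integral_combine[symmetric]) (use t i1 in auto)
      moreover have "0 \<le> integral {b..t/2} (\<lambda>s. 1 / r s)"
        by (rule integral_one_over_nonneg) (use b in \<open>auto simp: r_def intro!: sqrt_\<Phi>_continuous pos\<close>)
      ultimately show ?thesis by linarith
    qed
    also have "\<dots> \<le> K" using K(2)[of t] t unfolding r_def by simp
    finally have tK: "t \<le> 2 * K * r t" using rpos[OF t(1)] by (simp add: field_simps)
    have "r t * r t = \<Phi> t" using \<Phi>_nonneg[of t] t by (simp add: r_def)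
    also have "\<dots> \<le> t * \<phi> t" using \<Phi>_upper[of t] t by simp
    also have "\<dots> \<le> (2 * K * r t) * \<phi> t" using tK nonneg[of t] t by (intro mult_right_mono) auto
    finally have "r t * r t \<le> r t * (2 * K * \<phi> t)" by (simp add: mult_ac)
    then show ?thesis using rpos[OF t(1)] by simp
  qed
  (* Chosen so that K c (1 + 2 m) < 1; see the estimate of the radial Laplacian below. *)
  define c where "c = 1 / (2 * K * (1 + m))"
  have c: "c > 0" using K m by (simp add: c_def)
  define I where "I = (\<lambda>y. integral {b..y} (\<lambda>t. 1 / sqrt (\<Phi> t)) / c)"
  have r': "sqrt (\<Phi> t) = r t" for t by (simp add: r_def)
  have I': "integral {b..y} (\<lambda>t. 1 / r t) / c = I y" for y by (simp add: I_def r')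
  obtain q where q: "\<And>y. b < y \<Longrightarrow> q (I y - I a) = y"
    "\<And>y. b < y \<Longrightarrow> (q has_real_derivative c * r y) (at (I y - I a))"
    "\<And>y. b < y \<Longrightarrow> ((\<lambda>s. c * r (q s)) has_real_derivative c\<^sup>2 * \<phi> y / 2) (at (I y - I a))"
    and Imono: "\<And>y y'. b \<le> y \<Longrightarrow> y < y' \<Longrightarrow> I y < I y'"
    and hits: "\<And>s y'. 0 \<le> s \<Longrightarrow> a \<le> y' \<Longrightarrow> s + I a \<le> I y' \<Longrightarrow> \<exists>y\<ge>a. s = I y - I a"
    by (rule separated_solution[OF pos b c, unfolded r' I']) (assumption, rule that, assumption+)
  have IK: "I y \<le> K / c" if "b < y" for y
    using K(2)[of y] that c by (simp add: I_def divide_right_mono)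
  have I0: "0 \<le> I a" using Imono[of b a] b by (simp add: I_def)
  define T where "T = Sup (I ` {a..})"
  have bdd: "bdd_above (I ` {a..})" using IK b by (intro bdd_aboveI2[of _ _ "K / c"]) auto
  have IT: "I y < T" if "a \<le> y" for y
  proof -
    have "I y < I (y + 1)" using Imono[of y "y + 1"] b that by simp
    also have "\<dots> \<le> T" unfolding T_def using bdd that by (intro cSup_upper) auto
    finally show ?thesis .
  qed
  have TK: "T \<le> K / c" unfolding T_def using IK b by (intro cSup_least) auto
  define S where "S = T - I a"
  have S: "0 < S" "S \<le> K / c" using IT[of a] TK I0 b by (auto simp: S_def)
  have hit: "\<exists>y\<ge>a. s = I y - I a" if s: "0 \<le> s" "s < S" for s
  proof -
    have "s + I a < T" using s by (simp add: S_def)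
    then obtain y where "a \<le> y" "s + I a < I y"
      unfolding T_def using less_cSup_iff[of "I ` {a..}"] bdd by auto
    then show ?thesis using hits[of s y] s by auto
  qed
  have qd: "(q has_real_derivative c * r (q s)) (at s)" and qa: "a \<le> q s"
    and hd: "((\<lambda>s. c * r (q s)) has_real_derivative c\<^sup>2 * \<phi> (q s) / 2) (at s)" if s: "0 \<le> s" "s < S" for s
  proof -
    obtain y where y: "a \<le> y" "s = I y - I a" using hit[OF s] by blast
    have qy: "q s = y" using y q(1)[of y] b by simp
    show "(q has_real_derivative c * r (q s)) (at s)" "a \<le> q s"
      "((\<lambda>s. c * r (q s)) has_real_derivative c\<^sup>2 * \<phi> (q s) / 2) (at s)"
      using y q(2,3)[of y] b unfolding qy by auto
  qed
  show ?thesis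
  proof (rule that[of S q "\<lambda>s. c * r (q s)" "\<lambda>s. c\<^sup>2 * \<phi> (q s) / 2"])
    show "0 < S" by (rule S)
    show "q 0 = a" using q(1)[of a] b by simp
    show "2 * s * (c\<^sup>2 * \<phi> (q s) / 2) + m * (c * r (q s)) \<le> \<phi> (q s)" if s: "0 \<le> s" "s < S" for s
    proof -
      have f: "0 \<le> \<phi> (q s)" using qa[OF s] a by (intro nonneg) simp
      have "s * c \<le> S * c" using s c by (intro mult_right_mono) auto
      also have "\<dots> \<le> K" using S(2) c by (simp add: pos_le_divide_eq)
      finally have "s * c \<le> K" .
      then have "(s * c) * (c * \<phi> (q s)) \<le> K * (c * \<phi> (q s))" using c f by (intro mult_right_mono) auto
      moreover have "m * (c * r (q s)) \<le> m * (c * (2 * K * \<phi> (q s)))"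
        using r_le[OF qa[OF s]] m c by (intro mult_left_mono) auto
      ultimately have "2 * s * (c\<^sup>2 * \<phi> (q s) / 2) + m * (c * r (q s)) \<le> (K * c * (1 + 2 * m)) * \<phi> (q s)"
        by (simp add: power2_eq_square algebra_simps)
      also have "\<dots> \<le> 1 * \<phi> (q s)"
      proof (intro mult_right_mono f)
        have "K * c * (1 + 2 * m) \<le> K * c * (2 * (1 + m))" using K c by (intro mult_left_mono) auto
        also have "\<dots> = 1" using K m by (simp add: c_def)
        finally show "K * c * (1 + 2 * m) \<le> 1" .
      qed
      finally show ?thesis by simp
    qed
    show "\<exists>s0. 0 \<le> s0 \<and> s0 < S \<and> (\<forall>s. s0 \<le> s \<and> s < S \<longrightarrow> M \<le> q s)" for M
    proof (intro exI conjI allI impI)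
      let ?y = "max M a"
      have m: "I a \<le> I ?y" using Imono[of a ?y] b by (cases "a < ?y") (auto simp: max_def)
      then show "0 \<le> I ?y - I a" by simp
      show "I ?y - I a < S" using IT[of ?y] by (simp add: S_def)
      fix s assume s: "I ?y - I a \<le> s \<and> s < S"
      then obtain y where y: "a \<le> y" "s = I y - I a" using hit[of s] m by auto
      have "?y \<le> y"
      proof (rule ccontr)
        assume "\<not> ?y \<le> y"
        then have "I y < I ?y" using Imono[of y ?y] y b by simp
        then show False using s y by simp
      qed
      then show "M \<le> q s" using y q(1)[of y] b by simp
    qed
  qed (use qd qa hd in auto)
qed

text \<open>The solution of \<open>B' = sqrt (2 \<Phi>(B))\<close>.  Its initial slope is positive; a supersolution for the radial problem may grow
too fast at the start, and this choice avoids an improper integral at \<open>a\<close>.\<close>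

lemma global_one_dim_solution:
  assumes ko: "keller_osserman \<phi>" and pos: "\<And>t. 0 < t \<Longrightarrow> 0 < \<Phi> t"
  obtains a B dB where "0 < a" "B 0 = a"
    "\<And>s. 0 \<le> s \<Longrightarrow> (B has_real_derivative dB s) (at s)" "\<And>s. 0 \<le> s \<Longrightarrow> 0 \<le> dB s"
    "\<And>s. 0 \<le> s \<Longrightarrow> (dB has_real_derivative \<phi> (B s)) (at s)" "\<And>s. 0 \<le> s \<Longrightarrow> a \<le> B s"
proof -
  obtain b where b: "0 < b" and unb: "\<And>C. \<exists>y\<ge>b. C < integral {b..y} (\<lambda>t. 1 / sqrt (\<Phi> t))"
    using ko ko_integrand[OF pos] unfolding keller_osserman_def by blast
  define a where "a = b + 1"
  have a: "b < a" "0 < a" using b by (auto simp: a_def)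
  define I where "I = (\<lambda>y. integral {b..y} (\<lambda>t. 1 / sqrt (\<Phi> t)) / sqrt 2)"
  have I': "integral {b..y} (\<lambda>t. 1 / sqrt (\<Phi> t)) / sqrt 2 = I y" for y by (simp add: I_def)
  obtain q where q: "\<And>y. b < y \<Longrightarrow> q (I y - I a) = y"
    "\<And>y. b < y \<Longrightarrow> (q has_real_derivative sqrt 2 * sqrt (\<Phi> y)) (at (I y - I a))"
    "\<And>y. b < y \<Longrightarrow> ((\<lambda>s. sqrt 2 * sqrt (\<Phi> (q s))) has_real_derivative (sqrt 2)\<^sup>2 * \<phi> y / 2) (at (I y - I a))"
    and Imono: "\<And>y y'. b \<le> y \<Longrightarrow> y < y' \<Longrightarrow> I y < I y'"
    and hits: "\<And>s y'. 0 \<le> s \<Longrightarrow> a \<le> y' \<Longrightarrow> s + I a \<le> I y' \<Longrightarrow> \<exists>y\<ge>a. s = I y - I a"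
    by (rule separated_solution[OF pos b a(1), of "sqrt 2", unfolded I']) (assumption, simp, rule that, assumption+)
  have hit: "\<exists>y\<ge>a. s = I y - I a" if s: "0 \<le> s" for s
  proof -
    obtain y where y: "b \<le> y" "(s + I a) * sqrt 2 < integral {b..y} (\<lambda>t. 1 / sqrt (\<Phi> t))"
      using unb by blast
    then have Iy: "s + I a < I y" by (simp add: I_def pos_less_divide_eq)
    then have "a \<le> y" using Imono[of y a] s y(1) by (cases "a \<le> y") auto
    then show ?thesis using hits[of s y] s Iy by simp
  qed
  have sol: "(q has_real_derivative sqrt 2 * sqrt (\<Phi> (q s))) (at s)" "a \<le> q s"
    "((\<lambda>s. sqrt 2 * sqrt (\<Phi> (q s))) has_real_derivative \<phi> (q s)) (at s)" if s: "0 \<le> s" for s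
  proof -
    obtain y where y: "a \<le> y" "s = I y - I a" using hit[OF s] by blast
    have qy: "q s = y" using y q(1)[of y] a by simp
    show "(q has_real_derivative sqrt 2 * sqrt (\<Phi> (q s))) (at s)" "a \<le> q s"
      "((\<lambda>s. sqrt 2 * sqrt (\<Phi> (q s))) has_real_derivative \<phi> (q s)) (at s)"
      using y q(2,3)[of y] a unfolding qy by auto
  qed
  show ?thesis
  proof (rule that[of a q "\<lambda>s. sqrt 2 * sqrt (\<Phi> (q s))"])
    show "q 0 = a" using q(1)[of a] a by simp
    show "0 \<le> sqrt 2 * sqrt (\<Phi> (q s))" if "0 \<le> s" for s
      using \<Phi>_nonneg[of "q s"] sol(2)[OF that] a by simp
  qed (use a sol in auto)
qed

end

section \<open>Comparison with blow-up supersolutions\<close>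

context dunkl_setting
begin

text \<open>Let \<open>p\<close> be a polynomial approximation of \<open>v\<close>, and let \<open>u\<close> be the blow-up supersolution.  The perturbed difference
\<open>p - u + \<epsilon> \<bar>x\<bar>\<^sup>2\<close> is negative on a sphere where \<open>u \<ge> v + 1\<close>, and positive at the origin if \<open>v 0 > a\<close>.  At its interior
maximum \<open>v \<ge> u\<close>, so \<open>\<Delta>\<^sub>k p\<close> is at least \<open>\<phi>(u) - \<epsilon>\<close> there, while the maximum principle makes it at most
\<open>\<phi>(u) - 2 m \<epsilon>\<close>.\<close>

lemma entire_solution_le:
  assumes nl: "nonlinearity \<phi>" and v: "entire_positive_solution R k \<phi> v"
    and nko: "\<not> keller_osserman \<phi>" and a: "0 < a"
  shows "v 0 \<le> a"
proof (rule ccontr)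
  interpret nonlinearity \<phi> by (rule nl)
  assume "\<not> v 0 \<le> a"
  then have va: "v 0 > a" by simp
  have vc: "continuous_on UNIV v" and vpos: "\<And>x. v x > 0"
    and weak: "\<And>\<psi>. \<psi> \<in> test_functions \<Longrightarrow>
      (LINT x|lborel. v x * dunkl_laplacian R k \<psi> x * w x) = (LINT x|lborel. \<phi> (v x) * \<psi> x * w x)"
    using v by (auto simp: entire_positive_solution_def)
  have Fc: "continuous_on UNIV (\<lambda>x. \<phi> (v x))"
    by (rule continuous_on_compose2[OF cont vc]) (use vpos in \<open>auto intro: less_imp_le\<close>)
  obtain S Q dQ ddQ where S: "0 < S" and Q0: "Q 0 = a"
    and dQ: "\<And>s. 0 \<le> s \<Longrightarrow> s < S \<Longrightarrow> (Q has_real_derivative dQ s) (at s)"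
    and ddQ: "\<And>s. 0 \<le> s \<Longrightarrow> s < S \<Longrightarrow> (dQ has_real_derivative ddQ s) (at s)"
    and super: "\<And>s. 0 \<le> s \<Longrightarrow> s < S \<Longrightarrow> 2 * s * ddQ s + m * dQ s \<le> \<phi> (Q s)"
    and Qa: "\<And>s. 0 \<le> s \<Longrightarrow> s < S \<Longrightarrow> a \<le> Q s"
    and blow: "\<And>M. \<exists>s0. 0 \<le> s0 \<and> s0 < S \<and> (\<forall>s. s0 \<le> s \<and> s < S \<longrightarrow> M \<le> Q s)"
    by (rule blow_up_supersolution[OF nko a m_pos]) (rule that, assumption+)
  obtain M where M: "M > 0" "\<And>x. norm x \<le> sqrt (2 * S) \<Longrightarrow> \<bar>v x\<bar> \<le> M"
    using continuous_bounded_cball[OF vc] by blast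
  obtain s0 where s0: "0 \<le> s0" "s0 < S" "\<And>s. s0 \<le> s \<Longrightarrow> s < S \<Longrightarrow> M + 1 \<le> Q s"
    using blow[of "M + 1"] by blast
  define s1 where "s1 = (s0 + S) / 2"
  have s1: "s0 \<le> s1" "s1 < S" "0 < s1" using s0 S by (auto simp: s1_def field_simps)
  define \<rho> where "\<rho> = sqrt (2 * s1)"
  have \<rho>: "\<rho> > 0" "\<rho>\<^sup>2 = 2 * s1" "\<rho> \<le> sqrt (2 * S)" using s1 by (auto simp: \<rho>_def)
  define \<delta> where "\<delta> = min (v 0 - a) 1"
  have \<delta>: "0 < \<delta>" "\<delta> \<le> v 0 - a" "\<delta> \<le> 1" using va by (auto simp: \<delta>_def)
  (* Small enough that two approximation errors and the perturbation on the ball stay below \<delta>. *)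
  define \<epsilon> where "\<epsilon> = \<delta> / (2 * (2 + \<rho>\<^sup>2))"
  have den: "2 * (2 + \<rho>\<^sup>2) > 0" by (simp add: add_pos_nonneg)
  have eps: "\<epsilon> > 0" using \<delta> den by (simp add: \<epsilon>_def)
  have "\<epsilon> * (2 * (2 + \<rho>\<^sup>2)) = \<delta>" using den by (simp add: \<epsilon>_def)
  then have eps2: "2 * \<epsilon> + \<epsilon> * \<rho>\<^sup>2 < \<delta>" using \<delta> eps by (simp add: algebra_simps)
  obtain p g H where p: "has_grad_hess p g H" "\<And>x. norm x \<le> \<rho> \<Longrightarrow> \<bar>v x - p x\<bar> \<le> \<epsilon>"
    "\<And>x. norm x \<le> \<rho> \<Longrightarrow> \<bar>dunkl_laplacian R k p x - \<phi> (v x)\<bar> \<le> \<epsilon>"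
    using distributional_approximation[OF vc Fc weak \<rho>(1) eps] by blast
  (* The perturbation \<epsilon> |x|^2 is moved to the radial side; in the variable s = |x|^2 / 2 it reads 2 \<epsilon> s. *)
  define U where "U = (\<lambda>s. Q s - 2 * \<epsilon> * s)"
  have sq: "0 \<le> (norm x)\<^sup>2 / 2" "(norm x)\<^sup>2 / 2 \<le> s1" "(norm x)\<^sup>2 / 2 < S" if "norm x \<le> \<rho>" for x :: 'a
  proof -
    have "(norm x)\<^sup>2 \<le> \<rho>\<^sup>2" using that by (intro power_mono) auto
    then show "0 \<le> (norm x)\<^sup>2 / 2" "(norm x)\<^sup>2 / 2 \<le> s1" "(norm x)\<^sup>2 / 2 < S" using \<rho>(2) s1 by auto
  qed
  have Uc: "continuous_on {0..s1} U"
  proof -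
    have "continuous_on {0..s1} Q"
      by (intro continuous_at_imp_continuous_on ballI DERIV_isCont[OF dQ]) (use s1 in auto)
    then show ?thesis unfolding U_def by (intro continuous_intros)
  qed
  have "continuous_on (cball 0 \<rho>) (\<lambda>x::'a. U ((norm x)\<^sup>2 / 2))"
    by (rule continuous_on_compose2[OF Uc]) (use sq in \<open>auto intro!: continuous_intros\<close>)
  then have "continuous_on (cball 0 \<rho>) (\<lambda>x. p x - U ((norm x)\<^sup>2 / 2))"
    by (intro continuous_on_diff continuous_on_subset[OF has_grad_hess_continuous(1)[OF p(1)]]) auto
  moreover have "cball (0::'a) \<rho> \<noteq> {}" using \<rho> by simp
  ultimately have "\<exists>x0\<in>cball 0 \<rho>. \<forall>y\<in>cball 0 \<rho>. p y - U ((norm y)\<^sup>2 / 2) \<le> p x0 - U ((norm x0)\<^sup>2 / 2)"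
    by (intro continuous_attains_sup compact_cball)
  then obtain x0 where x0: "norm x0 \<le> \<rho>"
    "\<And>y. norm y \<le> \<rho> \<Longrightarrow> p y - U ((norm y)\<^sup>2 / 2) \<le> p x0 - U ((norm x0)\<^sup>2 / 2)" by auto
  define s where "s = (norm x0)\<^sup>2 / 2"
  have s: "0 \<le> s" "s \<le> s1" "s < S" using sq[OF x0(1)] by (auto simp: s_def)
  have "p 0 - U 0 \<le> p x0 - U s" using x0(2)[of 0] \<rho> by (simp add: s_def)
  then have f0: "\<delta> - \<epsilon> \<le> p x0 - U s" using p(2)[of 0] \<rho> \<delta>(2) Q0 by (simp add: U_def)
  have es: "\<epsilon> * (2 * s) \<le> \<epsilon> * \<rho>\<^sup>2" using s \<rho>(2) eps by (intro mult_left_mono) auto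
  have interior: "norm x0 < \<rho>"
  proof (rule ccontr)
    assume "\<not> norm x0 < \<rho>"
    then have "norm x0 = \<rho>" using x0 by simp
    then have "s = s1" using \<rho>(2) by (simp add: s_def)
    then have "M + 1 \<le> Q s" using s0(3)[OF s1(1,2)] by simp
    moreover have "p x0 \<le> M + \<epsilon>" using p(2)[OF x0(1)] M(2)[of x0] x0(1) \<rho>(3) by linarith
    ultimately have "p x0 - U s \<le> \<epsilon> - 1 + \<epsilon> * \<rho>\<^sup>2" using es unfolding U_def by linarith
    then show False using f0 eps2 \<delta> by linarith
  qed
  have "dunkl_laplacian R k p x0 \<le> (norm x0)\<^sup>2 * ddQ s + m * (dQ s - 2 * \<epsilon>)"
    unfolding s_def
  proof (rule dunkl_laplacian_at_max[OF p(1) _ _ interior])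
    show "(U has_real_derivative dQ t - 2 * \<epsilon>) (at t)" if "0 \<le> t" "t < \<rho>\<^sup>2 / 2" for t
      unfolding U_def using that \<rho>(2) s1 by (auto intro!: derivative_eq_intros dQ)
    show "((\<lambda>t. dQ t - 2 * \<epsilon>) has_real_derivative ddQ ((norm x0)\<^sup>2 / 2)) (at ((norm x0)\<^sup>2 / 2))"
      using ddQ[OF s(1,3)] unfolding s_def by (auto intro!: derivative_eq_intros)
    show "p x - U ((norm x)\<^sup>2 / 2) \<le> p x0 - U ((norm x0)\<^sup>2 / 2)" if "norm x < \<rho>" for x
      using x0(2)[of x] that by simp
  qed
  also have "\<dots> = 2 * s * ddQ s + m * dQ s - 2 * m * \<epsilon>" by (simp add: s_def algebra_simps)
  also have "\<dots> \<le> \<phi> (Q s) - 2 * m * \<epsilon>" using super[OF s(1,3)] by simp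
  finally have up: "dunkl_laplacian R k p x0 \<le> \<phi> (Q s) - 2 * m * \<epsilon>" .
  have "Q s \<le> v x0" using f0 p(2)[OF x0(1)] es eps2 unfolding U_def by linarith
  then have "\<phi> (Q s) \<le> \<phi> (v x0)" using Qa[OF s(1,3)] a by (intro mono) auto
  then have "2 * m * \<epsilon> \<le> \<epsilon>" using up p(3)[OF x0(1)] by linarith
  then show False using eps m_gt by simp
qed

end

section \<open>The radial equation\<close>

lemma continuous_on_atLeast:
  fixes f :: "real \<Rightarrow> real"
  assumes "\<And>b. a \<le> b \<Longrightarrow> continuous_on {a..b} f"
  shows "continuous_on {a..} f"
  unfolding continuous_on_eq_continuous_within
proof
  fix x assume x: "x \<in> {a..}"
  have "continuous (at x within {a..x + 1}) f"
    using assms[of "x + 1"] x by (simp add: continuous_on_eq_continuous_within)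
  moreover have "at x within {a..} = at x within {a..x + 1}"
    by (rule at_within_nhd[of _ "{..<x + 1}"]) auto
  ultimately show "continuous (at x within {a..}) f" by simp
qed

locale radial_problem = nonlinearity +
  fixes m :: real
  assumes m2: "m > 2"
begin

text \<open>The radial equation \<open>(r\<^sup>m\<^sup>-\<^sup>1 u')' = r\<^sup>m\<^sup>-\<^sup>1 \<phi>(u)\<close> integrates to \<open>u' = r \<cdot> avg u r\<close>.  Scaling the integral to \<open>[0, 1]\<close> removes
the singularity at \<open>r = 0\<close>.\<close>

definition avg :: "(real \<Rightarrow> real) \<Rightarrow> real \<Rightarrow> real" where
  "avg u r = integral {0..1} (\<lambda>\<theta>. \<theta> powr (m - 1) * \<phi> (u (r * \<theta>)))"

text \<open>The fixed points of this monotone operator are the radial solutions with value \<open>a\<close> at \<open>0\<close>.\<close>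

definition T :: "real \<Rightarrow> (real \<Rightarrow> real) \<Rightarrow> real \<Rightarrow> real" where
  "T a u r = a + integral {0..r} (\<lambda>\<rho>. \<rho> * avg u \<rho>)"

lemma powr_continuous: "continuous_on {0..} (\<lambda>\<theta>::real. \<theta> powr (m - 1))"
  by (rule continuous_on_powr') (use m2 in \<open>auto intro!: continuous_intros\<close>)

lemma phi_u_continuous:
  assumes "continuous_on {0..} u" "\<And>r. 0 \<le> r \<Longrightarrow> 0 \<le> u r"
  shows "continuous_on {0..} (\<lambda>r. \<phi> (u r))"
  by (rule continuous_on_compose2[OF cont assms(1)]) (use assms(2) in auto)

lemma avg_integrand_continuous:
  assumes u: "continuous_on {0..} u" "\<And>r. 0 \<le> r \<Longrightarrow> 0 \<le> u r" and r: "0 \<le> r"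
  shows "continuous_on {0..1} (\<lambda>\<theta>. \<theta> powr (m - 1) * \<phi> (u (r * \<theta>)))"
proof (rule continuous_on_mult)
  show "continuous_on {0..1} (\<lambda>\<theta>::real. \<theta> powr (m - 1))"
    by (rule continuous_on_subset[OF powr_continuous]) auto
  show "continuous_on {0..1} (\<lambda>\<theta>. \<phi> (u (r * \<theta>)))"
    by (rule continuous_on_compose2[OF phi_u_continuous[OF u]]) (use r in \<open>auto intro!: continuous_intros\<close>)
qed

lemma avg_integrable:
  assumes u: "continuous_on {0..} u" "\<And>r. 0 \<le> r \<Longrightarrow> 0 \<le> u r" and r: "0 \<le> r"
  shows "(\<lambda>\<theta>. \<theta> powr (m - 1) * \<phi> (u (r * \<theta>))) integrable_on {0..1}"
  by (rule integrable_continuous_interval[OF avg_integrand_continuous[OF assms]])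

lemma avg_nonneg:
  assumes u: "continuous_on {0..} u" "\<And>r. 0 \<le> r \<Longrightarrow> 0 \<le> u r" and r: "0 \<le> r"
  shows "0 \<le> avg u r"
  unfolding avg_def by (rule integral_nonneg[OF avg_integrable[OF assms]]) (use u(2) nonneg r in auto)

lemma avg_continuous:
  assumes u: "continuous_on {0..} u" "\<And>r. 0 \<le> r \<Longrightarrow> 0 \<le> u r"
  shows "continuous_on {0..} (avg u)"
proof -
  have "continuous_on ({0..} \<times> cbox 0 1) (\<lambda>(r, \<theta>). \<theta> powr (m - 1) * \<phi> (u (r * \<theta>)))"
    unfolding split_beta
  proof (rule continuous_on_mult)
    show "continuous_on ({0..} \<times> cbox (0::real) 1) (\<lambda>x::real \<times> real. snd x powr (m - 1))"
      by (rule continuous_on_compose2[OF powr_continuous]) (auto intro!: continuous_intros)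
    show "continuous_on ({0..} \<times> cbox 0 1) (\<lambda>x. \<phi> (u (fst x * snd x)))"
      by (rule continuous_on_compose2[OF phi_u_continuous[OF u]]) (auto intro!: continuous_intros)
  qed
  from integral_continuous_on_param[OF this] show ?thesis unfolding avg_def[abs_def] by simp
qed

lemma avg_mono:
  assumes u: "continuous_on {0..} u" "\<And>r. 0 \<le> r \<Longrightarrow> 0 \<le> u r"
    and u': "continuous_on {0..} u'" and le: "\<And>r. 0 \<le> r \<Longrightarrow> u r \<le> u' r" and r: "0 \<le> r"
  shows "avg u r \<le> avg u' r"
proof -
  have u'0: "0 \<le> u' r" if "0 \<le> r" for r using u(2)[OF that] le[OF that] by simp
  show ?thesis unfolding avg_def
    by (rule integral_le[OF avg_integrable[OF u r] avg_integrable[OF u' u'0 r]])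
      (use u(2) le r in \<open>auto intro!: mult_left_mono mono\<close>)
qed

lemma rho_avg_integrable:
  assumes u: "continuous_on {0..} u" "\<And>r. 0 \<le> r \<Longrightarrow> 0 \<le> u r"
  shows "(\<lambda>\<rho>. \<rho> * avg u \<rho>) integrable_on {0..r}"
  by (rule integrable_continuous_interval, intro continuous_intros continuous_on_subset[OF avg_continuous[OF u]]) auto

lemma T_mono:
  assumes u: "continuous_on {0..} u" "\<And>r. 0 \<le> r \<Longrightarrow> 0 \<le> u r"
    and u': "continuous_on {0..} u'" and le: "\<And>r. 0 \<le> r \<Longrightarrow> u r \<le> u' r"
  shows "T a u r \<le> T a u' r"
proof -
  have u'0: "0 \<le> u' r" if "0 \<le> r" for r using u(2)[OF that] le[OF that] by simp
  have "integral {0..r} (\<lambda>\<rho>. \<rho> * avg u \<rho>) \<le> integral {0..r} (\<lambda>\<rho>. \<rho> * avg u' \<rho>)"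
    by (rule integral_le[OF rho_avg_integrable[OF u] rho_avg_integrable[OF u' u'0]])
      (use avg_mono[OF u u' le] in \<open>auto intro!: mult_left_mono\<close>)
  then show ?thesis by (simp add: T_def)
qed

lemma T_continuous:
  assumes u: "continuous_on {0..} u" "\<And>r. 0 \<le> r \<Longrightarrow> 0 \<le> u r"
  shows "continuous_on {0..} (T a u)"
  unfolding T_def[abs_def]
  by (rule continuous_on_atLeast, intro continuous_intros indefinite_integral_continuous_1 rho_avg_integrable[OF u])

lemma T_ge:
  assumes u: "continuous_on {0..} u" "\<And>r. 0 \<le> r \<Longrightarrow> 0 \<le> u r"
  shows "a \<le> T a u r"
proof -
  have "0 \<le> integral {0..r} (\<lambda>\<rho>. \<rho> * avg u \<rho>)"
    by (rule integral_nonneg[OF rho_avg_integrable[OF u]]) (use avg_nonneg[OF u] in auto)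
  then show ?thesis by (simp add: T_def)
qed

text \<open>Bounding \<open>\<theta> powr (m - 1)\<close> by 1 in the average drops the drift term and leaves \<open>r \<cdot> avg B r \<le> B' r - B' 0\<close>.\<close>

lemma one_dim_supersolution:
  assumes a: "0 < a" and B0: "B 0 = a"
    and dB: "\<And>s. 0 \<le> s \<Longrightarrow> (B has_real_derivative dB s) (at s)" "\<And>s. 0 \<le> s \<Longrightarrow> 0 \<le> dB s"
    and ddB: "\<And>s. 0 \<le> s \<Longrightarrow> (dB has_real_derivative \<phi> (B s)) (at s)"
    and Ba: "\<And>s. 0 \<le> s \<Longrightarrow> a \<le> B s" and r: "0 \<le> r"
  shows "T a B r \<le> B r"
proof -
  have Bc: "continuous_on {0..} B"
    using dB(1) by (intro continuous_at_imp_continuous_on ballI DERIV_isCont) auto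
  have B00: "0 \<le> B s" if "0 \<le> s" for s using Ba[OF that] a by simp
  have le: "\<rho> * avg B \<rho> \<le> dB \<rho>" if \<rho>: "0 \<le> \<rho>" for \<rho>
  proof -
    have "((\<lambda>\<theta>. \<rho> * \<phi> (B (\<rho> * \<theta>))) has_integral dB (\<rho> * 1) - dB (\<rho> * 0)) {0..1}"
    proof (rule fundamental_theorem_of_calculus)
      fix \<theta> :: real assume t: "\<theta> \<in> {0..1}"
      have "((\<lambda>\<theta>. dB (\<rho> * \<theta>)) has_real_derivative \<phi> (B (\<rho> * \<theta>)) * \<rho>) (at \<theta>)"
        by (rule DERIV_chain2[OF ddB]) (use \<rho> t in \<open>auto intro!: derivative_eq_intros\<close>)
      then show "((\<lambda>\<theta>. dB (\<rho> * \<theta>)) has_vector_derivative \<rho> * \<phi> (B (\<rho> * \<theta>))) (at \<theta> within {0..1})"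
        by (simp add: mult.commute has_real_derivative_iff_has_vector_derivative has_vector_derivative_at_within)
    qed simp
    then have i: "((\<lambda>\<theta>. \<rho> * \<phi> (B (\<rho> * \<theta>))) has_integral dB \<rho> - dB 0) {0..1}" by simp
    have "\<rho> * avg B \<rho> = integral {0..1} (\<lambda>\<theta>. \<rho> * (\<theta> powr (m - 1) * \<phi> (B (\<rho> * \<theta>))))"
      unfolding avg_def by (rule integral_mult_right[symmetric])
    also have "\<dots> \<le> integral {0..1} (\<lambda>\<theta>. \<rho> * \<phi> (B (\<rho> * \<theta>)))"
    proof (rule integral_le)
      show "(\<lambda>\<theta>. \<rho> * (\<theta> powr (m - 1) * \<phi> (B (\<rho> * \<theta>)))) integrable_on {0..1}"
        by (rule integrable_on_mult_right[OF avg_integrable[OF Bc B00 \<rho>]])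
      show "(\<lambda>\<theta>. \<rho> * \<phi> (B (\<rho> * \<theta>))) integrable_on {0..1}" using i by (rule has_integral_integrable)
      fix \<theta> :: real assume t: "\<theta> \<in> {0..1}"
      have "\<theta> powr (m - 1) \<le> 1" using t m2 by (intro powr_le1) auto
      moreover have "0 \<le> \<phi> (B (\<rho> * \<theta>))" using t \<rho> B00 by (intro nonneg) auto
      ultimately have "\<theta> powr (m - 1) * \<phi> (B (\<rho> * \<theta>)) \<le> 1 * \<phi> (B (\<rho> * \<theta>))" by (intro mult_right_mono)
      then show "\<rho> * (\<theta> powr (m - 1) * \<phi> (B (\<rho> * \<theta>))) \<le> \<rho> * \<phi> (B (\<rho> * \<theta>))"
        using \<rho> by (simp add: mult_left_mono)
    qed
    also have "\<dots> = dB \<rho> - dB 0" using i by (rule integral_unique)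
    finally show ?thesis using dB(2)[of 0] by simp
  qed
  have "(dB has_integral B r - B 0) {0..r}"
    by (rule fundamental_theorem_of_calculus[OF r])
      (use dB(1) in \<open>auto simp: has_real_derivative_iff_has_vector_derivative[symmetric] intro: has_field_derivative_at_within\<close>)
  moreover have "integral {0..r} (\<lambda>\<rho>. \<rho> * avg B \<rho>) \<le> integral {0..r} dB"
    by (rule integral_le[OF rho_avg_integrable[OF Bc B00]]) (use le calculation in \<open>auto intro: has_integral_integrable\<close>)
  ultimately show ?thesis using B0 by (simp add: T_def integral_unique)
qed

text \<open>The iterates of \<open>T a\<close> starting from the constant \<open>a\<close> increase and stay below \<open>B\<close>; dominated convergence, applied to both
integrals, shows that their limit is a fixed point.\<close>

lemma radial_solution_exists:
  assumes a: "0 < a" and Bc: "continuous_on {0..} B" and Ba: "\<And>s. 0 \<le> s \<Longrightarrow> a \<le> B s"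
    and TB: "\<And>r. 0 \<le> r \<Longrightarrow> T a B r \<le> B r"
  obtains u where "continuous_on {0..} u" "\<And>r. 0 \<le> r \<Longrightarrow> a \<le> u r" "\<And>r. 0 \<le> r \<Longrightarrow> u r = T a u r"
proof -
  define U where "U = (\<lambda>j. (T a ^^ j) (\<lambda>_. a))"
  have U0: "U 0 = (\<lambda>_. a)" and US: "U (Suc j) = T a (U j)" for j by (simp_all add: U_def)
  have inv: "continuous_on {0..} (U j) \<and> (\<forall>r\<ge>0. a \<le> U j r \<and> U j r \<le> B r)" for j
  proof (induction j)
    case 0 then show ?case using Ba by (simp add: U0)
  next
    case (Suc j)
    have c: "continuous_on {0..} (U j)" and p: "\<And>r. 0 \<le> r \<Longrightarrow> 0 \<le> U j r" and le: "\<And>r. 0 \<le> r \<Longrightarrow> U j r \<le> B r"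
      using Suc a by (auto intro: order_trans[OF less_imp_le])
    have "T a (U j) r \<le> B r" if "0 \<le> r" for r
      using T_mono[OF c p Bc le, of a r] TB[OF that] by simp
    then show ?case unfolding US using T_continuous[OF c p] T_ge[OF c p] by auto
  qed
  have Uc: "continuous_on {0..} (U j)" and Ua: "\<And>r. 0 \<le> r \<Longrightarrow> a \<le> U j r"
    and UB: "\<And>r. 0 \<le> r \<Longrightarrow> U j r \<le> B r" for j using inv[of j] by auto
  have Up: "0 \<le> U j r" if "0 \<le> r" for j r using Ua[OF that, of j] a by simp
  have Bp: "0 \<le> B r" if "0 \<le> r" for r using Ba[OF that] a by simp
  have step: "U j r \<le> U (Suc j) r" if "0 \<le> r" for j r
    using that
  proof (induction j arbitrary: r)
    case 0 then show ?case using T_ge[OF Uc Up, of a 0 r] unfolding US by (simp add: U0)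
  next
    case (Suc j)
    show ?case using T_mono[OF Uc Up Uc Suc.IH, of a r] unfolding US by simp
  qed
  have "\<exists>L. (\<lambda>j. U j r) \<longlonglongrightarrow> L" if "0 \<le> r" for r
  proof -
    have "incseq (\<lambda>j. U j r)" using step[OF that] by (intro incseq_SucI)
    then show ?thesis using UB[OF that] incseq_convergent[of "\<lambda>j. U j r" "B r"] by blast
  qed
  then obtain u where lim: "\<And>r. 0 \<le> r \<Longrightarrow> (\<lambda>j. U j r) \<longlonglongrightarrow> u r" by metis
  have ua: "a \<le> u r" if "0 \<le> r" for r
    using LIMSEQ_le_const[OF lim[OF that], of a] Ua[OF that] by blast
  have avg_lim: "(\<lambda>j. avg (U j) r) \<longlonglongrightarrow> avg u r" if r: "0 \<le> r" for r
    unfolding avg_def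
  proof (rule dominated_convergence(2))
    show "(\<lambda>\<theta>. \<theta> powr (m - 1) * \<phi> (U j (r * \<theta>))) integrable_on {0..1}" for j
      by (rule avg_integrable[OF Uc Up r])
    show "(\<lambda>\<theta>. \<theta> powr (m - 1) * \<phi> (B (r * \<theta>))) integrable_on {0..1}"
      by (rule avg_integrable[OF Bc Bp r])
    fix \<theta> :: real assume t: "\<theta> \<in> {0..1}"
    then have rt: "0 \<le> r * \<theta>" using r by simp
    show "norm (\<theta> powr (m - 1) * \<phi> (U j (r * \<theta>))) \<le> \<theta> powr (m - 1) * \<phi> (B (r * \<theta>))" for j
      using nonneg[OF Up[OF rt, of j]] mono[OF Up[OF rt, of j] UB[OF rt, of j]] by (simp add: mult_left_mono)
    have "(\<lambda>j. \<phi> (U j (r * \<theta>))) \<longlonglongrightarrow> \<phi> (u (r * \<theta>))"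
      by (rule continuous_on_tendsto_compose[OF cont lim[OF rt]]) (use ua[OF rt] a Up[OF rt] in auto)
    then show "(\<lambda>j. \<theta> powr (m - 1) * \<phi> (U j (r * \<theta>))) \<longlonglongrightarrow> \<theta> powr (m - 1) * \<phi> (u (r * \<theta>))"
      by (intro tendsto_intros)
  qed
  have T_lim: "(\<lambda>\<rho>. \<rho> * avg u \<rho>) integrable_on {0..r}"
    "(\<lambda>j. integral {0..r} (\<lambda>\<rho>. \<rho> * avg (U j) \<rho>)) \<longlonglongrightarrow> integral {0..r} (\<lambda>\<rho>. \<rho> * avg u \<rho>)" for r
  proof -
    have 1: "(\<lambda>\<rho>. \<rho> * avg (U j) \<rho>) integrable_on {0..r}" for j by (rule rho_avg_integrable[OF Uc Up])
    have 2: "(\<lambda>\<rho>. \<rho> * avg B \<rho>) integrable_on {0..r}" by (rule rho_avg_integrable[OF Bc Bp])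
    have 3: "norm (\<rho> * avg (U j) \<rho>) \<le> \<rho> * avg B \<rho>" if "\<rho> \<in> {0..r}" for \<rho> j
      using avg_nonneg[OF Uc Up, of \<rho> j] avg_mono[OF Uc Up Bc UB, of \<rho> j] that by (simp add: mult_left_mono)
    have 4: "(\<lambda>j. \<rho> * avg (U j) \<rho>) \<longlonglongrightarrow> \<rho> * avg u \<rho>" if "\<rho> \<in> {0..r}" for \<rho>
      using that by (intro tendsto_intros avg_lim) auto
    show "(\<lambda>\<rho>. \<rho> * avg u \<rho>) integrable_on {0..r}" by (rule dominated_convergence(1)[OF 1 2 3 4])
    show "(\<lambda>j. integral {0..r} (\<lambda>\<rho>. \<rho> * avg (U j) \<rho>)) \<longlonglongrightarrow> integral {0..r} (\<lambda>\<rho>. \<rho> * avg u \<rho>)"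
      by (rule dominated_convergence(2)[OF 1 2 3 4])
  qed
  have uT: "u r = T a u r" if "0 \<le> r" for r
  proof (rule LIMSEQ_unique)
    show "(\<lambda>j. U (Suc j) r) \<longlonglongrightarrow> u r" using lim[OF that] by (rule LIMSEQ_Suc)
    show "(\<lambda>j. U (Suc j) r) \<longlonglongrightarrow> T a u r" unfolding US T_def by (intro tendsto_intros T_lim)
  qed
  have "continuous_on {0..} (T a u)" unfolding T_def[abs_def]
    by (rule continuous_on_atLeast, intro continuous_intros indefinite_integral_continuous_1 T_lim)
  then have "continuous_on {0..} u" by (rule continuous_on_eq) (simp add: uT)
  then show ?thesis using ua uT by (rule that)
qed

text \<open>Away from \<open>0\<close> the average is differentiated through \<open>r\<^sup>m avg u r = \<integral>\<^sub>0\<^sup>r \<tau>\<^sup>m\<^sup>-\<^sup>1 \<phi>(u \<tau>) d\<tau>\<close>.  The last equation says that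
the radial second derivative and the average agree at \<open>0\<close>, which makes \<open>u(\<bar>x\<bar>)\<close> twice continuously
differentiable there.\<close>

lemma radial_solution_derivatives:
  assumes u: "continuous_on {0..} u" "\<And>r. 0 \<le> r \<Longrightarrow> 0 \<le> u r" and uT: "\<And>r. 0 \<le> r \<Longrightarrow> u r = T a u r"
  shows "0 < r \<Longrightarrow> (u has_real_derivative r * avg u r) (at r)"
    "(u has_real_derivative 0) (at 0 within {0..1})"
    "0 < r \<Longrightarrow> (avg u has_real_derivative (\<phi> (u r) - m * avg u r) / r) (at r)"
    "m * avg u 0 = \<phi> (u 0)"
proof -
  have c: "continuous_on {0..} (\<lambda>\<rho>. \<rho> * avg u \<rho>)" by (intro continuous_intros avg_continuous[OF u])
  show "(u has_real_derivative r * avg u r) (at r)" if r: "0 < r"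
  proof -
    have "(T a u has_real_derivative 0 + r * avg u r) (at r)"
      unfolding T_def[abs_def] by (intro DERIV_add DERIV_const integral_derivative_at[OF c r])
    then have "(T a u has_real_derivative r * avg u r) (at r)" by simp
    then show ?thesis
      by (rule has_field_derivative_transform_within_open[of _ _ _ "{0<..}"]) (use r uT in auto)
  qed
  show "(u has_real_derivative 0) (at 0 within {0..1})"
  proof -
    have "((\<lambda>r. integral {0..r} (\<lambda>\<rho>. \<rho> * avg u \<rho>)) has_real_derivative 0 * avg u 0) (at 0 within {0..1})"
      by (rule integral_has_real_derivative) (auto intro: continuous_on_subset[OF c])
    then have "(T a u has_real_derivative 0 + 0 * avg u 0) (at 0 within {0..1})"
      unfolding T_def[abs_def] by (intro DERIV_add DERIV_const)
    then have "(T a u has_real_derivative 0) (at 0 within {0..1})" by simp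
    then show ?thesis
      by (rule has_field_derivative_transform_within[of _ _ _ _ 1]) (use uT in auto)
  qed
  define j where "j = (\<lambda>\<tau>. \<tau> powr (m - 1) * \<phi> (u \<tau>))"
  define J where "J = (\<lambda>r. integral {0..r} j)"
  have jc: "continuous_on {0..} j" unfolding j_def
    by (intro continuous_on_mult powr_continuous phi_u_continuous[OF u])
  have Jd: "(J has_real_derivative j r) (at r)" if "0 < r" for r
    unfolding J_def by (rule integral_derivative_at[OF jc that])
  have Jc: "continuous_on {0..} J" unfolding J_def
    by (rule continuous_on_atLeast, intro indefinite_integral_continuous_1 integrable_continuous_interval)
      (auto intro: continuous_on_subset[OF jc])
  have J: "r powr m * avg u r = J r" if r: "0 < r" for r
  proof -
    have "((\<lambda>\<theta>. r powr m * (\<theta> powr (m - 1) * \<phi> (u (r * \<theta>)))) has_integral J (r * 1) - J (r * 0)) {0..1}"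
    proof (rule fundamental_theorem_of_calculus_interior)
      show "continuous_on {0..1} (\<lambda>\<theta>. J (r * \<theta>))"
        by (rule continuous_on_compose2[OF Jc]) (use r in \<open>auto intro!: continuous_intros\<close>)
      fix \<theta> :: real assume t: "\<theta> \<in> {0<..<1}"
      have "((\<lambda>\<theta>. J (r * \<theta>)) has_real_derivative j (r * \<theta>) * r) (at \<theta>)"
        by (rule DERIV_chain2[OF Jd]) (use r t in \<open>auto intro!: derivative_eq_intros\<close>)
      moreover have "j (r * \<theta>) * r = r powr m * (\<theta> powr (m - 1) * \<phi> (u (r * \<theta>)))"
      proof -
        have "r powr m = r powr (m - 1) * r" using r powr_add[of r "m - 1" 1] by simp
        then show ?thesis using r t by (simp add: j_def powr_mult)
      qed
      ultimately show "((\<lambda>\<theta>. J (r * \<theta>)) has_vector_derivative r powr m * (\<theta> powr (m - 1) * \<phi> (u (r * \<theta>)))) (at \<theta>)"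
        by (simp add: has_real_derivative_iff_has_vector_derivative)
    qed simp
    from integral_unique[OF this] show ?thesis
      unfolding avg_def by (simp add: J_def)
  qed
  show "(avg u has_real_derivative (\<phi> (u r) - m * avg u r) / r) (at r)" if r: "0 < r"
  proof -
    have "((\<lambda>r. J r * r powr (- m)) has_real_derivative j r * r powr (- m) + (- m * r powr (- m - 1)) * J r) (at r)"
      by (rule DERIV_mult[OF Jd[OF r]]) (use r in \<open>auto intro!: derivative_eq_intros\<close>)
    also have "j r * r powr (- m) + (- m * r powr (- m - 1)) * J r = (\<phi> (u r) - m * avg u r) / r"
    proof -
      have 1: "r powr (m - 1) * r powr (- m) = 1 / r"
        unfolding powr_add[symmetric] using r by (simp add: powr_minus_divide)
      have 2: "r powr (- m - 1) * r powr m = 1 / r"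
        unfolding powr_add[symmetric] using r by (simp add: powr_minus_divide)
      have "j r * r powr (- m) = (r powr (m - 1) * r powr (- m)) * \<phi> (u r)" by (simp add: j_def)
      moreover have "(- m * r powr (- m - 1)) * J r = - m * (r powr (- m - 1) * r powr m) * avg u r"
        unfolding J[OF r, symmetric] by simp
      ultimately show ?thesis unfolding 1 2 by (simp add: diff_divide_distrib)
    qed
    finally show ?thesis
    proof (rule has_field_derivative_transform_within_open[of _ _ _ "{0<..}"])
      fix x :: real assume x: "x \<in> {0<..}"
      have "J x = x powr m * avg u x" using J[of x] x by simp
      then have "J x * x powr (- m) = avg u x * (x powr m * x powr (- m))" by (simp only: mult_ac)
      also have "x powr m * x powr (- m) = 1" using x by (simp flip: powr_add)
      finally show "J x * x powr (- m) = avg u x" by simp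
    qed (use r in auto)
  qed
  show "m * avg u 0 = \<phi> (u 0)"
  proof -
    have "((\<lambda>\<theta>::real. \<theta> powr (m - 1)) has_integral 1 powr m / m - 0 powr m / m) {0..1}"
    proof (rule fundamental_theorem_of_calculus_interior)
      show "continuous_on {0..1} (\<lambda>\<theta>::real. \<theta> powr m / m)"
        by (intro continuous_on_divide continuous_on_powr') (use m2 in \<open>auto intro!: continuous_intros\<close>)
      show "((\<lambda>\<theta>. \<theta> powr m / m) has_vector_derivative x powr (m - 1)) (at x)" if "x \<in> {0<..<1}" for x
        unfolding has_real_derivative_iff_has_vector_derivative[symmetric]
        using that m2 by (auto intro!: derivative_eq_intros)
    qed simp
    from integral_unique[OF this] have "integral {0..1} (\<lambda>\<theta>. \<theta> powr (m - 1)) = 1 / m" using m2 by simp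
    then show ?thesis using m2 unfolding avg_def by simp
  qed
qed

end

section \<open>Radial solutions are entire solutions\<close>

lemma filterlim_norm_at_0: "filterlim norm (at 0 within {0..1}) (at (0::'a::real_normed_vector))"
  unfolding filterlim_at
proof (intro conjI)
  show "(norm \<longlongrightarrow> 0) (at (0::'a))" by (rule tendsto_norm_zero) (rule tendsto_ident_at)
  have "\<forall>\<^sub>F x in at (0::'a). dist x 0 < 1" by (rule eventually_at_ball[of 1, THEN eventually_mono]) (auto simp: dist_commute)
  then show "\<forall>\<^sub>F x in at (0::'a). norm x \<in> {0..1} \<and> norm x \<noteq> 0"
    by (simp add: eventually_at_filter) (auto elim!: eventually_mono)
qed

context dunkl_setting
begin

text \<open>Here \<open>h = u'/r\<close> and \<open>d = r h'\<close>.  The Hessian is the sum of a multiple of the identity and a multiple of the projection to the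
radial direction; \<open>d 0 = 0\<close> makes the latter continuous at the origin.\<close>

lemma radial_has_grad_hess:
  fixes u h d :: "real \<Rightarrow> real"
  assumes du: "\<And>r. 0 < r \<Longrightarrow> (u has_real_derivative r * h r) (at r)"
    and du0: "(u has_real_derivative 0) (at 0 within {0..1})"
    and dh: "\<And>r. 0 < r \<Longrightarrow> (h has_real_derivative d r / r) (at r)"
    and hc: "continuous_on {0..} h" and dc: "continuous_on {0..} d" and d0: "d 0 = 0"
  shows "has_grad_hess (\<lambda>x::'a. u (norm x)) (\<lambda>x. h (norm x) *\<^sub>R x)
    (\<lambda>x b. h (norm x) *\<^sub>R b + (d (norm x) / (norm x)\<^sup>2 * (x \<bullet> b)) *\<^sub>R x)"
  unfolding has_grad_hess_def
proof (intro conjI allI)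
  have hn: "continuous_on UNIV (\<lambda>x::'a. h (norm x))" and dn: "continuous_on UNIV (\<lambda>x::'a. d (norm x))"
    by (rule continuous_on_compose2[OF hc] continuous_on_compose2[OF dc], auto intro!: continuous_intros)+
  fix x b :: 'a
  show "((\<lambda>x. u (norm x)) has_derivative (\<lambda>b. h (norm x) *\<^sub>R x \<bullet> b)) (at x)"
  proof (cases "x = 0")
    case False
    have "((\<lambda>x. u (norm x)) has_derivative (\<lambda>b. norm x * h (norm x) * (sgn x \<bullet> b))) (at x)"
      using has_derivative_compose[OF has_derivative_norm[OF False] du[of "norm x", unfolded has_field_derivative_def]] False
      by (simp add: inner_commute)
    then show ?thesis using False by (simp add: sgn_div_norm mult.assoc mult.left_commute)
  next
    case True
    have "((\<lambda>y. (u y - u 0) / (y - 0)) \<longlongrightarrow> 0) (at 0 within {0..1})"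
      using du0 by (simp add: has_field_derivative_iff)
    from tendsto_norm_zero[OF filterlim_compose[OF this filterlim_norm_at_0]]
    have "((\<lambda>y::'a. norm (u (norm y) - u 0) / norm y) \<longlongrightarrow> 0) (at 0)" by simp
    then show ?thesis unfolding has_derivative_at True by (simp add: bounded_linear_inner_right)
  qed
  show "((\<lambda>x. h (norm x) *\<^sub>R x) has_derivative
      (\<lambda>b. h (norm x) *\<^sub>R b + (d (norm x) / (norm x)\<^sup>2 * (x \<bullet> b)) *\<^sub>R x)) (at x)"
  proof (cases "x = 0")
    case False
    have "((\<lambda>x. h (norm x)) has_derivative (\<lambda>b. d (norm x) / norm x * (sgn x \<bullet> b))) (at x)"
      using has_derivative_compose[OF has_derivative_norm[OF False] dh[of "norm x", unfolded has_field_derivative_def]] False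
      by (simp add: inner_commute)
    from has_derivative_scaleR[OF this has_derivative_ident] show ?thesis
      by (rule has_derivative_eq_rhs) (auto simp: fun_eq_iff sgn_div_norm power2_eq_square divide_inverse mult.assoc)
  next
    case True
    have "isCont (\<lambda>x::'a. h (norm x)) 0" using hn by (simp add: continuous_on_eq_continuous_at)
    then have "((\<lambda>y::'a. h (norm y) - h 0) \<longlongrightarrow> 0) (at 0)" by (simp add: isCont_def LIM_zero)
    then have l: "((\<lambda>y::'a. norm (h (norm y) - h 0)) \<longlongrightarrow> 0) (at 0)" by (rule tendsto_norm_zero)
    have "\<forall>\<^sub>F y::'a in at 0. norm (h (norm y) - h 0) = norm (h (norm y) *\<^sub>R y - h 0 *\<^sub>R y) / norm y"
      unfolding eventually_at_filter
      by (intro always_eventually) (auto simp flip: scaleR_diff_left)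
    from Lim_transform_eventually[OF l this]
    show ?thesis unfolding has_derivative_at True by (simp add: bounded_linear_scaleR_right)
  qed
  show "continuous_on UNIV (\<lambda>x. h (norm x) *\<^sub>R b + (d (norm x) / (norm x)\<^sup>2 * (x \<bullet> b)) *\<^sub>R x)"
  proof (rule continuous_on_add)
    show "continuous_on UNIV (\<lambda>x::'a. h (norm x) *\<^sub>R b)" by (intro continuous_on_scaleR hn continuous_on_const)
    show "continuous_on UNIV (\<lambda>x. (d (norm x) / (norm x)\<^sup>2 * (x \<bullet> b)) *\<^sub>R x)"
    proof (intro continuous_at_imp_continuous_on ballI)
      fix x :: 'a
      show "isCont (\<lambda>x. (d (norm x) / (norm x)\<^sup>2 * (x \<bullet> b)) *\<^sub>R x) x"
      proof (cases "x = 0")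
        case False
        have "continuous_on (- {0}) (\<lambda>x. (d (norm x) / (norm x)\<^sup>2 * (x \<bullet> b)) *\<^sub>R x)"
          by (intro continuous_intros continuous_on_subset[OF dn]) auto
        then show ?thesis using False by (simp add: continuous_on_eq_continuous_at open_Compl)
      next
        case True
        have "isCont (\<lambda>x::'a. d (norm x)) 0" using dn by (simp add: continuous_on_eq_continuous_at)
        then have "((\<lambda>y::'a. d (norm y)) \<longlongrightarrow> 0) (at 0)" using d0 by (simp add: isCont_def)
        from tendsto_mult_left_zero[OF tendsto_norm_zero[OF this], of "norm b"]
        have l: "((\<lambda>y::'a. norm (d (norm y)) * norm b) \<longlongrightarrow> 0) (at 0)" .
        have "((\<lambda>y::'a. (d (norm y) / (norm y)\<^sup>2 * (y \<bullet> b)) *\<^sub>R y) \<longlongrightarrow> 0) (at 0)"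
        proof (rule Lim_null_comparison[OF _ l], intro always_eventually allI)
          fix y :: 'a
          show "norm ((d (norm y) / (norm y)\<^sup>2 * (y \<bullet> b)) *\<^sub>R y) \<le> norm (d (norm y)) * norm b"
          proof (cases "y = 0")
            case False
            have "norm ((d (norm y) / (norm y)\<^sup>2 * (y \<bullet> b)) *\<^sub>R y) = \<bar>d (norm y)\<bar> / norm y * \<bar>y \<bullet> b\<bar>"
              using False by (simp add: abs_mult power2_eq_square)
            also have "\<dots> \<le> \<bar>d (norm y)\<bar> / norm y * (norm y * norm b)"
              by (intro mult_left_mono Cauchy_Schwarz_ineq2) auto
            finally show ?thesis using False by simp
          qed simp
        qed
        then show ?thesis using True by (simp add: isCont_def)
      qed
    qed
  qed
qed

lemma dunkl_laplacian_radial: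
  fixes u h d :: "real \<Rightarrow> real"
  assumes gh: "has_grad_hess (\<lambda>x::'a. u (norm x)) (\<lambda>x. h (norm x) *\<^sub>R x)
    (\<lambda>x b. h (norm x) *\<^sub>R b + (d (norm x) / (norm x)\<^sup>2 * (x \<bullet> b)) *\<^sub>R x)"
    and d0: "d 0 = 0"
  shows "dunkl_laplacian R k (\<lambda>x. u (norm x)) x = m * h (norm x) + d (norm x)"
proof -
  have "(\<Sum>b\<in>Basis. (h (norm x) *\<^sub>R b + (d (norm x) / (norm x)\<^sup>2 * (x \<bullet> b)) *\<^sub>R x) \<bullet> b)
     = (\<Sum>b\<in>Basis. h (norm x) + d (norm x) / (norm x)\<^sup>2 * ((x \<bullet> b) * (x \<bullet> b)))"
    by (intro sum.cong refl) (simp add: inner_add_left)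
  also have "\<dots> = real DIM('a) * h (norm x) + d (norm x) / (norm x)\<^sup>2 * (x \<bullet> x)"
    unfolding sum.distrib sum_distrib_left[symmetric] euclidean_inner[symmetric] by simp
  also have "d (norm x) / (norm x)\<^sup>2 * (x \<bullet> x) = d (norm x)"
    using d0 by (cases "x = 0") (auto simp: power2_norm_eq_inner)
  finally have lap: "(\<Sum>b\<in>Basis. (h (norm x) *\<^sub>R b + (d (norm x) / (norm x)\<^sup>2 * (x \<bullet> b)) *\<^sub>R x) \<bullet> b)
     = real DIM('a) * h (norm x) + d (norm x)" .
  have "dunkl_term_C2 \<alpha> (\<lambda>x. u (norm x)) (\<lambda>x. h (norm x) *\<^sub>R x)
     (\<lambda>x b. h (norm x) *\<^sub>R b + (d (norm x) / (norm x)\<^sup>2 * (x \<bullet> b)) *\<^sub>R x) x = h (norm x)" if "\<alpha> \<in> R" for \<alpha>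
  proof (cases "\<alpha> \<bullet> x = 0")
    case True
    then have "x \<bullet> \<alpha> = 0" by (simp add: inner_commute)
    moreover have "norm \<alpha> \<noteq> 0" using R_nonzero[OF that] by simp
    ultimately show ?thesis using True unfolding dunkl_term_C2_def
      by (simp add: inner_add_left flip: power2_norm_eq_inner)
  next
    case False
    then show ?thesis unfolding dunkl_term_C2_def by (simp add: inner_commute)
  qed
  then show ?thesis unfolding dunkl_laplacian_eq[OF gh] lap m_eq
    by (simp add: sum_distrib_right distrib_right)
qed

lemma entire_solution_if_C2:
  assumes gh: "has_grad_hess v g H" and pos: "\<And>x. 0 < v x"
    and eq: "\<And>x. dunkl_laplacian R k v x = \<phi> (v x)"
  shows "entire_positive_solution R k \<phi> v"
  unfolding entire_positive_solution_def
proof (intro conjI allI ballI pos)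
  show "continuous_on UNIV v" by (rule has_grad_hess_continuous[OF gh])
  fix \<psi> :: "'a \<Rightarrow> real" assume "\<psi> \<in> test_functions"
  then have sm: "smooth \<psi>" and "compact (closure {x. \<psi> x \<noteq> 0})" by (auto simp: test_functions_def)
  then have "bounded (closure {x. \<psi> x \<noteq> 0})" by (simp add: compact_imp_bounded)
  then obtain \<rho> where \<rho>: "\<And>x. x \<in> closure {x. \<psi> x \<noteq> 0} \<Longrightarrow> norm x \<le> \<rho>"
    unfolding bounded_iff by blast
  have out: "\<psi> x = 0" if "norm x > \<rho>" for x
    using \<rho>[of x] closure_subset[of "{x. \<psi> x \<noteq> 0}"] that by force
  show "(LINT x|lborel. v x * dunkl_laplacian R k \<psi> x * w x) = (LINT x|lborel. \<phi> (v x) * \<psi> x * w x)"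
    using dunkl_green[OF gh has_grad_hess_smooth[OF sm] out] unfolding eq .
qed

lemma entire_solution_exists:
  assumes nl: "nonlinearity \<phi>" and ko: "keller_osserman \<phi>"
  shows "\<exists>v. entire_positive_solution R k \<phi> v"
proof -
  interpret nonlinearity \<phi> by (rule nl)
  show ?thesis
  proof (cases "\<exists>t>0. \<Phi> t = 0")
    case True
    then obtain t where t: "t > 0" "\<Phi> t = 0" by blast
    have "\<phi> (t / 2) = 0" using \<Phi>_zero_imp[OF t(2), of "t / 2"] t by simp
    then have "entire_positive_solution R k \<phi> (\<lambda>x. t / 2)"
      using t by (intro entire_solution_if_C2[OF has_grad_hess_const]) (auto simp: dunkl_laplacian_const)
    then show ?thesis by blast
  next
    case False
    then have pos: "0 < \<Phi> t" if "0 < t" for t using \<Phi>_nonneg[of t] that by (simp add: less_le) force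
    interpret radial_problem \<phi> m by unfold_locales (rule m_gt)
    obtain a B dB where a: "0 < a" and B: "B 0 = a"
      "\<And>s. 0 \<le> s \<Longrightarrow> (B has_real_derivative dB s) (at s)" "\<And>s. 0 \<le> s \<Longrightarrow> 0 \<le> dB s"
      "\<And>s. 0 \<le> s \<Longrightarrow> (dB has_real_derivative \<phi> (B s)) (at s)" "\<And>s. 0 \<le> s \<Longrightarrow> a \<le> B s"
      by (rule global_one_dim_solution[OF ko pos]) (assumption, rule that, assumption+)
    have Bc: "continuous_on {0..} B"
      using B(2) by (intro continuous_at_imp_continuous_on ballI DERIV_isCont) auto
    obtain u where u: "continuous_on {0..} u" "\<And>r. 0 \<le> r \<Longrightarrow> a \<le> u r" "\<And>r. 0 \<le> r \<Longrightarrow> u r = T a u r"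
      using radial_solution_exists[OF a Bc B(5) one_dim_supersolution[OF a B]] by blast
    have u0: "0 \<le> u r" if "0 \<le> r" for r using u(2)[OF that] a by simp
    define d where "d = (\<lambda>r. \<phi> (u r) - m * avg u r)"
    note der = radial_solution_derivatives[OF u(1) u0 u(3)]
    have d0: "d 0 = 0" using der(4) by (simp add: d_def)
    have dc: "continuous_on {0..} d" unfolding d_def
      by (intro continuous_intros phi_u_continuous[OF u(1) u0] avg_continuous[OF u(1) u0])
    have gh: "has_grad_hess (\<lambda>x::'a. u (norm x)) (\<lambda>x. avg u (norm x) *\<^sub>R x)
      (\<lambda>x b. avg u (norm x) *\<^sub>R b + (d (norm x) / (norm x)\<^sup>2 * (x \<bullet> b)) *\<^sub>R x)"
      by (rule radial_has_grad_hess[OF der(1,2) _ avg_continuous[OF u(1) u0] dc d0]) (simp_all add: d_def der(3))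
    have "entire_positive_solution R k \<phi> (\<lambda>x. u (norm x))"
    proof (rule entire_solution_if_C2[OF gh])
      show "0 < u (norm x)" for x :: 'a using u(2)[of "norm x"] a by simp
      show "dunkl_laplacian R k (\<lambda>x. u (norm x)) x = \<phi> (u (norm x))" for x
        unfolding dunkl_laplacian_radial[OF gh d0] by (simp add: d_def)
    qed
    then show ?thesis by blast
  qed
qed

end

section \<open>The Keller-Osserman criterion\<close>

lemma nonlinearityI:
  assumes "\<forall>t\<ge>0. \<phi> t \<ge> 0" "locally_lipschitz_on {0..} \<phi>" "mono_on {0..} \<phi>"
  shows "nonlinearity \<phi>"
proof
  have "local_lipschitz {0::real} {0..} (\<lambda>_. \<phi>)" using assms(2) by (simp add: locally_lipschitz_on_def)
  then show "continuous_on {0..} \<phi>" by (rule local_lipschitz_continuous_on) simp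
qed (use assms in \<open>auto simp: mono_on_def\<close>)

theorem theorem7p5:
  fixes R :: "'a::euclidean_space set" and k :: "'a \<Rightarrow> real" and \<phi> :: "real \<Rightarrow> real"
  assumes "root_system R"
    and "pos_multiplicity R k"
    and "real DIM('a) + (\<Sum>\<alpha>\<in>R. k \<alpha>) > 2"
    and "\<forall>t\<ge>0. \<phi> t \<ge> 0"
    and "locally_lipschitz_on {0..} \<phi>"
    and "mono_on {0..} \<phi>"
    and "\<phi> 0 = 0"
    and "\<exists>t\<ge>0. \<phi> t \<noteq> 0"
  shows "(\<exists>v. entire_positive_solution R k \<phi> v) \<longleftrightarrow> keller_osserman \<phi>"
proof -
  interpret dunkl_setting R k "real DIM('a) + (\<Sum>\<alpha>\<in>R. k \<alpha>)"
    by unfold_locales (use assms in auto)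
  have nl: "nonlinearity \<phi>" by (rule nonlinearityI[OF assms(4-6)])
  show ?thesis
  proof
    assume "\<exists>v. entire_positive_solution R k \<phi> v"
    then obtain v where v: "entire_positive_solution R k \<phi> v" by blast
    then have "0 < v 0" by (simp add: entire_positive_solution_def)
    show "keller_osserman \<phi>"
    proof (rule ccontr)
      assume "\<not> keller_osserman \<phi>"
      from entire_solution_le[OF nl v this, of "v 0 / 2"] \<open>0 < v 0\<close> show False by simp
    qed
  next
    assume "keller_osserman \<phi>"
    then show "\<exists>v. entire_positive_solution R k \<phi> v" by (rule entire_solution_exists[OF nl])
  qed
qed

end
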